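(* Let $n \ge 2$. Let $f : \mathbb{R}^n \to [0,\infty)$ be continuous with compact support, and let $K$ be a compact set in $\mathbb{R}^n$ with radially negligible boundary. Then for each $g \in \{f, 1_K\}$ the limit $$\mathcal{I}_0(g) := \lim_{p \to -1^+} \frac{p+1}{n} \int_{\mathbb{R}^n}\cdots\int_{\mathbb{R}^n} \Delta(x_1,\ldots,x_n)^p\, g(x_1)\cdots g(x_n)\, dx_1\cdots dx_n$$ exists, and $$|I(f)| = \mathcal{I}_0(f) \quad\text{and}\quad |IK| = \mathcal{I}_0(1_K).$$
   Context: $\Delta(x_1,\ldots,x_m)$ denotes the $m$-dimensional volume of the parallelotope spanned by $x_1,\ldots,x_m \in \mathbb{R}^n$ (so $\Delta(x_1,\ldots,x_n)=|\det(x_1,\ldots,x_n)|$). $|\cdot|_k$ is $k$-dimensional Hausdorff measure and $|\cdot|=|\cdot|_n$ for subsets of $\mathbb{R}^n$. For a non-negative, bounded, compactly supported Borel function $g$ on $\mathbb{R}^n$, $I(g)$ is the star-shaped set $\{ r u : u \in \mathbb{S}^{n-1}, 0 \le r \le \rho_{I(g)}(u)\}$ with $\rho_{I(g)}(u) = \int_{u^\perp} g(y)\,dy$ (integration with respect to $(n-1)$-dimensional Lebesgue measure on $u^\perp$); for compact $K$, $IK := I(1_K)$. A compact set $K\subset\mathbb{R}^n$ has radially negligible boundary if $\int_{\mathbb{S}^{n-1}} |\partial K \cap \mathbb{R}_+ u|_1 \, d\sigma_{\mathbb{S}^{n-1}}(u) = 0$, where $\sigma_{\mathbb{S}^{n-1}}$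 is the Haar probability measure on the unit sphere. *)

theory Defs
  imports "HOL-Probability.Probability"
begin

definition parallelotope :: "('i::finite \<Rightarrow> real^'n) \<Rightarrow> (real^'n) set" where
  "parallelotope x = {\<Sum>i\<in>UNIV. t i *\<^sub>R x i | t. \<forall>i. 0 \<le> t i \<and> t i \<le> 1}"

text \<open>The volume of the parallelotope spanned by as many vectors as the dimension of the space.  The
  lemma on determinants is stated for well-ordered index types because the library's
  change-of-variables results are.\<close>

definition Delta :: "('n::finite \<Rightarrow> real^'n) \<Rightarrow> real" where
  "Delta x = measure lebesgue (parallelotope x)"

lemma Delta_eq_det:
  fixes x :: "'n::{finite,wellorder} \<Rightarrow> real^'n::_"
  shows "Delta x = \<bar>det (\<chi> i. x i)\<bar>"
proof -
  let ?f = "\<lambda>t. transpose (\<chi> i. x i) *v t"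
  have f: "?f t = (\<Sum>i\<in>UNIV. t $ i *\<^sub>R x i)" for t
    by (simp add: vec_eq_iff matrix_vector_mult_def transpose_def mult.commute)
  have "parallelotope x = ?f ` cbox 0 1"
  proof (intro equalityI subsetI)
    fix y assume "y \<in> parallelotope x"
    then obtain t where t: "y = (\<Sum>i\<in>UNIV. t i *\<^sub>R x i)" "\<forall>i. 0 \<le> t i \<and> t i \<le> 1"
      by (auto simp: parallelotope_def)
    then have "y = ?f (\<chi> i. t i)" "(\<chi> i. t i) \<in> cbox 0 1"
      by (simp_all add: f mem_box_cart del: transpose_matrix_vector)
    then show "y \<in> ?f ` cbox 0 1" by blast
  next
    fix y assume "y \<in> ?f ` cbox 0 1"
    then obtain t where t: "y = ?f t" "t \<in> cbox 0 1" by blast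
    show "y \<in> parallelotope x"
      unfolding parallelotope_def mem_Collect_eq
      using t by (intro exI[of _ "\<lambda>i. t $ i"]) (auto simp: f mem_box_cart simp del: transpose_matrix_vector)
  qed
  moreover have "measure lebesgue (?f ` cbox 0 1)
      = \<bar>det (matrix ?f)\<bar> * measure lebesgue (cbox (0::real^'n::_) 1)"
    by (intro measure_linear_image matrix_vector_mul_linear lmeasurable_cbox)
  moreover have "measure lebesgue (cbox (0::real^'n::_) 1) = 1"
    by (simp add: content_cbox_cart interval_ne_empty_cart)
  ultimately show ?thesis
    by (simp add: Delta_def matrix_of_matrix_vector_mul det_transpose del: transpose_matrix_vector)
qed

text \<open>Lebesgue measure on a linear subspace \<open>S\<close>, obtained as \<^const>\<open>lborel\<close> itself is: by transporting
  the product of one-dimensional Lebesgue measures along the coordinates of an orthonormal basis of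
  \<open>S\<close>.  It does not depend on the basis, and is regarded as a Borel measure on the whole space that is
  concentrated on \<open>S\<close>.\<close>

definition orthonormal_basis_of :: "'a::euclidean_space set \<Rightarrow> 'a set \<Rightarrow> bool" where
  "orthonormal_basis_of S B \<longleftrightarrow>
     pairwise orthogonal B \<and> (\<forall>b\<in>B. norm b = 1) \<and> span B = S"

definition subspace_lborel :: "'a::euclidean_space set \<Rightarrow> 'a measure" where
  "subspace_lborel S =
     (let B = (SOME B. orthonormal_basis_of S B)
      in distr (\<Pi>\<^sub>M b\<in>B. lborel) borel (\<lambda>c. \<Sum>b\<in>B. c b *\<^sub>R b))"

lemma orthonormal_basis_of_exists: "subspace S \<Longrightarrow> \<exists>B. orthonormal_basis_of S B"
  unfolding orthonormal_basis_of_def by (metis orthonormal_basis_subspace)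

text \<open>Radial function of the set \<open>I(g)\<close>, for a unit vector \<open>u\<close>.\<close>

definition radial_I :: "(real^'n \<Rightarrow> real) \<Rightarrow> real^'n \<Rightarrow> real" where
  "radial_I g u = (\<integral>y. g y \<partial>subspace_lborel {y. y \<bullet> u = 0})"

definition I_body :: "(real^'n \<Rightarrow> real) \<Rightarrow> (real^'n) set" where
  "I_body g = {r *\<^sub>R u | r u. norm u = 1 \<and> 0 \<le> r \<and> r \<le> radial_I g u}"

text \<open>\<open>k\<close>-dimensional Hausdorff (outer) measure, normalised so that it agrees with Lebesgue measure on
  \<open>k\<close>-dimensional Euclidean space.  Boundedness is demanded because \<^const>\<open>diameter\<close> has no meaning on
  unbounded sets; the case distinction only matters for \<open>k = 0\<close>.\<close>

definition hausdorff_content :: "nat \<Rightarrow> real \<Rightarrow> 'a::metric_space set \<Rightarrow> ennreal" where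
  "hausdorff_content k \<delta> A =
     (INF C \<in> {C :: nat \<Rightarrow> 'a set. A \<subseteq> (\<Union>i. C i) \<and> (\<forall>i. bounded (C i) \<and> diameter (C i) \<le> \<delta>)}.
        \<Sum>i. if C i = {} then 0 else ennreal (unit_ball_vol k * (diameter (C i) / 2) ^ k))"

definition hausdorff_measure :: "nat \<Rightarrow> 'a::metric_space set \<Rightarrow> ennreal" where
  "hausdorff_measure k A = (SUP \<delta> \<in> {0<..}. hausdorff_content k \<delta> A)"

text \<open>The Haar probability measure on the unit sphere, as the radial projection of the uniform
  distribution on the unit ball.  It is regarded as a Borel measure on the whole space that is
  concentrated on the sphere.  The lemmas below show that it is a rotation-invariant probability
  measure on the sphere.\<close>

definition sphere_haar :: "('a::euclidean_space) measure" where
  "sphere_haar = distr (uniform_measure lborel (ball 0 1)) borel sgn"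

lemma borel_measurable_sgn_vec [measurable]: "(sgn :: 'a::euclidean_space \<Rightarrow> 'a) \<in> borel_measurable borel"
  unfolding sgn_div_norm[abs_def] by measurable

lemma emeasure_unit_ball:
  "emeasure lborel (ball (0::'a::euclidean_space) 1) \<noteq> 0"
  "emeasure lborel (ball (0::'a::euclidean_space) 1) \<noteq> \<infinity>"
  using unit_ball_vol_pos[of "real DIM('a)"] by (simp_all add: emeasure_ball del: unit_ball_vol_pos)

lemma space_sphere_haar [simp]: "space sphere_haar = UNIV"
  and sets_sphere_haar [simp, measurable_cong]: "sets sphere_haar = sets borel"
  by (simp_all add: sphere_haar_def)

lemma prob_space_sphere_haar: "prob_space sphere_haar"
  unfolding sphere_haar_def
  by (intro prob_space.prob_space_distr prob_space_uniform_measure emeasure_unit_ball)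
     measurable

lemma emeasure_sphere_haar:
  fixes A :: "'a::euclidean_space set"
  assumes "A \<in> sets borel"
  shows "emeasure sphere_haar A
    = emeasure lborel (ball 0 1 \<inter> sgn -` A) / emeasure lborel (ball (0::'a) 1)"
proof -
  have "sgn -` A \<in> sets borel"
    using measurable_sets_borel[OF borel_measurable_sgn_vec assms] .
  moreover have "(sgn :: 'a \<Rightarrow> 'a) \<in> uniform_measure lborel (ball 0 1) \<rightarrow>\<^sub>M borel"
    by measurable
  ultimately show ?thesis
    using assms unfolding sphere_haar_def by (simp add: emeasure_distr)
qed

lemma emeasure_sphere_haar_sphere: "emeasure sphere_haar (sphere (0::'a::euclidean_space) 1) = 1"
proof -
  have "ball (0::'a) 1 \<inter> sgn -` sphere 0 1 = ball 0 1 - {0}"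
    by (auto simp: norm_sgn)
  moreover have "emeasure lborel (ball (0::'a) 1 - {0}) = emeasure lborel (ball (0::'a) 1)"
    by (intro emeasure_Diff_null_set) auto
  ultimately show ?thesis
    using emeasure_unit_ball[where 'a='a]
    by (subst emeasure_sphere_haar) (auto intro!: ennreal_divide_self simp: less_top)
qed

lemma sphere_haar_orthogonal_invariant:
  fixes T :: "real^'n::{finite,wellorder} \<Rightarrow> real^'n::_"
  assumes T: "orthogonal_transformation T"
  shows "distr sphere_haar borel T = sphere_haar"
proof (rule measure_eqI)
  have lin: "linear T" and nT: "\<And>x. norm (T x) = norm x" and bij: "bij T"
    using T by (auto simp: orthogonal_transformation_linear orthogonal_transformation_norm
        orthogonal_transformation_bij)
  have T_borel [measurable]: "T \<in> borel_measurable borel"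
    using lin by (intro borel_measurable_continuous_onI linear_continuous_on)
      (simp add: linear_conv_bounded_linear)
  have sgnT: "sgn (T x) = T (sgn x)" for x
    using lin nT by (simp add: sgn_div_norm linear_scale)
  fix A assume "A \<in> sets (distr sphere_haar borel T)"
  then have A: "A \<in> sets borel" by simp
  have TA: "T -` A \<in> sets borel"
    using measurable_sets_borel[OF T_borel A] .
  define S where "S = ball 0 1 \<inter> sgn -` T -` A"
  have S: "S \<in> sets borel"
    unfolding S_def using measurable_sets_borel[OF borel_measurable_sgn_vec TA] by auto
  have S': "S \<in> lmeasurable"
    by (rule bounded_set_imp_lmeasurable) (use S in \<open>auto simp: S_def bounded_Int\<close>)
  have im: "T ` S = ball 0 1 \<inter> sgn -` A"
  proof (intro equalityI subsetI)
    fix y assume "y \<in> ball 0 1 \<inter> sgn -` A"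
    moreover obtain x where "y = T x" using bij by (metis bij_pointE)
    ultimately show "y \<in> T ` S" by (auto simp: S_def sgnT nT)
  qed (auto simp: S_def sgnT nT)
  have S2: "ball 0 1 \<inter> sgn -` A \<in> sets (borel :: (real^'n::_) measure)"
    using measurable_sets_borel[OF borel_measurable_sgn_vec A] by auto
  have "emeasure lborel (T ` S) = emeasure lebesgue (T ` S)"
    using S2 by (simp add: im)
  also have "\<dots> = emeasure lebesgue S"
    using measure_orthogonal_image[OF T S'] measurable_orthogonal_image[OF T S'] S'
    by (simp add: emeasure_eq_measure2)
  also have "\<dots> = emeasure lborel S"
    using S by simp
  finally have "emeasure lborel (T ` S) = emeasure lborel S" .
  then show "emeasure (distr sphere_haar borel T) A = emeasure sphere_haar A"
    using A TA by (simp add: emeasure_distr emeasure_sphere_haar S_def[symmetric] im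
        measurable_cong_sets[OF sets_sphere_haar refl])
qed simp

definition radially_negligible_boundary :: "(real^'n) set \<Rightarrow> bool" where
  "radially_negligible_boundary K \<longleftrightarrow>
     (\<integral>\<^sup>+u. hausdorff_measure 1 (frontier K \<inter> {r *\<^sub>R u | r. 0 \<le> r}) \<partial>sphere_haar) = 0"

text \<open>The functional under the limit, with \<open>n = CARD('n)\<close>; it takes values in the extended
  nonnegative reals, so that nothing has to be assumed about convergence of the integral.  The integral
  over \<open>n\<close>-tuples of points is taken with respect to the product measure.  For \<open>p < 0\<close> the power
  \<open>0 powr p\<close> is \<open>0\<close> here rather than infinite; this concerns the null set of linearly dependent
  tuples only.\<close>

definition Delta_moment :: "(real^'n \<Rightarrow> real) \<Rightarrow> real \<Rightarrow> ennreal" where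
  "Delta_moment g p =
     ennreal ((p + 1) / real CARD('n)) *
     (\<integral>\<^sup>+x. ennreal (Delta x powr p * (\<Prod>i\<in>UNIV. g (x i))) \<partial>(\<Pi>\<^sub>M i\<in>(UNIV::'n set). lborel))"

definition I0 :: "(real^'n \<Rightarrow> real) \<Rightarrow> ennreal" where
  "I0 g = Lim (at_right (-1)) (Delta_moment g)"

end

theory Submission
  imports Defs
begin

text \<open>
  Fix a coordinate \<open>k\<close>. A hyperplane that is a graph over the other coordinates is given by its slopes
  \<open>a\<close>. For \<open>n\<close> points let \<open>a\<close> be the slopes of the graph through the origin and all of them except the
  \<open>k\<close>-th, and let \<open>s\<close> be the vertical distance of the \<open>k\<close>-th point from this graph. By Cramer's rule the
  determinant of the points is \<open>s\<close> times the minor \<open>d\<close> of the remaining coordinates, and passing from the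
  \<open>k\<close>-th coordinates of the points to \<open>(a, s)\<close> costs the Jacobian \<open>\<bar>d\<bar>\<close>. Hence \<open>Delta ^ p\<close> turns into
  \<open>\<bar>d\<bar> ^ (1 + p) * \<bar>s\<bar> ^ p\<close>. As \<open>p\<close> decreases to \<open>-1\<close>, the first factor tends to 1 and
  \<open>(p + 1) * \<bar>s\<bar> ^ p\<close> tends to twice the Dirac measure at 0, which puts all \<open>n\<close> points on one hyperplane;
  the limit is \<open>(2/n)\<close> times the integral of \<open>G(a)^n\<close>, where \<open>G(a)\<close> is the integral of \<open>g\<close> over the
  graph in the base coordinates. The same number is the volume of \<open>I(g)\<close>, because its radial function in the
  normal direction \<open>\<nu> = (-a, 1)\<close> is \<open>\<bar>\<nu>\<bar> * G(a)\<close>. Dominated convergence applies because \<open>G\<close> decays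
  like \<open>1 / \<bar>a\<bar>\<close> and its smeared version like \<open>\<bar>a\<bar> ^ (-1/2)\<close>, uniformly in \<open>p\<close>. For \<open>g = 1\<^sub>K\<close> the
  convergence of the kernels needs that \<open>\<partial>K\<close> is a null set, which follows from radial negligibility.
  Integrals over the \<open>n - 1\<close> other coordinates are written as integrals over the whole space, with a
  weight of total mass 1 in coordinate \<open>k\<close>.
\<close>

section \<open>Lebesgue measure on vectors and slicing\<close>

lemma Basis_vec_Union: "(Basis :: ('a::euclidean_space^'n) set) = (\<Union>i. axis i ` Basis)"
  by (auto simp: Basis_vec_def)

lemma prod_Basis_vec:
  fixes f :: "'a::euclidean_space^'n \<Rightarrow> 'b::comm_monoid_mult"
  shows "(\<Prod>b\<in>Basis. f b) = (\<Prod>i\<in>UNIV. \<Prod>b\<in>Basis. f (axis i b))"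
proof -
  have "(\<Prod>b\<in>Basis. f b) = (\<Prod>i\<in>(UNIV::'n set). prod f (axis i ` Basis))"
    unfolding Basis_vec_Union
    by (rule prod.UNION_disjoint) (auto simp: axis_eq_axis nonzero_Basis)
  also have "\<dots> = (\<Prod>i\<in>UNIV. \<Prod>b\<in>Basis. f (axis i b))"
    by (intro prod.cong refl prod.reindex_cong[of "axis _"]) (auto simp: inj_on_def axis_eq_axis)
  finally show ?thesis .
qed

lemma borel_measurable_vec_lambda [measurable]:
  "vec_lambda \<in> (\<Pi>\<^sub>M i\<in>(UNIV::'n::finite set). borel) \<rightarrow>\<^sub>M (borel :: ('a::euclidean_space^'n) measure)"
  by (subst borel_measurable_euclidean_space)
     (auto simp: Basis_vec_Union inner_axis)

lemma borel_measurable_vec_lambda_comp [measurable (raw)]: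
  fixes f :: "'b \<Rightarrow> 'n::finite \<Rightarrow> 'a::euclidean_space"
  assumes "\<And>i. (\<lambda>x. f x i) \<in> borel_measurable M"
  shows "(\<lambda>x. \<chi> i. f x i) \<in> borel_measurable M"
  using assms by (subst borel_measurable_euclidean_space)
     (auto simp: Basis_vec_Union inner_axis)

lemma borel_measurable_vec_nth_comp [measurable (raw)]:
  fixes f :: "'b \<Rightarrow> 'a::euclidean_space^'n"
  assumes f: "f \<in> borel_measurable M"
  shows "(\<lambda>x. f x $ i) \<in> borel_measurable M"
proof -
  have "(\<lambda>x::'a^'n. x $ i) \<in> borel_measurable borel"
    by (intro borel_measurable_continuous_onI continuous_intros)
  then show ?thesis using f by (rule measurable_compose_rev)
qed

text \<open>The entry type is an arbitrary Euclidean space, so the fact covers both vectors of reals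
  and matrices seen as tuples of rows. It suffices to compare boxes, on which both measures are
  products of side lengths.\<close>

lemma lborel_vec:
  "(lborel :: ('a::euclidean_space^'n) measure) = distr (\<Pi>\<^sub>M i\<in>UNIV. lborel) borel vec_lambda"
proof (rule lborel_eqI)
  interpret product_sigma_finite "\<lambda>_::'n. lborel :: 'a measure" ..
  fix l u :: "'a^'n" assume le: "\<And>b. b \<in> Basis \<Longrightarrow> l \<bullet> b \<le> u \<bullet> b"
  have le': "l $ i \<bullet> b \<le> u $ i \<bullet> b" if "b \<in> Basis" for i b
    using le[of "axis i b"] that by (auto simp: Basis_vec_Union inner_axis)
  have box: "vec_lambda -` box l u = PiE UNIV (\<lambda>i. box (l $ i) (u $ i))"
    by (auto simp: mem_box Basis_vec_Union inner_axis PiE_iff)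
  have "emeasure (distr (\<Pi>\<^sub>M i\<in>(UNIV::'n set). lborel) borel vec_lambda) (box l u)
      = emeasure (\<Pi>\<^sub>M i\<in>(UNIV::'n set). lborel) (PiE UNIV (\<lambda>i. box (l $ i) (u $ i)))"
    by (subst emeasure_distr) (auto simp: box space_PiM)
  also have "\<dots> = (\<Prod>i\<in>UNIV. \<Prod>b\<in>Basis. (u $ i - l $ i) \<bullet> b)"
    using le' by (simp add: emeasure_PiM emeasure_lborel_box_eq prod_ennreal[symmetric] prod_nonneg inner_diff_left)
  also have "\<dots> = (\<Prod>b\<in>Basis. (u - l) \<bullet> b)"
    by (simp add: prod_Basis_vec inner_axis)
  finally show "emeasure (distr (\<Pi>\<^sub>M i\<in>(UNIV::'n set). lborel) borel vec_lambda) (box l u)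
      = (\<Prod>b\<in>Basis. (u - l) \<bullet> b)" .
qed simp

lemma nn_integral_PiM_lborel:
  fixes F :: "('n::finite \<Rightarrow> 'a::euclidean_space) \<Rightarrow> ennreal"
  assumes [measurable]: "(\<lambda>X. F (($) X)) \<in> borel_measurable (borel :: ('a^'n) measure)"
  shows "(\<integral>\<^sup>+x. F x \<partial>(\<Pi>\<^sub>M i\<in>UNIV. lborel)) = (\<integral>\<^sup>+X. F (($) X) \<partial>(lborel :: ('a^'n) measure))"
  by (subst lborel_vec, subst nn_integral_distr) (auto simp: vec_lambda_inverse)

lemma nn_integral_lborel_vec_prod:
  fixes f :: "'n::finite \<Rightarrow> 'a::euclidean_space \<Rightarrow> ennreal"
  assumes [measurable]: "\<And>i. f i \<in> borel_measurable borel"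
  shows "(\<integral>\<^sup>+x. (\<Prod>i\<in>UNIV. f i (x $ i)) \<partial>(lborel :: ('a^'n) measure)) = (\<Prod>i\<in>UNIV. \<integral>\<^sup>+x. f i x \<partial>lborel)"
proof -
  interpret product_sigma_finite "\<lambda>_::'n. lborel :: 'a measure" ..
  have "(\<integral>\<^sup>+x. (\<Prod>i\<in>UNIV. f i (x $ i)) \<partial>(lborel :: ('a^'n) measure))
     = (\<integral>\<^sup>+x. (\<Prod>i\<in>UNIV. f i (x i)) \<partial>(\<Pi>\<^sub>M i\<in>UNIV. lborel))"
    by (subst nn_integral_PiM_lborel) auto
  also have "\<dots> = (\<Prod>i\<in>UNIV. \<integral>\<^sup>+x. f i x \<partial>lborel)"
    by (subst product_nn_integral_prod) auto
  finally show ?thesis .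
qed

lemma nn_integral_lborel_translate:
  fixes c :: "'a::euclidean_space"
  assumes [measurable]: "F \<in> borel_measurable borel"
  shows "(\<integral>\<^sup>+x. F (x + c) \<partial>lborel) = (\<integral>\<^sup>+x. F x \<partial>lborel)"
  by (subst (2) lborel_distr_plus[symmetric, of c], subst nn_integral_distr)
     (auto simp: add.commute)

lemma nn_integral_lborel_scale:
  fixes c :: real
  assumes [measurable]: "F \<in> borel_measurable borel" and c: "c \<noteq> 0"
  shows "(\<integral>\<^sup>+x. F x \<partial>lborel) = ennreal \<bar>c\<bar> * (\<integral>\<^sup>+x. F (c * x) \<partial>lborel)"
  using nn_integral_real_affine[OF assms(1) c, of 0] by simp

text \<open>Averaging over the translates by \<open>T t\<close>: the weight \<open>W\<close> plays the role of the transversal to the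
  fibres, so that integrals over a quotient space can be written as integrals over the whole space.\<close>

lemma nn_integral_slice:
  fixes T :: "'b::euclidean_space \<Rightarrow> 'a::euclidean_space"
  assumes [measurable]: "T \<in> borel_measurable borel" "W \<in> borel_measurable borel" "F \<in> borel_measurable borel"
    and W: "\<And>x. (\<integral>\<^sup>+t. W (x - T t) \<partial>lborel) = 1"
  shows "(\<integral>\<^sup>+x. F x \<partial>lborel) = (\<integral>\<^sup>+y. W y * (\<integral>\<^sup>+t. F (y + T t) \<partial>lborel) \<partial>lborel)"
proof -
  have "(\<integral>\<^sup>+y. W y * (\<integral>\<^sup>+t. F (y + T t) \<partial>lborel) \<partial>lborel)
     = (\<integral>\<^sup>+y. \<integral>\<^sup>+t. W y * F (y + T t) \<partial>lborel \<partial>lborel)"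
    by (intro nn_integral_cong nn_integral_cmult[symmetric]) auto
  also have "\<dots> = (\<integral>\<^sup>+t. \<integral>\<^sup>+y. W y * F (y + T t) \<partial>lborel \<partial>lborel)"
    by (rule lborel_pair.Fubini') auto
  also have "\<dots> = (\<integral>\<^sup>+t. \<integral>\<^sup>+x. W (x - T t) * F x \<partial>lborel \<partial>lborel)"
  proof (rule nn_integral_cong)
    fix t
    show "(\<integral>\<^sup>+y. W y * F (y + T t) \<partial>lborel) = (\<integral>\<^sup>+x. W (x - T t) * F x \<partial>lborel)"
      by (subst nn_integral_lborel_translate[of "\<lambda>x. W (x - T t) * F x" "T t", symmetric]) auto
  qed
  also have "\<dots> = (\<integral>\<^sup>+x. \<integral>\<^sup>+t. W (x - T t) * F x \<partial>lborel \<partial>lborel)"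
    by (rule lborel_pair.Fubini') auto
  also have "\<dots> = (\<integral>\<^sup>+x. F x \<partial>lborel)"
    by (intro nn_integral_cong) (simp add: nn_integral_multc W)
  finally show ?thesis ..
qed

text \<open>Other densities of mass 1 could mark the transversal as well; an indicator also keeps
  the weights finite, which later allows them to be pulled out of limits in
  \<open>ennreal\<close>.\<close>

definition unit_weight :: "real \<Rightarrow> ennreal" where
  "unit_weight = indicator {0..1}"

lemma borel_measurable_unit_weight [measurable]: "unit_weight \<in> borel_measurable borel"
  by (simp add: unit_weight_def)

lemma nn_integral_unit_weight [simp]:
  "(\<integral>\<^sup>+t. unit_weight t \<partial>lborel) = 1" "(\<integral>\<^sup>+t. unit_weight (s - t) \<partial>lborel) = 1"
proof -
  show *: "(\<integral>\<^sup>+t. unit_weight t \<partial>lborel) = 1"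
    by (simp add: unit_weight_def)
  have "(\<integral>\<^sup>+t. unit_weight t \<partial>lborel) = (\<integral>\<^sup>+t. unit_weight (s - t) \<partial>lborel)"
    using nn_integral_real_affine[of unit_weight "-1" s] by simp
  with * show "(\<integral>\<^sup>+t. unit_weight (s - t) \<partial>lborel) = 1" by simp
qed

definition vupd :: "'a^'n \<Rightarrow> 'n \<Rightarrow> 'a \<Rightarrow> 'a^'n" where
  "vupd y k t = (\<chi> i. if i = k then t else y $ i)"

lemma vupd_nth [simp]: "vupd y k t $ i = (if i = k then t else y $ i)"
  by (simp add: vupd_def)

lemma vupd_vupd [simp]: "vupd (vupd y k s) k t = vupd y k t"
  by (simp add: vec_eq_iff)

lemma vupd_eq_plus_axis: "vupd y k t = (y::real^'n) + axis k (t - y $ k)"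
  by (simp add: vec_eq_iff axis_def)

lemma borel_measurable_vupd [measurable (raw)]:
  fixes f :: "'b \<Rightarrow> real^'n"
  assumes [measurable]: "f \<in> borel_measurable M" "g \<in> borel_measurable M"
  shows "(\<lambda>x. vupd (f x) k (g x)) \<in> borel_measurable M"
  unfolding vupd_def by measurable

lemma borel_measurable_axis [measurable]: "(\<lambda>t::real. axis k t :: real^'n) \<in> borel_measurable borel"
  unfolding axis_def by measurable

text \<open>Fubini for one coordinate without leaving the type \<open>real^'n\<close>: the inner
  integral does not see \<open>y $ k\<close>, so in the outer integral this coordinate only
  integrates the weight and contributes the factor 1.\<close>

lemma nn_integral_slice_coordinate:
  fixes F :: "real^'n \<Rightarrow> ennreal"
  assumes [measurable]: "F \<in> borel_measurable borel"
  shows "(\<integral>\<^sup>+x. F x \<partial>lborel) = (\<integral>\<^sup>+y. unit_weight (y $ k) * (\<integral>\<^sup>+t. F (vupd y k t) \<partial>lborel) \<partial>lborel)"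
proof -
  have "(\<integral>\<^sup>+x. F x \<partial>lborel) = (\<integral>\<^sup>+y. unit_weight (y $ k) * (\<integral>\<^sup>+t. F (y + axis k t) \<partial>lborel) \<partial>lborel)"
    by (rule nn_integral_slice) auto
  moreover have "(\<integral>\<^sup>+t. F (y + axis k t) \<partial>lborel) = (\<integral>\<^sup>+t. F (vupd y k t) \<partial>lborel)" for y
    using nn_integral_lborel_translate[of "\<lambda>t. F (y + axis k t)" "- y $ k"]
    by (simp add: vupd_eq_plus_axis)
  ultimately show ?thesis by simp
qed

section \<open>Linear change of variables\<close>

lemma nn_integral_lborel_diagonal:
  fixes c :: "'n::finite \<Rightarrow> real"
  assumes [measurable]: "F \<in> borel_measurable borel" and c: "\<And>i. c i \<noteq> 0"
  shows "(\<integral>\<^sup>+x. F x \<partial>lborel) = ennreal (\<Prod>i\<in>UNIV. \<bar>c i\<bar>) * (\<integral>\<^sup>+x. F (\<chi> i. c i * x $ i) \<partial>lborel)"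
proof -
  let ?c = "\<lambda>b::real^'n. (\<chi> i. c i * b $ i) \<bullet> b"
  have cb: "?c (axis i 1) = c i" for i
    by (simp add: inner_axis)
  have T: "(\<Sum>j\<in>Basis. (?c j * (x \<bullet> j)) *\<^sub>R j) = (\<chi> i. c i * x $ i)" for x
  proof (rule euclidean_eqI)
    fix b :: "real^'n" assume b: "b \<in> Basis"
    then obtain i where i: "b = axis i 1" by (auto simp: Basis_vec_Union)
    show "(\<Sum>j\<in>Basis. (?c j * (x \<bullet> j)) *\<^sub>R j) \<bullet> b = (\<chi> i. c i * x $ i) \<bullet> b"
      using b cb[of i] by (simp add: inner_sum_left_Basis i) (simp add: inner_axis)
  qed
  have "lborel = density (distr lborel borel (\<lambda>x. 0 + (\<Sum>j\<in>Basis. (?c j * (x \<bullet> j)) *\<^sub>R j)))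
      (\<lambda>_. \<Prod>j\<in>Basis. \<bar>?c j\<bar>)"
    by (rule lborel_affine_euclidean) (auto simp: Basis_vec_Union cb c)
  also have "(\<Prod>j\<in>Basis. \<bar>?c j\<bar>) = (\<Prod>i\<in>UNIV. \<bar>c i\<bar>)"
    by (simp add: prod_Basis_vec cb)
  finally have *: "lborel = density (distr lborel borel (\<lambda>x. \<chi> i. c i * x $ i)) (\<lambda>_. \<Prod>i\<in>UNIV. \<bar>c i\<bar>)"
    by (simp add: T)
  show ?thesis
    by (subst *, subst nn_integral_density) (auto simp: nn_integral_distr nn_integral_cmult)
qed

lemma lborel_permute:
  fixes \<pi> :: "'n::finite \<Rightarrow> 'n"
  assumes \<pi>: "bij \<pi>"
  shows "distr lborel borel (\<lambda>x::real^'n. \<chi> i. x $ \<pi> i) = lborel"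
proof (rule lborel_eqI[symmetric])
  fix l u :: "real^'n" assume le: "\<And>b. b \<in> Basis \<Longrightarrow> l \<bullet> b \<le> u \<bullet> b"
  define r where "r = inv \<pi>"
  have r: "r (\<pi> i) = i" "\<pi> (r i) = i" for i
    using \<pi> by (auto simp: r_def bij_is_inj bij_is_surj surj_f_inv_f)
  have le': "l $ i \<le> u $ i" for i
    using le[of "axis i 1"] by (auto simp: Basis_vec_Union inner_axis)
  have "(\<lambda>x::real^'n. \<chi> i. x $ \<pi> i) -` box l u = box (\<chi> i. l $ r i) (\<chi> i. u $ r i)"
    by (auto simp: mem_box_cart r) (metis r)+
  moreover have b: "(\<chi> i. l $ r i) \<bullet> b \<le> (\<chi> i. u $ r i) \<bullet> b" if "b \<in> Basis" for b
    using that le' by (auto simp: Basis_vec_Union inner_axis)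
  ultimately have "emeasure (distr lborel borel (\<lambda>x::real^'n. \<chi> i. x $ \<pi> i)) (box l u)
      = emeasure lborel (box (\<chi> i. l $ r i) (\<chi> i. u $ r i))"
    by (simp add: emeasure_distr)
  also have "\<dots> = (\<Prod>i\<in>UNIV. u $ r i - l $ r i)"
    using b by (simp add: emeasure_lborel_box) (simp add: prod_Basis_vec inner_axis)
  also have "(\<Prod>i\<in>UNIV. u $ r i - l $ r i) = (\<Prod>i\<in>UNIV. u $ i - l $ i)"
    by (rule prod.reindex_bij_betw) (simp add: r_def \<pi> bij_imp_bij_inv)
  finally show "emeasure (distr lborel borel (\<lambda>x::real^'n. \<chi> i. x $ \<pi> i)) (box l u) = (\<Prod>b\<in>Basis. (u - l) \<bullet> b)"
    by (simp add: prod_Basis_vec inner_axis)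
qed simp

text \<open>Every matrix is built from elementary ones, and for regular factors both sides are
  multiplicative. The induction quantifies over \<open>F\<close>, since for a product the second
  hypothesis is used for \<open>F\<close> composed with the first factor.\<close>

lemma nn_integral_lborel_linear:
  fixes A :: "real^'n^'n"
  assumes "det A \<noteq> 0" and "F \<in> borel_measurable borel"
  shows "(\<integral>\<^sup>+x. F x \<partial>lborel) = ennreal \<bar>det A\<bar> * (\<integral>\<^sup>+x. F (A *v x) \<partial>lborel)"
proof -
  have meas [measurable]: "(\<lambda>x. B *v x) \<in> borel_measurable borel" for B :: "real^'n^'n"
    unfolding matrix_vector_mult_def by measurable
  have "det A \<noteq> 0 \<longrightarrow> (\<forall>F\<in>borel_measurable borel.
      (\<integral>\<^sup>+x. F x \<partial>lborel) = ennreal \<bar>det A\<bar> * (\<integral>\<^sup>+x. F (A *v x) \<partial>lborel))"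
  proof (induction A rule: induct_matrix_elementary[case_names mult zero_row diagonal swap1 idplus])
    case (mult A B)
    show ?case
    proof (intro impI ballI)
      fix F :: "real^'n \<Rightarrow> ennreal" assume [measurable]: "F \<in> borel_measurable borel"
      assume "det (A ** B) \<noteq> 0"
      then have d: "det A \<noteq> 0" "det B \<noteq> 0" by (auto simp: det_mul)
      have "(\<integral>\<^sup>+x. F x \<partial>lborel) = ennreal \<bar>det A\<bar> * (\<integral>\<^sup>+x. F (A *v x) \<partial>lborel)"
        by (rule mult(1)[rule_format, OF d(1)]) simp
      also have "(\<integral>\<^sup>+x. F (A *v x) \<partial>lborel) = ennreal \<bar>det B\<bar> * (\<integral>\<^sup>+x. F (A *v (B *v x)) \<partial>lborel)"
        by (rule mult(2)[rule_format, OF d(2)]) simp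
      finally show "(\<integral>\<^sup>+x. F x \<partial>lborel) = ennreal \<bar>det (A ** B)\<bar> * (\<integral>\<^sup>+x. F ((A ** B) *v x) \<partial>lborel)"
        by (simp add: det_mul abs_mult ennreal_mult matrix_vector_mul_assoc mult.assoc)
    qed
  next
    case (zero_row A i)
    then show ?case by (simp add: det_zero_row)
  next
    case (diagonal A)
    have "det A = (\<Prod>i\<in>UNIV. A $ i $ i)"
      using diagonal by (simp add: det_diagonal)
    moreover have "A *v x = (\<chi> i. A $ i $ i * x $ i)" for x
    proof -
      have "(\<Sum>j\<in>UNIV. A $ i $ j * x $ j) = (\<Sum>j\<in>UNIV. if j = i then A $ i $ j * x $ j else 0)" for i
        using diagonal by (intro sum.cong) auto
      then show ?thesis by (simp add: vec_eq_iff matrix_vector_mult_def)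
    qed
    ultimately show ?case
      by (intro impI ballI, simp only: abs_prod, intro nn_integral_lborel_diagonal) auto
  next
    case (swap1 m n)
    let ?P = "(\<chi> i j. mat 1 $ i $ Transposition.transpose m n j) :: real^'n^'n"
    have mv: "?P *v x = (\<chi> i. x $ Transposition.transpose m n i)" for x
    proof -
      have "(\<Sum>j\<in>UNIV. (if i = Transposition.transpose m n j then 1 else 0) * x $ j)
          = (\<Sum>j\<in>UNIV. if j = Transposition.transpose m n i then x $ j else 0)" for i
        by (intro sum.cong) (auto simp: Transposition.transpose_def)
      then show ?thesis by (simp add: vec_eq_iff matrix_vector_mult_def mat_def)
    qed
    have "det ?P = - det (mat 1 :: real^'n^'n)"
      using det_permute_columns[of "Transposition.transpose m n" "mat 1 :: real^'n^'n"] swap1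
      by (simp add: permutes_swap_id sign_swap_id)
    then have "\<bar>det ?P\<bar> = 1" by simp
    moreover have "(\<integral>\<^sup>+x. F x \<partial>lborel) = (\<integral>\<^sup>+x. F (?P *v x) \<partial>lborel)"
      if [measurable]: "F \<in> borel_measurable borel" for F
      unfolding mv
      by (subst lborel_permute[of "Transposition.transpose m n", symmetric]) (auto simp: nn_integral_distr)
    ultimately show ?case by (intro impI ballI) (simp only: ennreal_1 mult_1)
  next
    case (idplus m n c)
    let ?P = "(\<chi> i j. if i = m \<and> j = n then c else of_bool (i = j)) :: real^'n^'n"
    have mv: "?P *v x = x + axis m (c * x $ n)" for x
    proof -
      have "(\<Sum>j\<in>UNIV. (if i = m \<and> j = n then c else of_bool (i = j)) * x $ j)
          = (\<Sum>j\<in>UNIV. (if j = i then x $ j else 0) + (if j = n then if i = m then c * x $ j else 0 else 0))" for i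
        using idplus by (intro sum.cong) auto
      then show ?thesis by (simp add: vec_eq_iff matrix_vector_mult_def sum.distrib axis_def)
    qed
    have "det ?P = det (\<chi> i. if i = m then row m (mat 1 :: real^'n^'n) + c *s row n (mat 1) else row i (mat 1))"
      using idplus by (intro arg_cong[where f=det]) (auto simp: vec_eq_iff row_def mat_def)
    also have "\<dots> = 1"
      using idplus by (subst det_row_operation) auto
    finally have d: "det ?P = 1" .
    have "(\<integral>\<^sup>+x. F x \<partial>lborel) = (\<integral>\<^sup>+x. F (?P *v x) \<partial>lborel)"
      if [measurable]: "F \<in> borel_measurable borel" for F
    proof -
      \<comment> \<open>On a line in direction \<open>m\<close> the elementary shear is a
        translation by \<open>c * y $ n\<close>, which is constant there because \<open>n\<close>
        differs from \<open>m\<close>.\<close>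
      have eq: "vupd y m t + axis m (c * vupd y m t $ n) = vupd y m (t + c * y $ n)" for y :: "real^'n" and t
        using idplus by (simp add: vec_eq_iff axis_def)
      have "(\<integral>\<^sup>+x. F (?P *v x) \<partial>lborel)
          = (\<integral>\<^sup>+y. unit_weight (y $ m) * (\<integral>\<^sup>+t. F (vupd y m (t + c * y $ n)) \<partial>lborel) \<partial>lborel)"
        by (subst nn_integral_slice_coordinate[of _ m]) (simp_all only: mv eq, measurable)
      also have "\<dots> = (\<integral>\<^sup>+y. unit_weight (y $ m) * (\<integral>\<^sup>+t. F (vupd y m t) \<partial>lborel) \<partial>lborel)"
        by (subst nn_integral_lborel_translate[of "\<lambda>t. F (vupd _ m t)"]) auto
      also have "\<dots> = (\<integral>\<^sup>+x. F x \<partial>lborel)"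
        by (rule nn_integral_slice_coordinate[symmetric]) simp
      finally show ?thesis by simp
    qed
    then show ?case by (intro impI ballI) (simp only: d abs_one ennreal_1 mult_1)
  qed
  then show ?thesis using assms by blast
qed

section \<open>Slicing matrices along a column\<close>

lemma borel_measurable_matrix_vector_mult [measurable (raw)]:
  fixes f :: "'b \<Rightarrow> real^'n^'m"
  assumes [measurable]: "f \<in> borel_measurable M" "g \<in> borel_measurable M"
  shows "(\<lambda>x. f x *v g x) \<in> borel_measurable M"
  unfolding matrix_vector_mult_def by measurable

lemma borel_measurable_det [measurable (raw)]:
  fixes f :: "'b \<Rightarrow> real^'n^'n"
  assumes [measurable]: "f \<in> borel_measurable M"
  shows "(\<lambda>x. det (f x)) \<in> borel_measurable M"
  unfolding det_def by measurable

text \<open>Here the index type is an arbitrary finite one. In the regular case the linear change of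
  variables is applied to the indicator of the parallelotope; in the singular case the parallelotope
  lies in the hyperplane orthogonal to a kernel vector of the transpose.\<close>

lemma Delta_eq_abs_det:
  fixes x :: "'n::finite \<Rightarrow> real^'n"
  shows "Delta x = \<bar>det (\<chi> i. x i)\<bar>"
proof -
  define A where "A = transpose (\<chi> i. x i)"
  have Ax: "A *v t = (\<Sum>i\<in>UNIV. t $ i *\<^sub>R x i)" for t
    by (simp add: A_def vec_eq_iff matrix_vector_mult_def transpose_def mult.commute)
  have par: "parallelotope x = (*v) A ` cbox 0 1"
  proof (intro equalityI subsetI)
    fix y assume "y \<in> parallelotope x"
    then obtain t where t: "y = (\<Sum>i\<in>UNIV. t i *\<^sub>R x i)" "\<forall>i. 0 \<le> t i \<and> t i \<le> 1"
      by (auto simp: parallelotope_def)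
    then have "y = A *v (\<chi> i. t i)" "(\<chi> i. t i) \<in> cbox 0 1"
      by (simp_all add: Ax mem_box_cart)
    then show "y \<in> (*v) A ` cbox 0 1" by blast
  next
    fix y assume "y \<in> (*v) A ` cbox 0 1"
    then obtain t where t: "y = A *v t" "t \<in> cbox 0 1" by blast
    show "y \<in> parallelotope x"
      unfolding parallelotope_def mem_Collect_eq
      using t by (intro exI[of _ "\<lambda>i. t $ i"]) (auto simp: Ax mem_box_cart)
  qed
  have detA: "det A = det (\<chi> i. x i)"
    by (simp add: A_def)
  show ?thesis
  proof (cases "det A = 0")
    case True
    then have "det (transpose A) = 0" by simp
    then obtain w where w: "w \<noteq> 0" "transpose A *v w = 0"
      using invertible_det_nz[of "transpose A"] matrix_left_invertible_ker[of "transpose A"]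
      by (auto simp: invertible_left_inverse)
    have "w \<bullet> y = 0" if "y \<in> parallelotope x" for y
    proof -
      from that obtain t where "y = A *v t" by (auto simp: par)
      then show ?thesis
        using w(2) dot_lmul_matrix[of w A t] by simp
    qed
    then have "parallelotope x \<subseteq> {y. w \<bullet> y = 0}" by auto
    then have "negligible (parallelotope x)"
      using w(1) negligible_hyperplane negligible_subset by blast
    then show ?thesis
      using True detA by (simp add: Delta_def negligible_iff_measure)
  next
    case False
    then have "inj ((*v) A)"
      by (simp add: inj_matrix_vector_mult invertible_det_nz)
    then have ind: "(indicator ((*v) A ` cbox 0 1) (A *v t) :: ennreal) = indicator (cbox 0 1) t" for t
      by (auto simp: indicator_def inj_image_mem_iff)
    have "compact ((*v) A ` cbox 0 1)"
      by (intro compact_continuous_image linear_continuous_on matrix_vector_mul_bounded_linear compact_cbox)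
    then have S [measurable]: "(*v) A ` cbox 0 1 \<in> sets borel"
      by (simp add: borel_compact)
    have "emeasure lborel (cbox (0::real^'n) 1) = (\<Prod>b\<in>Basis. (1 - 0) \<bullet> (b::real^'n))"
      by (rule emeasure_lborel_cbox) (auto simp: Basis_vec_Union inner_axis)
    then have cbox: "emeasure lborel (cbox (0::real^'n) 1) = 1"
      by (simp add: prod_Basis_vec inner_axis)
    have "emeasure lborel ((*v) A ` cbox 0 1) = \<bar>det A\<bar> * (\<integral>\<^sup>+t. indicator ((*v) A ` cbox 0 1) (A *v t) \<partial>lborel)"
      using nn_integral_lborel_linear[OF False, of "indicator ((*v) A ` cbox 0 1)"] by simp
    also have "\<dots> = \<bar>det A\<bar>"
      by (simp add: ind cbox)
    finally show ?thesis
      using S by (simp add: Delta_def par detA measure_def)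
  qed
qed

section \<open>Slopes and vertical offset as coordinates for a column\<close>

definition cupd :: "real^'n^'n \<Rightarrow> 'n \<Rightarrow> real^'n \<Rightarrow> real^'n^'n" where
  "cupd Y k c = (\<chi> i. vupd (Y $ i) k (c $ i))"

text \<open>Its determinant is the principal minor of \<open>Y\<close> without row and column
  \<open>k\<close>, the \<open>d\<close> of the outline. Keeping the full size avoids a second,
  smaller index type.\<close>

definition colmat :: "'n \<Rightarrow> real^'n^'n \<Rightarrow> real^'n^'n" where
  "colmat k Y = cupd Y k (axis k 1)"

definition lin :: "'n \<Rightarrow> real^'n \<Rightarrow> real^'n \<Rightarrow> real" where
  "lin k a y = (\<Sum>j\<in>UNIV-{k}. a $ j * y $ j)"

lemma cupd_nth [simp]: "cupd Y k c $ i = vupd (Y $ i) k (c $ i)"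
  by (simp add: cupd_def)

lemma lin_vupd [simp]: "lin k (vupd a k s) y = lin k a y" "lin k a (vupd y k s) = lin k a y"
  by (simp_all add: lin_def cong: sum.cong_simp)

lemma borel_measurable_cupd [measurable (raw)]:
  assumes [measurable]: "f \<in> borel_measurable M" "g \<in> borel_measurable M"
  shows "(\<lambda>x. cupd (f x) k (g x)) \<in> borel_measurable M"
  unfolding cupd_def by measurable

lemma borel_measurable_colmat [measurable (raw)]:
  assumes [measurable]: "f \<in> borel_measurable M"
  shows "(\<lambda>x. colmat k (f x)) \<in> borel_measurable M"
  unfolding colmat_def by measurable

lemma borel_measurable_lin [measurable (raw)]:
  assumes [measurable]: "f \<in> borel_measurable M" "g \<in> borel_measurable M"
  shows "(\<lambda>x. lin k (f x) (g x)) \<in> borel_measurable M"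
  unfolding lin_def by measurable

text \<open>One vector \<open>b\<close> carries both parameters: the entries away from
  \<open>k\<close> are slopes, entry \<open>k\<close> is the vertical offset of row
  \<open>k\<close>. Thus the passage from slopes and offset to the \<open>k\<close>-th coordinates
  of the rows is linear with matrix \<open>colmat k Y\<close>.\<close>

lemma colmat_mult_nth: "(colmat k Y *v b) $ i = lin k b (Y $ i) + (if i = k then b $ k else 0)"
proof -
  have "(colmat k Y *v b) $ i = (\<Sum>j\<in>UNIV. colmat k Y $ i $ j * b $ j)"
    by (simp add: matrix_vector_mult_def)
  also have "\<dots> = colmat k Y $ i $ k * b $ k + (\<Sum>j\<in>UNIV-{k}. colmat k Y $ i $ j * b $ j)"
    by (rule sum.remove) auto
  also have "(\<Sum>j\<in>UNIV-{k}. colmat k Y $ i $ j * b $ j) = lin k b (Y $ i)"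
    by (auto simp: lin_def colmat_def mult.commute intro!: sum.cong)
  finally show ?thesis by (auto simp: colmat_def axis_def)
qed

text \<open>Cramer's rule, read as a formula for the determinant in terms of the offset
  \<open>b $ k\<close>.\<close>

lemma det_cupd_colmat: "det (cupd Y k (colmat k Y *v b)) = b $ k * det (colmat k Y)"
proof -
  have "cupd Y k (colmat k Y *v b) = (\<chi> i j. if j = k then (colmat k Y *v b) $ i else colmat k Y $ i $ j)"
    by (simp add: vec_eq_iff colmat_def)
  then show ?thesis by (simp only: cramer_lemma)
qed

text \<open>The transversal weight has one unit weight per row; its integral over the translates of
  the column factorises into integrals equal to 1.\<close>

lemma nn_integral_slice_column:
  fixes F :: "real^'n^'n \<Rightarrow> ennreal"
  assumes [measurable]: "F \<in> borel_measurable borel"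
  shows "(\<integral>\<^sup>+X. F X \<partial>lborel)
    = (\<integral>\<^sup>+Y. (\<Prod>i\<in>UNIV. unit_weight (Y $ i $ k)) * (\<integral>\<^sup>+c. F (cupd Y k c) \<partial>lborel) \<partial>lborel)"
proof -
  let ?T = "\<lambda>c::real^'n. (\<chi> i. axis k (c $ i)) :: real^'n^'n"
  have [measurable]: "?T \<in> borel_measurable borel" by measurable
  have "(\<integral>\<^sup>+c. (\<Prod>i\<in>UNIV. unit_weight ((X - ?T c) $ i $ k)) \<partial>lborel) = 1" for X
    using nn_integral_lborel_vec_prod[of "\<lambda>i t. unit_weight (X $ i $ k - t)"] by simp
  then have "(\<integral>\<^sup>+X. F X \<partial>lborel)
    = (\<integral>\<^sup>+Y. (\<Prod>i\<in>UNIV. unit_weight (Y $ i $ k)) * (\<integral>\<^sup>+c. F (Y + ?T c) \<partial>lborel) \<partial>lborel)"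
    by (intro nn_integral_slice) auto
  moreover have "(\<integral>\<^sup>+c. F (Y + ?T c) \<partial>lborel) = (\<integral>\<^sup>+c. F (cupd Y k c) \<partial>lborel)" for Y
  proof -
    have "cupd Y k c = Y + ?T (c + (\<chi> i. - Y $ i $ k))" for c
      by (simp add: vec_eq_iff axis_def)
    then show ?thesis
      using nn_integral_lborel_translate[of "\<lambda>c. F (Y + ?T c)" "\<chi> i. - Y $ i $ k"] by simp
  qed
  ultimately show ?thesis by simp
qed

text \<open>The determinant of \<open>A + t I\<close> is a nonzero polynomial in \<open>t\<close>, because \<open>I + s A\<close> is regular for small \<open>s\<close>.\<close>

lemma finite_det_plus_scalar_eq_0:
  fixes A :: "real^'n^'n"
  shows "finite {t. det (A + t *\<^sub>R mat 1) = 0}"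
proof -
  define P where "P = det (\<chi> i j. [: A $ i $ j, if i = j then 1 else 0 :] :: real poly^'n^'n)"
  have P: "poly P t = det (A + t *\<^sub>R mat 1)" for t
    by (simp add: P_def det_def poly_sum poly_prod mat_def if_distrib[of "\<lambda>x. t * x"] cong: if_cong)
  have "((\<lambda>s. det (mat 1 + s *\<^sub>R A)) \<longlongrightarrow> det (mat 1 + (0::real) *\<^sub>R A)) (at_right 0)"
    unfolding det_def by (intro tendsto_intros)
  then have "\<forall>\<^sub>F s in at_right 0. det (mat 1 + s *\<^sub>R A) \<noteq> 0"
    by (rule tendsto_imp_eventually_ne) simp
  then have "\<forall>\<^sub>F s in at_right (0::real). det (mat 1 + s *\<^sub>R A) \<noteq> 0 \<and> s > 0"
    by (intro eventually_conj eventually_at_right_less)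
  then obtain s :: real where s: "det (mat 1 + s *\<^sub>R A) \<noteq> 0" "s > 0"
    using eventually_happens' trivial_limit_at_right_real by blast
  have "mat 1 + s *\<^sub>R A = mat s ** (A + (1/s) *\<^sub>R mat 1)"
  proof -
    have "mat s ** B = s *\<^sub>R B" for B :: "real^'n^'n"
      by (simp add: vec_eq_iff matrix_matrix_mult_def mat_def if_distrib[of "\<lambda>x. x * _"] cong: if_cong)
    then show ?thesis using s(2) by (simp add: scaleR_add_right add.commute)
  qed
  then have "poly P (1/s) \<noteq> 0"
    using s(1) by (auto simp: det_mul P)
  then have "P \<noteq> 0" by auto
  then show ?thesis using poly_roots_finite[of P] by (simp add: P)
qed

text \<open>Each line in direction \<open>mat 1\<close> meets the singular set in finitely many
  points, so slicing along these lines shows that it is null.\<close>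

lemma AE_det_colmat_nonzero:
  fixes k :: "'n::finite"
  shows "AE Y in lborel. det (colmat k Y) \<noteq> 0"
proof -
  have fin: "finite {t::real. det (colmat k (Y + t *\<^sub>R mat 1)) = 0}" for Y
  proof (rule finite_subset[OF _ finite_det_plus_scalar_eq_0[of "colmat k Y"]], rule subsetI, clarsimp)
    fix t :: real assume t: "det (colmat k (Y + t *\<^sub>R mat 1)) = 0"
    \<comment> \<open>Column \<open>k\<close> of \<open>colmat k (Y + t *\<^sub>R mat 1)\<close>
      does not change with \<open>t\<close>, whereas adding the multiple of the identity to
      \<open>colmat k Y\<close> scales that column by \<open>1 + t\<close>. The diagonal factor
      accounts for this.\<close>
    let ?D = "(\<chi> i j. if i = j then if i = k then 1 + t else 1 else 0) :: real^'n^'n"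
    have "colmat k Y + t *\<^sub>R mat 1 = colmat k (Y + t *\<^sub>R mat 1) ** ?D"
      by (simp add: vec_eq_iff matrix_matrix_mult_def mat_def colmat_def axis_def
          if_distrib[of "\<lambda>x. _ * x"] cong: if_cong)
    then show "det (colmat k Y + t *\<^sub>R mat 1) = 0" by (simp add: det_mul t)
  qed
  let ?Z = "{Y::real^'n^'n. det (colmat k Y) = 0}"
  have Z [measurable]: "?Z \<in> sets borel" by measurable
  have "emeasure lborel ?Z = (\<integral>\<^sup>+Y. indicator ?Z Y \<partial>lborel)" by simp
  also have "\<dots> = (\<integral>\<^sup>+Y. unit_weight (Y $ k $ k) * (\<integral>\<^sup>+t. indicator ?Z (Y + t *\<^sub>R mat 1) \<partial>lborel) \<partial>lborel)"
    by (rule nn_integral_slice) (auto simp: mat_def)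
  also have "\<dots> = (\<integral>\<^sup>+Y. unit_weight (Y $ k $ k) * 0 \<partial>(lborel :: (real^'n^'n) measure))"
  proof (intro nn_integral_cong arg_cong2[where f="(*)"] refl)
    fix Y :: "real^'n^'n"
    have "(\<integral>\<^sup>+t. indicator ?Z (Y + t *\<^sub>R mat 1) \<partial>lborel :: ennreal)
      = (\<integral>\<^sup>+t. indicator {t. det (colmat k (Y + t *\<^sub>R mat 1)) = 0} t \<partial>lborel)"
      by (intro nn_integral_cong) (auto simp: indicator_def)
    also have "\<dots> = emeasure lborel {t. det (colmat k (Y + t *\<^sub>R mat 1)) = 0}"
      using fin[of Y] by (intro nn_integral_indicator) (simp add: borel_closed finite_imp_closed)
    also have "\<dots> = 0"
      using fin[of Y] by (simp add: emeasure_lborel_countable countable_finite)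
    finally show "(\<integral>\<^sup>+t. indicator ?Z (Y + t *\<^sub>R mat 1) \<partial>lborel) = (0::ennreal)" .
  qed
  finally have "?Z \<in> null_sets lborel" by (auto simp: null_sets_def)
  then show ?thesis by (auto dest: AE_not_in)
qed

text \<open>The rows other than row \<open>k\<close> lie on the graph of \<open>lin k a\<close> over the coordinates other than \<open>k\<close>,
  row \<open>k\<close> lies at vertical distance \<open>s\<close> from it.\<close>

definition graph_rows :: "'n \<Rightarrow> real^'n^'n \<Rightarrow> real^'n \<Rightarrow> real \<Rightarrow> real^'n^'n" where
  "graph_rows k Y a s = (\<chi> i. vupd (Y $ i) k (lin k a (Y $ i) + (if i = k then s else 0)))"

lemma graph_rows_eq: "graph_rows k Y a s = cupd Y k (colmat k Y *v vupd a k s)"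
  by (simp add: vec_eq_iff graph_rows_def colmat_mult_nth)

lemma graph_rows_nth [simp]:
  "graph_rows k Y a s $ i = vupd (Y $ i) k (lin k a (Y $ i) + (if i = k then s else 0))"
  by (simp add: graph_rows_def)

lemma det_graph_rows: "det (graph_rows k Y a s) = s * det (colmat k Y)"
  by (simp add: graph_rows_eq det_cupd_colmat)

text \<open>With the other columns fixed, column \<open>k\<close> is the image of slopes and offset
  under \<open>colmat k Y\<close>, which costs its determinant; slicing the parameter vector along
  \<open>k\<close> separates \<open>s\<close> from \<open>a\<close>. The singular \<open>Y\<close>
  form a null set.\<close>

lemma nn_integral_graph_rows:
  fixes F :: "real^'n^'n \<Rightarrow> ennreal"
  assumes [measurable]: "F \<in> borel_measurable borel"
  shows "(\<integral>\<^sup>+X. F X \<partial>lborel) = (\<integral>\<^sup>+Y. \<integral>\<^sup>+a. (\<Prod>i\<in>UNIV. unit_weight (Y $ i $ k)) * unit_weight (a $ k) *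
      ennreal \<bar>det (colmat k Y)\<bar> * (\<integral>\<^sup>+s. F (graph_rows k Y a s) \<partial>lborel) \<partial>lborel \<partial>lborel)"
proof -
  have [measurable]: "(\<lambda>x. graph_rows k (f x) (g x) (h x)) \<in> borel_measurable M"
    if [measurable]: "f \<in> borel_measurable M" "g \<in> borel_measurable M" "h \<in> borel_measurable M" for f g h and M :: "'z measure"
    unfolding graph_rows_def by measurable
  have eq: "(\<integral>\<^sup>+c. F (cupd Y k c) \<partial>lborel) = ennreal \<bar>det (colmat k Y)\<bar> *
      (\<integral>\<^sup>+a. unit_weight (a $ k) * (\<integral>\<^sup>+s. F (graph_rows k Y a s) \<partial>lborel) \<partial>lborel)"
    if "det (colmat k Y) \<noteq> 0" for Y
    using nn_integral_lborel_linear[OF that, of "\<lambda>c. F (cupd Y k c)"]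
      nn_integral_slice_coordinate[of "\<lambda>b. F (cupd Y k (colmat k Y *v b))" k]
    by (simp add: graph_rows_eq)
  have "(\<integral>\<^sup>+X. F X \<partial>lborel) = (\<integral>\<^sup>+Y. (\<Prod>i\<in>UNIV. unit_weight (Y $ i $ k)) * (ennreal \<bar>det (colmat k Y)\<bar> *
      (\<integral>\<^sup>+a. unit_weight (a $ k) * (\<integral>\<^sup>+s. F (graph_rows k Y a s) \<partial>lborel) \<partial>lborel)) \<partial>lborel)"
    unfolding nn_integral_slice_column[of F k, OF assms]
    by (rule nn_integral_cong_AE) (use AE_det_colmat_nonzero[of k] in eventually_elim, simp add: eq)
  also have "\<dots> = (\<integral>\<^sup>+Y. \<integral>\<^sup>+a. (\<Prod>i\<in>UNIV. unit_weight (Y $ i $ k)) * unit_weight (a $ k) *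
      ennreal \<bar>det (colmat k Y)\<bar> * (\<integral>\<^sup>+s. F (graph_rows k Y a s) \<partial>lborel) \<partial>lborel \<partial>lborel)"
    by (intro nn_integral_cong) (simp add: nn_integral_cmult[symmetric] ac_simps)
  finally show ?thesis .
qed

text \<open>On graph rows the determinant is \<open>s\<close> times the minor, so the Jacobian
  raises the exponent of the minor from \<open>p\<close> to \<open>1 + p\<close>. The power of
  \<open>s\<close> stays with row \<open>k\<close>, the only row that moves with
  \<open>s\<close>.\<close>

lemma nn_integral_Delta_powr:
  fixes g :: "real^'n \<Rightarrow> real"
  assumes [measurable]: "g \<in> borel_measurable borel" and g: "\<And>x. g x \<ge> 0"
  shows "(\<integral>\<^sup>+x. ennreal (Delta x powr p * (\<Prod>i\<in>UNIV. g (x i))) \<partial>(\<Pi>\<^sub>M i\<in>(UNIV::'n set). lborel))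
    = (\<integral>\<^sup>+Y. \<integral>\<^sup>+a. (\<Prod>i\<in>UNIV. unit_weight (Y $ i $ k)) * unit_weight (a $ k) *
        ennreal (\<bar>det (colmat k Y)\<bar> powr (1 + p)) *
        (\<Prod>i\<in>UNIV-{k}. ennreal (g (vupd (Y $ i) k (lin k a (Y $ i))))) *
        (\<integral>\<^sup>+s. ennreal (\<bar>s\<bar> powr p * g (vupd (Y $ k) k (lin k a (Y $ k) + s))) \<partial>lborel) \<partial>lborel \<partial>lborel)"
proof -
  let ?F = "\<lambda>X::real^'n^'n. ennreal (\<bar>det X\<bar> powr p * (\<Prod>i\<in>UNIV. g (X $ i)))"
  have "(\<integral>\<^sup>+x. ennreal (Delta x powr p * (\<Prod>i\<in>UNIV. g (x i))) \<partial>(\<Pi>\<^sub>M i\<in>(UNIV::'n set). lborel))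
      = (\<integral>\<^sup>+X. ?F X \<partial>lborel)"
    by (subst nn_integral_PiM_lborel) (simp_all add: Delta_eq_abs_det)
  also have "\<dots> = (\<integral>\<^sup>+Y. \<integral>\<^sup>+a. (\<Prod>i\<in>UNIV. unit_weight (Y $ i $ k)) * unit_weight (a $ k) *
      ennreal \<bar>det (colmat k Y)\<bar> * (\<integral>\<^sup>+s. ?F (graph_rows k Y a s) \<partial>lborel) \<partial>lborel \<partial>lborel)"
    by (rule nn_integral_graph_rows) measurable
  also have "\<dots> = (\<integral>\<^sup>+Y. \<integral>\<^sup>+a. (\<Prod>i\<in>UNIV. unit_weight (Y $ i $ k)) * unit_weight (a $ k) *
        ennreal (\<bar>det (colmat k Y)\<bar> powr (1 + p)) *
        (\<Prod>i\<in>UNIV-{k}. ennreal (g (vupd (Y $ i) k (lin k a (Y $ i))))) *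
        (\<integral>\<^sup>+s. ennreal (\<bar>s\<bar> powr p * g (vupd (Y $ k) k (lin k a (Y $ k) + s))) \<partial>lborel) \<partial>lborel \<partial>lborel)"
  proof (rule nn_integral_cong, rule nn_integral_cong)
    fix Y :: "real^'n^'n" and a :: "real^'n"
    let ?d = "\<bar>det (colmat k Y)\<bar>" and ?P = "\<Prod>i\<in>UNIV-{k}. g (vupd (Y $ i) k (lin k a (Y $ i)))"
    let ?h = "\<lambda>s. \<bar>s\<bar> powr p * g (vupd (Y $ k) k (lin k a (Y $ k) + s))"
    have P: "?P \<ge> 0" by (intro prod_nonneg) (simp add: g)
    have "?F (graph_rows k Y a s) = ennreal (?d powr p * ?P) * ennreal (?h s)" for s
    proof -
      have "(\<Prod>i\<in>UNIV. g (graph_rows k Y a s $ i)) = g (graph_rows k Y a s $ k) * (\<Prod>i\<in>UNIV-{k}. g (graph_rows k Y a s $ i))"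
        by (rule prod.remove) auto
      also have "(\<Prod>i\<in>UNIV-{k}. g (graph_rows k Y a s $ i)) = ?P"
        by (intro prod.cong) auto
      finally have "\<bar>det (graph_rows k Y a s)\<bar> powr p * (\<Prod>i\<in>UNIV. g (graph_rows k Y a s $ i)) = (?d powr p * ?P) * ?h s"
        by (simp add: det_graph_rows abs_mult powr_mult)
      then show ?thesis
        using P g by (simp add: ennreal_mult[symmetric])
    qed
    then have int: "(\<integral>\<^sup>+s. ?F (graph_rows k Y a s) \<partial>lborel) = ennreal (?d powr p * ?P) * (\<integral>\<^sup>+s. ennreal (?h s) \<partial>lborel)"
      by (simp add: nn_integral_cmult)
    let ?W = "(\<Prod>i\<in>UNIV. unit_weight (Y $ i $ k)) * unit_weight (a $ k)"
    have "?W * ennreal ?d * (\<integral>\<^sup>+s. ?F (graph_rows k Y a s) \<partial>lborel)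
        = ?W * (ennreal ?d * ennreal (?d powr p * ?P)) * (\<integral>\<^sup>+s. ennreal (?h s) \<partial>lborel)"
      by (simp only: int mult.assoc)
    \<comment> \<open>For vanishing \<open>?d\<close> both sides are 0, because
      \<open>0 powr (1 + p)\<close> is 0 by convention.\<close>
    also have "ennreal ?d * ennreal (?d powr p * ?P)
        = ennreal (?d powr (1 + p)) * (\<Prod>i\<in>UNIV-{k}. ennreal (g (vupd (Y $ i) k (lin k a (Y $ i)))))"
      using P g by (cases "?d = 0") (simp_all add: prod_ennreal ennreal_mult[symmetric] powr_add mult.assoc)
    finally show "?W * ennreal ?d * (\<integral>\<^sup>+s. ?F (graph_rows k Y a s) \<partial>lborel) = ?W * ennreal (?d powr (1 + p)) *
        (\<Prod>i\<in>UNIV-{k}. ennreal (g (vupd (Y $ i) k (lin k a (Y $ i))))) * (\<integral>\<^sup>+s. ennreal (?h s) \<partial>lborel)"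
      by (simp only: mult.assoc)
  qed
  finally show ?thesis .
qed

section \<open>The volume of \<open>I(g)\<close>\<close>

lemma nn_integral_even:
  fixes f :: "real \<Rightarrow> ennreal"
  assumes [measurable]: "f \<in> borel_measurable borel"
  shows "(\<integral>\<^sup>+t. f \<bar>t\<bar> \<partial>lborel) = 2 * (\<integral>\<^sup>+t. f t * indicator {0..} t \<partial>lborel)"
proof -
  have "(\<integral>\<^sup>+t. f \<bar>t\<bar> \<partial>lborel) = (\<integral>\<^sup>+t. f t * indicator {0..} t + f (- t) * indicator {..<0} t \<partial>lborel)"
    by (intro nn_integral_cong) (auto simp: indicator_def)
  also have "\<dots> = (\<integral>\<^sup>+t. f t * indicator {0..} t \<partial>lborel) + (\<integral>\<^sup>+t. f (- t) * indicator {..<0} t \<partial>lborel)"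
    by (intro nn_integral_add) auto
  also have "(\<integral>\<^sup>+t. f (- t) * indicator {..<0} t \<partial>lborel) = (\<integral>\<^sup>+t. f t * indicator {0<..} t \<partial>lborel)"
    by (subst nn_integral_real_affine[of _ "-1" 0]) (auto intro!: nn_integral_cong simp: indicator_def)
  also have "\<dots> = (\<integral>\<^sup>+t. f t * indicator {0..} t \<partial>lborel)"
    using AE_lborel_singleton[of "0::real"]
    by (intro nn_integral_cong_AE) (auto elim!: eventually_mono simp: indicator_def)
  finally show ?thesis by (simp add: mult_2)
qed

lemma nn_integral_abs_powr:
  assumes "p > -1" "c \<ge> 0"
  shows "(\<integral>\<^sup>+t. ennreal (\<bar>t\<bar> powr p) * indicator {-c..c} t \<partial>lborel) = ennreal (2 * c powr (p + 1) / (p + 1))"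
proof -
  have "(\<integral>\<^sup>+t. ennreal (\<bar>t\<bar> powr p) * indicator {-c..c} t \<partial>lborel)
      = (\<integral>\<^sup>+t. ennreal (\<bar>t\<bar> powr p) * indicator {..c} \<bar>t\<bar> \<partial>lborel)"
    by (intro nn_integral_cong) (auto simp: indicator_def)
  also have "\<dots> = 2 * (\<integral>\<^sup>+t. ennreal (t powr p) * indicator {..c} t * indicator {0..} t \<partial>lborel)"
    by (rule nn_integral_even) auto
  also have "(\<integral>\<^sup>+t. ennreal (t powr p) * indicator {..c} t * indicator {0..} t \<partial>lborel)
      = (\<integral>\<^sup>+t. ennreal (t powr p) * indicator {0..c} t \<partial>lborel)"
    by (intro nn_integral_cong) (auto simp: indicator_def)
  also have "\<dots> = ennreal (c powr (p + 1) / (p + 1))"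
    using assms by (intro nn_integral_has_integral_lebesgue' has_integral_powr_from_0) auto
  finally show ?thesis
    using assms by (simp add: ennreal_mult''[symmetric] flip: ennreal_numeral)
qed

text \<open>Since \<open>l\<close> is orthogonal to \<open>v\<close>, the functional is constant on
  lines in direction \<open>v\<close>, and the map translates each of them. The weight is normalised
  by \<open>v \<bullet> v\<close> so that it has mass 1 along these lines.\<close>

lemma nn_integral_lborel_shear:
  fixes l v :: "'a::euclidean_space"
  assumes [measurable]: "F \<in> borel_measurable borel" and lv: "l \<bullet> v = 0"
  shows "(\<integral>\<^sup>+x. F (x + (l \<bullet> x) *\<^sub>R v) \<partial>lborel) = (\<integral>\<^sup>+x. F x \<partial>lborel)"
proof (cases "v = 0")
  case False
  let ?W = "\<lambda>y. unit_weight ((y \<bullet> v) / (v \<bullet> v))"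
  have W: "(\<integral>\<^sup>+t. ?W (x - t *\<^sub>R v) \<partial>lborel) = 1" for x
    using False by (simp add: inner_diff_left diff_divide_distrib)
  have "(\<integral>\<^sup>+x. F (x + (l \<bullet> x) *\<^sub>R v) \<partial>lborel)
      = (\<integral>\<^sup>+y. ?W y * (\<integral>\<^sup>+t. F (y + (t + l \<bullet> y) *\<^sub>R v) \<partial>lborel) \<partial>lborel)"
    using W lv by (subst nn_integral_slice[of "\<lambda>t. t *\<^sub>R v" ?W])
      (auto simp: inner_add_right algebra_simps)
  also have "\<dots> = (\<integral>\<^sup>+y. ?W y * (\<integral>\<^sup>+t. F (y + t *\<^sub>R v) \<partial>lborel) \<partial>lborel)"
    by (subst nn_integral_lborel_translate[of "\<lambda>t. F (_ + t *\<^sub>R v)"]) auto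
  also have "\<dots> = (\<integral>\<^sup>+x. F x \<partial>lborel)"
    using W by (intro nn_integral_slice[symmetric]) auto
  finally show ?thesis .
qed simp

section \<open>Lebesgue measure on hyperplanes, in orthonormal and in graph coordinates\<close>

lemma PiM_lborel_reindex:
  fixes \<pi> :: "'i \<Rightarrow> 'j"
  assumes \<pi>: "bij_betw \<pi> I J" and fin: "finite I"
  shows "distr (\<Pi>\<^sub>M j\<in>J. (lborel :: 'a::euclidean_space measure)) (\<Pi>\<^sub>M i\<in>I. lborel) (\<lambda>\<omega>. \<lambda>i\<in>I. \<omega> (\<pi> i)) = (\<Pi>\<^sub>M i\<in>I. lborel)"
proof -
  interpret I: product_sigma_finite "\<lambda>_::'i. lborel :: 'a measure" ..
  interpret J: product_sigma_finite "\<lambda>_::'j. lborel :: 'a measure" ..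
  have finJ: "finite J" using \<pi> fin bij_betw_finite by blast
  have mem: "\<pi> i \<in> J" if "i \<in> I" for i using \<pi> that by (auto simp: bij_betw_def)
  let ?r = "inv_into I \<pi>"
  have meas: "(\<lambda>\<omega>. \<lambda>i\<in>I. \<omega> (\<pi> i)) \<in> (\<Pi>\<^sub>M j\<in>J. (lborel :: 'a measure)) \<rightarrow>\<^sub>M (\<Pi>\<^sub>M i\<in>I. lborel)"
    using mem by (intro measurable_restrict measurable_component_singleton)
  show ?thesis
  proof (rule I.PiM_eqI)
    fix A :: "'i \<Rightarrow> 'a set" assume A: "\<And>i. i \<in> I \<Longrightarrow> A i \<in> sets lborel"
    have "(\<lambda>\<omega>. \<lambda>i\<in>I. \<omega> (\<pi> i)) -` Pi\<^sub>E I A \<inter> space (\<Pi>\<^sub>M j\<in>J. (lborel :: 'a measure)) = Pi\<^sub>E J (\<lambda>j. A (?r j))"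
    proof -
      have "(\<forall>i\<in>I. \<omega> (\<pi> i) \<in> A i) \<longleftrightarrow> (\<forall>j\<in>J. \<omega> j \<in> A (?r j))" for \<omega> :: "'j \<Rightarrow> 'a"
        using \<pi> by (auto simp: bij_betw_def inv_into_f_f)
      then show ?thesis by (auto simp: space_PiM PiE_iff)
    qed
    moreover have "?r j \<in> I" if "j \<in> J" for j
      using \<pi> that by (metis bij_betw_def inv_into_into)
    ultimately have "emeasure (distr (\<Pi>\<^sub>M j\<in>J. (lborel :: 'a measure)) (\<Pi>\<^sub>M i\<in>I. lborel) (\<lambda>\<omega>. \<lambda>i\<in>I. \<omega> (\<pi> i))) (Pi\<^sub>E I A)
        = (\<Prod>j\<in>J. emeasure lborel (A (?r j)))"
      using A fin finJ by (subst emeasure_distr[OF meas]) (auto intro!: sets_PiM_I_finite J.emeasure_PiM)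
    also have "\<dots> = (\<Prod>i\<in>I. emeasure lborel (A i))"
      using prod.reindex_bij_betw[OF \<pi>, of "\<lambda>j. emeasure lborel (A (?r j))"] \<pi>
      by (simp add: bij_betw_def inv_into_f_f cong: prod.cong_simp)
    finally show "emeasure (distr (\<Pi>\<^sub>M j\<in>J. (lborel :: 'a measure)) (\<Pi>\<^sub>M i\<in>I. lborel) (\<lambda>\<omega>. \<lambda>i\<in>I. \<omega> (\<pi> i))) (Pi\<^sub>E I A)
        = (\<Prod>i\<in>I. emeasure lborel (A i))" .
  qed (use fin in auto)
qed

text \<open>The matrix whose columns are the basis vectors is orthogonal, so its determinant is 1 in
  absolute value.\<close>

lemma nn_integral_orthonormal_basis:
  fixes B :: "(real^'n) set"
  assumes B: "pairwise orthogonal B" "\<And>b. b \<in> B \<Longrightarrow> norm b = 1" "card B = CARD('n)" "finite B"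
    and [measurable]: "F \<in> borel_measurable borel"
  shows "(\<integral>\<^sup>+x. F x \<partial>lborel) = (\<integral>\<^sup>+c. F (\<Sum>b\<in>B. c b *\<^sub>R b) \<partial>(\<Pi>\<^sub>M b\<in>B. lborel))"
proof -
  obtain \<pi> :: "'n \<Rightarrow> real^'n" where \<pi>: "bij_betw \<pi> UNIV B"
    using B by (metis finite_same_card_bij finite_class.finite_UNIV)
  then have mem: "\<pi> i \<in> B" for i by (auto simp: bij_betw_def)
  define A where "A = (\<chi> i j. \<pi> j $ i)"
  have "(transpose A ** A) $ i $ j = mat 1 $ i $ j" for i j
  proof -
    have "(transpose A ** A) $ i $ j = \<pi> i \<bullet> \<pi> j"
      by (simp add: matrix_matrix_mult_def transpose_def A_def inner_vec_def)
    also have "\<dots> = (if i = j then 1 else 0)"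
    proof (cases "i = j")
      case True
      then show ?thesis using B(2)[OF mem[of j]] by (simp add: norm_eq_1)
    next
      case False
      then have "\<pi> i \<noteq> \<pi> j" using \<pi> by (auto simp: bij_betw_def inj_on_def)
      then have "orthogonal (\<pi> i) (\<pi> j)"
        using B(1) mem by (auto simp: pairwise_def)
      then show ?thesis using False by (simp add: orthogonal_def)
    qed
    finally show ?thesis by (simp add: mat_def)
  qed
  then have "transpose A ** A = mat 1" by (simp add: vec_eq_iff)
  then have "orthogonal_matrix A" by (simp add: orthogonal_matrix)
  then have d: "\<bar>det A\<bar> = 1" using det_orthogonal_matrix by fastforce
  then have d0: "det A \<noteq> 0" by auto
  have Ac: "A *v c = (\<Sum>i\<in>UNIV. c $ i *\<^sub>R \<pi> i)" for c
    by (simp add: vec_eq_iff matrix_vector_mult_def A_def mult.commute)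
  have "(\<integral>\<^sup>+x. F x \<partial>lborel) = (\<integral>\<^sup>+c. F (A *v c) \<partial>lborel)"
    using nn_integral_lborel_linear[OF d0 assms(5)] by (simp add: d)
  also have "\<dots> = (\<integral>\<^sup>+c. F (\<Sum>i\<in>UNIV. c i *\<^sub>R \<pi> i) \<partial>(\<Pi>\<^sub>M i\<in>UNIV. lborel))"
    by (subst nn_integral_PiM_lborel) (simp_all add: Ac)
  also have "\<dots> = (\<integral>\<^sup>+c. F (\<Sum>i\<in>UNIV. c (\<pi> i) *\<^sub>R \<pi> i) \<partial>(\<Pi>\<^sub>M b\<in>B. lborel))"
  proof -
    have [measurable]: "(\<lambda>\<omega>. \<lambda>i\<in>UNIV. \<omega> (\<pi> i)) \<in> (\<Pi>\<^sub>M j\<in>B. (lborel :: real measure)) \<rightarrow>\<^sub>M (\<Pi>\<^sub>M i\<in>UNIV. lborel)"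
      using mem by (intro measurable_restrict measurable_component_singleton)
    show ?thesis
      by (subst PiM_lborel_reindex[OF \<pi>, symmetric]) (auto simp: nn_integral_distr)
  qed
  also have "\<dots> = (\<integral>\<^sup>+c. F (\<Sum>b\<in>B. c b *\<^sub>R b) \<partial>(\<Pi>\<^sub>M b\<in>B. lborel))"
    using sum.reindex_bij_betw[OF \<pi>] by (intro nn_integral_cong arg_cong[where f=F]) auto
  finally show ?thesis .
qed

lemma sets_subspace_lborel [simp, measurable_cong]: "sets (subspace_lborel S) = sets borel"
  by (simp add: subspace_lborel_def Let_def)

text \<open>The chosen basis of the hyperplane together with \<open>u\<close> is an orthonormal
  basis of the whole space, and the weight integrates to 1 in direction \<open>u\<close>. The
  right-hand side no longer mentions a basis.\<close>

lemma nn_integral_subspace_lborel_hyperplane: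
  fixes u :: "real^'n" and f :: "real^'n \<Rightarrow> ennreal"
  assumes [measurable]: "f \<in> borel_measurable borel" and u: "norm u = 1"
  shows "(\<integral>\<^sup>+y. f y \<partial>subspace_lborel {y. y \<bullet> u = 0})
    = (\<integral>\<^sup>+x. unit_weight (x \<bullet> u) * f (x - (x \<bullet> u) *\<^sub>R u) \<partial>lborel)"
proof -
  let ?S = "{y. y \<bullet> u = 0}"
  define B where "B = (SOME B. orthonormal_basis_of ?S B)"
  have u0: "u \<noteq> 0" using u by auto
  have S: "?S = {y. u \<bullet> y = 0}" by (simp add: inner_commute)
  have "orthonormal_basis_of ?S B"
    unfolding B_def by (rule someI_ex, rule orthonormal_basis_of_exists) (simp add: S subspace_hyperplane)
  then have B: "pairwise orthogonal B" "\<And>b. b \<in> B \<Longrightarrow> norm b = 1" "span B = ?S"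
    by (auto simp: orthonormal_basis_of_def)
  have ind: "independent B"
    using B(1) B(2)[of 0] by (intro pairwise_orthogonal_independent) auto
  then have fin: "finite B" by (rule independent_imp_finite)
  have "card B = dim ?S"
    using ind B(3) by (metis dim_span_eq_card_independent dim_span)
  then have card: "card B = CARD('n) - 1"
    using dim_hyperplane[OF u0] by (simp only: S) simp
  have Bu: "b \<bullet> u = 0" if "b \<in> B" for b
    using B(3) span_base[OF that] by auto
  have uB: "u \<notin> B" using Bu u by (auto simp: norm_eq_1)
  have uu: "u \<bullet> u = 1" using u by (simp add: norm_eq_1)
  interpret product_sigma_finite "\<lambda>_::real^'n. lborel :: real measure" ..
  let ?F = "\<lambda>x. unit_weight (x \<bullet> u) * f (x - (x \<bullet> u) *\<^sub>R u)"
  have "(\<integral>\<^sup>+x. ?F x \<partial>lborel) = (\<integral>\<^sup>+c. ?F (\<Sum>b\<in>insert u B. c b *\<^sub>R b) \<partial>(\<Pi>\<^sub>M b\<in>insert u B. lborel))"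
  proof (rule nn_integral_orthonormal_basis)
    show "pairwise orthogonal (insert u B)"
      using B(1) Bu by (auto simp: pairwise_insert orthogonal_def inner_commute)
    show "card (insert u B) = CARD('n)"
      using card fin uB zero_less_card_finite[where 'a='n] by simp
  qed (use B u fin in auto)
  also have "\<dots> = (\<integral>\<^sup>+c. (\<integral>\<^sup>+s. ?F (\<Sum>b\<in>insert u B. (c(u := s)) b *\<^sub>R b) \<partial>lborel) \<partial>(\<Pi>\<^sub>M b\<in>B. lborel))"
    using fin uB by (intro product_nn_integral_insert) auto
  also have "\<dots> = (\<integral>\<^sup>+c. (\<integral>\<^sup>+s. unit_weight s * f (\<Sum>b\<in>B. c b *\<^sub>R b) \<partial>lborel) \<partial>(\<Pi>\<^sub>M b\<in>B. lborel))"
  proof (rule nn_integral_cong, rule nn_integral_cong)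
    fix c s
    have "(\<Sum>b\<in>insert u B. (c(u := s)) b *\<^sub>R b) = s *\<^sub>R u + (\<Sum>b\<in>B. c b *\<^sub>R b)"
    proof -
      have "(\<Sum>b\<in>B. (c(u := s)) b *\<^sub>R b) = (\<Sum>b\<in>B. c b *\<^sub>R b)"
        using uB by (intro sum.cong) auto
      then show ?thesis using fin uB by simp
    qed
    moreover have "(\<Sum>b\<in>B. c b *\<^sub>R b) \<bullet> u = 0"
      using Bu by (simp add: inner_sum_left)
    ultimately show "?F (\<Sum>b\<in>insert u B. (c(u := s)) b *\<^sub>R b) = unit_weight s * f (\<Sum>b\<in>B. c b *\<^sub>R b)"
      by (simp add: inner_add_left uu)
  qed
  also have "\<dots> = (\<integral>\<^sup>+c. f (\<Sum>b\<in>B. c b *\<^sub>R b) \<partial>(\<Pi>\<^sub>M b\<in>B. lborel))"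
    by (simp add: nn_integral_multc)
  also have "\<dots> = (\<integral>\<^sup>+y. f y \<partial>subspace_lborel ?S)"
    unfolding subspace_lborel_def Let_def B_def[symmetric] by (subst nn_integral_distr) auto
  finally show ?thesis ..
qed

definition graph_integral :: "'n \<Rightarrow> (real^'n \<Rightarrow> ennreal) \<Rightarrow> real^'n \<Rightarrow> ennreal" where
  "graph_integral k f a = (\<integral>\<^sup>+y. unit_weight (y $ k) * f (vupd y k (lin k a y)) \<partial>lborel)"

lemma borel_measurable_graph_integral [measurable (raw)]:
  assumes [measurable]: "f \<in> borel_measurable borel" "h \<in> borel_measurable M"
  shows "(\<lambda>x. graph_integral k f (h x)) \<in> borel_measurable M"
  unfolding graph_integral_def by measurable

lemma graph_integral_vupd [simp]: "graph_integral k f (vupd a k t) = graph_integral k f a"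
  by (simp add: graph_integral_def)

text \<open>The factor \<open>norm \<nu>\<close> is the surface element of the graph with slopes
  \<open>a\<close>, whose normal is \<open>\<nu>\<close>. A volume-preserving shear replaces the
  orthogonal projection onto the hyperplane by the vertical one.\<close>

lemma nn_integral_subspace_lborel_graph:
  fixes a :: "real^'n" and f :: "real^'n \<Rightarrow> ennreal" and k :: 'n
  assumes [measurable]: "f \<in> borel_measurable borel"
  defines "\<nu> \<equiv> vupd (- a) k 1"
  shows "(\<integral>\<^sup>+y. f y \<partial>subspace_lborel {y. y \<bullet> sgn \<nu> = 0}) = ennreal (norm \<nu>) * graph_integral k f a"
proof -
  define u where "u = sgn \<nu>"
  have "\<nu> $ k = 1" by (simp add: \<nu>_def)
  then have \<nu>0: "\<nu> \<noteq> 0" by auto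
  then have N: "norm \<nu> > 0" by simp
  have u: "norm u = 1" using \<nu>0 by (simp add: u_def norm_sgn)
  have uu: "u \<bullet> u = 1" using u by (simp add: norm_eq_1)
  have uk: "u $ k = 1 / norm \<nu>" by (simp add: u_def sgn_div_norm \<nu>_def divide_simps)
  have z\<nu>: "z \<bullet> \<nu> = z $ k - lin k a z" for z
  proof -
    have "z \<bullet> \<nu> = (\<Sum>j\<in>UNIV. z $ j * \<nu> $ j)" by (simp add: inner_vec_def)
    also have "\<dots> = z $ k * \<nu> $ k + (\<Sum>j\<in>UNIV-{k}. z $ j * \<nu> $ j)"
      by (rule sum.remove) auto
    also have "(\<Sum>j\<in>UNIV-{k}. z $ j * \<nu> $ j) = - lin k a z"
      by (auto simp: lin_def \<nu>_def sum_negf[symmetric] intro!: sum.cong)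
    finally show ?thesis by (simp add: \<nu>_def)
  qed
  have zu: "z \<bullet> u = (z $ k - lin k a z) / norm \<nu>" for z
    by (simp add: u_def sgn_div_norm z\<nu> divide_simps)
  \<comment> \<open>The vertical vector of length \<open>norm \<nu>\<close> has inner product 1 with
    \<open>u\<close>. Hence \<open>v\<close> is orthogonal to \<open>u\<close>, and the shear keeps
    the level \<open>z \<bullet> u\<close> while exchanging the direction of projection.\<close>
  define v where "v = u - axis k (norm \<nu>)"
  have uv: "u \<bullet> v = 0"
    using N by (simp add: v_def inner_diff_right uu inner_axis uk)
  let ?F = "\<lambda>x. unit_weight (x \<bullet> u) * f (x - (x \<bullet> u) *\<^sub>R u)"
  have eq: "?F (z + (u \<bullet> z) *\<^sub>R v) = unit_weight (z \<bullet> u) * f (vupd z k (lin k a z))" for z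
  proof -
    have "(z + (u \<bullet> z) *\<^sub>R v) \<bullet> u = z \<bullet> u"
      using uv by (simp add: inner_add_right inner_commute)
    moreover have "z + (u \<bullet> z) *\<^sub>R v - (z \<bullet> u) *\<^sub>R u = vupd z k (lin k a z)"
    proof -
      have "z + (u \<bullet> z) *\<^sub>R v - (z \<bullet> u) *\<^sub>R u = z - (z \<bullet> u) *\<^sub>R axis k (norm \<nu>)"
        by (simp add: v_def inner_commute algebra_simps)
      also have "\<dots> = vupd z k (lin k a z)"
        using N by (simp add: zu vec_eq_iff axis_def)
      finally show ?thesis .
    qed
    ultimately show ?thesis by simp
  qed
  have "(\<integral>\<^sup>+y. f y \<partial>subspace_lborel {y. y \<bullet> u = 0}) = (\<integral>\<^sup>+x. ?F x \<partial>lborel)"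
    by (rule nn_integral_subspace_lborel_hyperplane) (use u in auto)
  also have "\<dots> = (\<integral>\<^sup>+z. ?F (z + (u \<bullet> z) *\<^sub>R v) \<partial>lborel)"
    by (rule nn_integral_lborel_shear[symmetric]) (use uv in auto)
  also have "\<dots> = (\<integral>\<^sup>+z. unit_weight (z \<bullet> u) * f (vupd z k (lin k a z)) \<partial>lborel)"
    unfolding eq ..
  also have "\<dots> = (\<integral>\<^sup>+y. unit_weight (y $ k) * (\<integral>\<^sup>+t. unit_weight (vupd y k t \<bullet> u) * f (vupd y k (lin k a y)) \<partial>lborel) \<partial>lborel)"
    by (subst nn_integral_slice_coordinate[of _ k]) auto
  also have "\<dots> = (\<integral>\<^sup>+y. ennreal (norm \<nu>) * (unit_weight (y $ k) * f (vupd y k (lin k a y))) \<partial>lborel)"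
  proof (rule nn_integral_cong)
    fix y :: "real^'n"
    \<comment> \<open>As the height \<open>t\<close> varies, the level changes at rate
      \<open>1 / norm \<nu>\<close>; rescaling the weight produces the surface element.\<close>
    have "(\<integral>\<^sup>+t. unit_weight (vupd y k t \<bullet> u) \<partial>lborel) = (\<integral>\<^sup>+t. unit_weight ((t - lin k a y) / norm \<nu>) \<partial>lborel)"
      by (simp add: zu)
    also have "\<dots> = ennreal (norm \<nu>) * (\<integral>\<^sup>+t. unit_weight t \<partial>lborel)"
      using N by (subst nn_integral_real_affine[of _ "norm \<nu>" "lin k a y"]) auto
    finally have "(\<integral>\<^sup>+t. unit_weight (vupd y k t \<bullet> u) \<partial>lborel) = ennreal (norm \<nu>)" by simp
    then show "unit_weight (y $ k) * (\<integral>\<^sup>+t. unit_weight (vupd y k t \<bullet> u) * f (vupd y k (lin k a y)) \<partial>lborel)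
        = ennreal (norm \<nu>) * (unit_weight (y $ k) * f (vupd y k (lin k a y)))"
      by (simp add: nn_integral_multc ac_simps)
  qed
  also have "\<dots> = ennreal (norm \<nu>) * graph_integral k f a"
    by (simp add: nn_integral_cmult graph_integral_def)
  finally show ?thesis by (simp add: u_def)
qed

text \<open>Projective polar coordinates: the substitution of \<open>t\<close> times
  \<open>(-a, 1)\<close> for \<open>x\<close>, with \<open>t\<close> the \<open>k\<close>-th
  coordinate, has Jacobian \<open>\<bar>t\<bar>\<close> to the power \<open>n - 1\<close>, and the
  condition becomes \<open>\<bar>t\<bar> \<le> c a\<close>. Integrating over \<open>t\<close> yields
  \<open>2 / n\<close> times the \<open>n\<close>-th power of \<open>c a\<close>.\<close>

lemma nn_integral_homogeneous:
  fixes c :: "real^'n \<Rightarrow> real"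
  assumes [measurable]: "c \<in> borel_measurable borel" and c: "\<And>a. c a \<ge> 0" "\<And>a t. c (vupd a k t) = c a"
    and n: "CARD('n) \<ge> 2"
  shows "emeasure lborel {x. x $ k \<noteq> 0 \<and> \<bar>x $ k\<bar> \<le> c ((-1 / x $ k) *\<^sub>R x)}
    = (\<integral>\<^sup>+a. unit_weight (a $ k) * ennreal (2 / CARD('n) * c a ^ CARD('n)) \<partial>lborel)"
proof -
  define B where "B = {x. x $ k \<noteq> 0 \<and> \<bar>x $ k\<bar> \<le> c ((-1 / x $ k) *\<^sub>R x)}"
  let ?m = "CARD('n) - 1"
  have [measurable]: "B \<in> sets borel" unfolding B_def by measurable
  have "emeasure lborel B = (\<integral>\<^sup>+x. indicator B x \<partial>lborel)" by simp
  also have "\<dots> = (\<integral>\<^sup>+y. unit_weight (y $ k) * (\<integral>\<^sup>+t. indicator B (vupd y k t) \<partial>lborel) \<partial>lborel)"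
    by (rule nn_integral_slice_coordinate) simp
  also have "\<dots> = (\<integral>\<^sup>+y. \<integral>\<^sup>+t. unit_weight (y $ k) * indicator B (vupd y k t) \<partial>lborel \<partial>lborel)"
    by (intro nn_integral_cong) (simp add: nn_integral_cmult)
  also have "\<dots> = (\<integral>\<^sup>+t. \<integral>\<^sup>+y. unit_weight (y $ k) * indicator B (vupd y k t) \<partial>lborel \<partial>lborel)"
    by (rule lborel_pair.Fubini') auto
  also have "\<dots> = (\<integral>\<^sup>+t. \<integral>\<^sup>+a. unit_weight (a $ k) * (ennreal (\<bar>t\<bar> powr ?m) * indicator {-c a..c a} t) \<partial>lborel \<partial>lborel)"
  proof (rule nn_integral_cong_AE, use AE_lborel_singleton[of "0::real"] in eventually_elim)
    fix t :: real assume t: "t \<noteq> 0"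
    \<comment> \<open>For fixed \<open>t\<close> the substitution multiplies all coordinates other
      than \<open>k\<close> by \<open>-t\<close>. Coordinate \<open>k\<close> keeps the factor 1,
      since it only carries the weight.\<close>
    have prod: "(\<Prod>i\<in>UNIV. \<bar>if i = k then 1 else - t\<bar>) = \<bar>t\<bar> powr ?m"
    proof -
      have "(\<Prod>i\<in>UNIV. \<bar>if i = k then 1 else - t\<bar>) = (\<Prod>i\<in>UNIV-{k}. \<bar>t\<bar>)"
        by (subst prod.remove[of _ k]) (auto intro!: prod.cong)
      also have "\<dots> = \<bar>t\<bar> ^ ?m" by (simp add: card_Diff_singleton)
      also have "\<dots> = \<bar>t\<bar> powr ?m" using t by (intro powr_realpow[symmetric]) simp
      finally show ?thesis .
    qed
    have ind: "indicator B (vupd (\<chi> i. (if i = k then 1 else - t) * a $ i) k t) = (indicator {-c a..c a} t :: ennreal)" for a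
    proof -
      \<comment> \<open>The entry \<open>-1\<close> in coordinate \<open>k\<close> is immaterial,
        because \<open>c\<close> is invariant under \<open>vupd\<close> there.\<close>
      have "(-1 / t) *\<^sub>R vupd (\<chi> i. (if i = k then 1 else - t) * a $ i) k t = vupd a k (-1)"
        using t by (simp add: vec_eq_iff)
      then show ?thesis using t by (auto simp: B_def indicator_def c)
    qed
    have "(\<integral>\<^sup>+y. unit_weight (y $ k) * indicator B (vupd y k t) \<partial>lborel)
        = ennreal (\<bar>t\<bar> powr ?m) * (\<integral>\<^sup>+a. unit_weight (a $ k) * indicator {-c a..c a} t \<partial>lborel)"
      using t by (subst nn_integral_lborel_diagonal[of _ "\<lambda>i. if i = k then 1 else - t"]) (auto simp: ind prod simp del: of_nat_diff)
    also have "\<dots> = (\<integral>\<^sup>+a. unit_weight (a $ k) * (ennreal (\<bar>t\<bar> powr ?m) * indicator {-c a..c a} t) \<partial>lborel)"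
      by (subst nn_integral_cmult[symmetric]) (auto simp: ac_simps indicator_def)
    finally show "(\<integral>\<^sup>+y. unit_weight (y $ k) * indicator B (vupd y k t) \<partial>lborel)
        = (\<integral>\<^sup>+a. unit_weight (a $ k) * (ennreal (\<bar>t\<bar> powr ?m) * indicator {-c a..c a} t) \<partial>lborel)" .
  qed
  also have "\<dots> = (\<integral>\<^sup>+a. \<integral>\<^sup>+t. unit_weight (a $ k) * (ennreal (\<bar>t\<bar> powr ?m) * indicator {-c a..c a} t) \<partial>lborel \<partial>lborel)"
    by (rule lborel_pair.Fubini') (auto simp: indicator_def)
  also have "\<dots> = (\<integral>\<^sup>+a. unit_weight (a $ k) * ennreal (2 / CARD('n) * c a ^ CARD('n)) \<partial>lborel)"
  proof (rule nn_integral_cong)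
    fix a
    have "2 * c a powr (real ?m + 1) / (real ?m + 1) = 2 / CARD('n) * c a ^ CARD('n)"
    proof -
      have "real ?m + 1 = real CARD('n)" using n by simp
      then show ?thesis using c(1)[of a] n by (simp add: powr_realpow')
    qed
    then show "(\<integral>\<^sup>+t. unit_weight (a $ k) * (ennreal (\<bar>t\<bar> powr ?m) * indicator {-c a..c a} t) \<partial>lborel)
        = unit_weight (a $ k) * ennreal (2 / CARD('n) * c a ^ CARD('n))"
      using nn_integral_abs_powr[of "real ?m" "c a"] c(1)[of a] by (simp add: nn_integral_cmult)
  qed
  finally show ?thesis by (simp add: B_def)
qed

text \<open>Off the hyperplane \<open>x $ k = 0\<close> every point is \<open>x $ k\<close> times a
  normal \<open>\<nu> = (-a, 1)\<close>. Its norm and the radial function both contain the factor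
  \<open>norm \<nu>\<close>; cancelling it turns membership into
  \<open>\<bar>x $ k\<bar> \<le> c a\<close>.\<close>

lemma emeasure_I_body:
  fixes g :: "real^'n \<Rightarrow> real"
  assumes g [measurable]: "g \<in> borel_measurable borel" "\<And>x. g x \<ge> 0"
    and fin: "\<And>a. graph_integral k (\<lambda>x. ennreal (g x)) a < \<infinity>"
    and n: "CARD('n) \<ge> 2"
  shows "emeasure lebesgue (I_body g)
    = ennreal (2 / CARD('n)) * (\<integral>\<^sup>+a. unit_weight (a $ k) * graph_integral k (\<lambda>x. ennreal (g x)) a ^ CARD('n) \<partial>lborel)"
proof -
  define G where "G = graph_integral k (\<lambda>x. ennreal (g x))"
  define c where "c = (\<lambda>a. enn2real (G a))"
  have G: "G a = ennreal (c a)" for a using fin[of a] by (simp add: c_def G_def)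
  have c0: "c a \<ge> 0" for a by (simp add: c_def)
  have c_meas [measurable]: "c \<in> borel_measurable borel" unfolding c_def G_def by measurable
  have c_vupd: "c (vupd a k t) = c a" for a t by (simp add: c_def G_def)
  have radial: "radial_I g (sgn (vupd (- a) k 1)) = norm (vupd (- a) k 1) * c a" for a
  proof -
    have "radial_I g (sgn (vupd (- a) k 1)) = enn2real (\<integral>\<^sup>+y. ennreal (g y) \<partial>subspace_lborel {y. y \<bullet> sgn (vupd (- a) k 1) = 0})"
      unfolding radial_I_def by (rule integral_eq_nn_integral) (auto simp: g)
    then show ?thesis
      by (simp add: nn_integral_subspace_lborel_graph G_def[symmetric] G c0 ennreal_mult[symmetric])
  qed
  \<comment> \<open>Opposite normals define the same hyperplane; this covers the points with
    negative \<open>x $ k\<close>.\<close>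
  have radial_minus: "radial_I g (- u) = radial_I g u" for u by (simp add: radial_I_def)
  define B where "B = {x. x $ k \<noteq> 0 \<and> \<bar>x $ k\<bar> \<le> c ((-1 / x $ k) *\<^sub>R x)}"
  have B: "B \<in> sets borel" unfolding B_def by measurable
  have mem: "x \<in> I_body g \<longleftrightarrow> x \<in> B" if xk: "x $ k \<noteq> 0" for x
  proof -
    define a where "a = (-1 / x $ k) *\<^sub>R x"
    define \<nu> where "\<nu> = vupd (- a) k 1"
    have x: "x = x $ k *\<^sub>R \<nu>" using xk by (simp add: a_def \<nu>_def vec_eq_iff)
    have "\<nu> $ k = 1" by (simp add: \<nu>_def)
    then have N: "norm \<nu> > 0" by auto
    have x0: "x \<noteq> 0" using xk by auto
    have nx: "norm x = \<bar>x $ k\<bar> * norm \<nu>" by (subst x) simp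
    have sx: "sgn x = sgn (x $ k) *\<^sub>R sgn \<nu>"
      by (subst x) (simp only: sgn_scaleR)
    have "radial_I g (sgn x) = radial_I g (sgn \<nu>)"
      using xk by (auto simp: sx sgn_if radial_minus)
    also have "\<dots> = norm \<nu> * c a" using radial[of a] by (simp add: \<nu>_def)
    finally have r: "radial_I g (sgn x) = norm \<nu> * c a" .
    have "x \<in> I_body g \<longleftrightarrow> norm x \<le> radial_I g (sgn x)"
    proof
      assume "x \<in> I_body g"
      then obtain r u where ru: "x = r *\<^sub>R u" "norm u = 1" "0 \<le> r" "r \<le> radial_I g u"
        by (auto simp: I_body_def)
      then have "norm x = r" "sgn x = u" using x0 by (auto simp: sgn_div_norm)
      then show "norm x \<le> radial_I g (sgn x)" using ru by simp
    next
      assume "norm x \<le> radial_I g (sgn x)"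
      then show "x \<in> I_body g"
        using x0 unfolding I_body_def
        by (intro CollectI exI[of _ "norm x"] exI[of _ "sgn x"]) (simp add: sgn_div_norm)
    qed
    also have "\<dots> \<longleftrightarrow> \<bar>x $ k\<bar> \<le> c a"
      using N by (simp add: r nx mult.commute)
    finally show ?thesis using xk by (simp add: a_def B_def)
  qed
  have "{x::real^'n. x $ k = 0} = {x. axis k 1 \<bullet> x = 0}"
    by (simp add: inner_axis')
  then have hyp: "negligible {x::real^'n. x $ k = 0}"
    by (simp add: negligible_hyperplane axis_eq_0_iff)
  have AE: "AE x in lebesgue. x $ k \<noteq> (0::real)"
    using AE_not_in[of "{x::real^'n. x $ k = 0}" lebesgue] hyp by (simp add: negligible_iff_null_sets)
  have AE': "AE x in lebesgue. x \<in> B \<longleftrightarrow> x \<in> I_body g"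
    using AE by eventually_elim (simp add: mem)
  \<comment> \<open>The part inside the hyperplane is only known to be contained in a null set, so
    its measurability comes from completeness of \<open>lebesgue\<close>.\<close>
  have I: "I_body g = B \<union> (I_body g \<inter> {x. x $ k = 0})"
    using mem by (auto simp: B_def)
  have "negligible (I_body g \<inter> {x. x $ k = 0})"
    using hyp by (rule negligible_subset) auto
  then have "I_body g \<inter> {x. x $ k = 0} \<in> sets lebesgue"
    by (rule negligible_imp_sets)
  moreover have B': "B \<in> sets lebesgue"
    using B by (intro sets_completionI_sets) simp
  ultimately have "I_body g \<in> sets lebesgue"
    by (subst I) (rule sets.Un)
  then have "emeasure lebesgue (I_body g) = emeasure lebesgue B"
    by (rule emeasure_eq_AE[OF AE' B', symmetric])
  also have "\<dots> = emeasure lborel B"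
    using B by simp
  also have "\<dots> = (\<integral>\<^sup>+a. unit_weight (a $ k) * ennreal (2 / CARD('n) * c a ^ CARD('n)) \<partial>lborel)"
    unfolding B_def by (rule nn_integral_homogeneous[of c k, OF c_meas c0 c_vupd n])
  also have "\<dots> = (\<integral>\<^sup>+a. ennreal (2 / CARD('n)) * (unit_weight (a $ k) * G a ^ CARD('n)) \<partial>lborel)"
  proof (rule nn_integral_cong)
    fix a
    have "ennreal (2 / CARD('n) * c a ^ CARD('n)) = ennreal (2 / CARD('n)) * ennreal (c a ^ CARD('n))"
      using c0 by (intro ennreal_mult) auto
    then show "unit_weight (a $ k) * ennreal (2 / CARD('n) * c a ^ CARD('n))
        = ennreal (2 / CARD('n)) * (unit_weight (a $ k) * G a ^ CARD('n))"
      by (simp only: G ennreal_power[OF c0] mult.left_commute)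
  qed
  also have "\<dots> = ennreal (2 / CARD('n)) * (\<integral>\<^sup>+a. unit_weight (a $ k) * G a ^ CARD('n) \<partial>lborel)"
    unfolding G_def by (rule nn_integral_cmult) measurable
  finally show ?thesis unfolding G_def .
qed

section \<open>Radially negligible boundaries\<close>

text \<open>The ray is an isometric copy of the half-line, so a cover of its part in
  \<open>A\<close> gives a cover of the radii by intervals as long as the diameters. The single
  scale 1 suffices, the Hausdorff measure being a supremum over scales.\<close>

lemma emeasure_ray_le_hausdorff:
  fixes u :: "'a::euclidean_space"
  assumes u: "norm u = 1" and S: "{r. 0 \<le> r \<and> r *\<^sub>R u \<in> A} \<in> sets borel"
  shows "emeasure lborel {r. 0 \<le> r \<and> r *\<^sub>R u \<in> A} \<le> hausdorff_measure 1 (A \<inter> {r *\<^sub>R u | r. 0 \<le> r})"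
proof -
  let ?S = "{r. 0 \<le> r \<and> r *\<^sub>R u \<in> A}" and ?A = "A \<inter> {r *\<^sub>R u | r. 0 \<le> r}"
  have "emeasure lborel ?S \<le> hausdorff_content 1 1 ?A"
    unfolding hausdorff_content_def
  proof (rule INF_greatest)
    fix C :: "nat \<Rightarrow> 'a set"
    assume "C \<in> {C. ?A \<subseteq> (\<Union>i. C i) \<and> (\<forall>i. bounded (C i) \<and> diameter (C i) \<le> 1)}"
    then have C: "?A \<subseteq> (\<Union>i. C i)" "\<forall>i. bounded (C i) \<and> diameter (C i) \<le> 1"
      by auto
    define T where "T i = {r. 0 \<le> r \<and> r *\<^sub>R u \<in> C i}" for i
    \<comment> \<open>Starting the interval at the infimum keeps its length equal to the diameter,
      where an interval centred at a point of \<open>T i\<close> would need twice that.\<close>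
    define J where "J i = (if T i = {} then {} else {Inf (T i) .. Inf (T i) + diameter (C i)})" for i
    have TJ: "T i \<subseteq> J i" for i
    proof
      fix r assume r: "r \<in> T i"
      have "bdd_below (T i)" by (rule bdd_belowI[of _ 0]) (auto simp: T_def)
      then have "Inf (T i) \<le> r" using r by (rule cInf_lower[rotated])
      moreover have "r - diameter (C i) \<le> Inf (T i)"
      proof (rule cInf_greatest)
        fix r' assume r': "r' \<in> T i"
        have "\<bar>r - r'\<bar> = dist (r *\<^sub>R u) (r' *\<^sub>R u)"
          using u by (simp add: dist_norm flip: scaleR_left_diff_distrib)
        also have "\<dots> \<le> diameter (C i)"
          using C r r' by (intro diameter_bounded_bound) (auto simp: T_def)
        finally show "r - diameter (C i) \<le> r'" by linarith
      qed (use r in auto)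
      ultimately show "r \<in> J i" using r by (auto simp: J_def)
    qed
    have d: "diameter (C i) \<ge> 0" for i using C by (intro diameter_ge_0) auto
    have "?S \<subseteq> (\<Union>i. J i)"
    proof
      fix r assume r: "r \<in> ?S"
      then have "r *\<^sub>R u \<in> ?A" by auto
      then obtain i where "r *\<^sub>R u \<in> C i" using C(1) by blast
      then have "r \<in> T i" using r by (auto simp: T_def)
      then show "r \<in> (\<Union>i. J i)" using TJ by blast
    qed
    then have "emeasure lborel ?S \<le> emeasure lborel (\<Union>i. J i)"
      by (intro emeasure_mono) (auto simp: J_def)
    also have "\<dots> \<le> (\<Sum>i. emeasure lborel (J i))"
      by (intro emeasure_subadditive_countably) (auto simp: J_def)
    \<comment> \<open>Since \<open>unit_ball_vol 1\<close> is 2, each term of the Hausdorff sum is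
      just the diameter.\<close>
    also have "\<dots> \<le> (\<Sum>i. if C i = {} then 0 else ennreal (unit_ball_vol 1 * (diameter (C i) / 2)))"
    proof (intro suminf_le summableI)
      fix i
      show "emeasure lborel (J i) \<le> (if C i = {} then 0 else ennreal (unit_ball_vol 1 * (diameter (C i) / 2)))"
        using d[of i] by (auto simp: J_def T_def unit_ball_vol_1)
    qed
    finally show "emeasure lborel ?S \<le> (\<Sum>i. if C i = {} then 0 else ennreal (unit_ball_vol (real 1) * (diameter (C i) / 2) ^ 1))"
      by (simp only: of_nat_1 power_one_right)
  qed
  also have "\<dots> \<le> hausdorff_measure 1 ?A"
    unfolding hausdorff_measure_def by (rule SUP_upper) simp
  finally show ?thesis .
qed

text \<open>Fubini in radius and direction replaces polar coordinates. Let \<open>h x\<close> be the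
  length of the set of \<open>r \<ge> 0\<close> with \<open>r *\<^sub>R x\<close> in the boundary.
  Radial negligibility makes \<open>h\<close> vanish almost everywhere on the unit ball; exchanging
  integrals, for almost every \<open>r > 0\<close> the part in the ball of the boundary shrunk by
  \<open>r\<close> is null. For large \<open>r\<close> this is all of the shrunk boundary.\<close>

lemma null_sets_frontier_radially_negligible:
  fixes K :: "(real^'n) set"
  assumes K: "compact K" and neg: "radially_negligible_boundary K"
  shows "frontier K \<in> null_sets lborel"
proof -
  let ?A = "frontier K"
  have A [measurable]: "?A \<in> sets borel" by (simp add: borel_closed)
  define h where "h x = (\<integral>\<^sup>+r. indicator ?A (r *\<^sub>R x) * indicator {0..} r \<partial>(lborel::real measure))" for x :: "real^'n"
  have [measurable]: "h \<in> borel_measurable borel" unfolding h_def by measurable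
  \<comment> \<open>The comparison with Hausdorff measure holds for unit vectors, whereas
    \<open>sphere_haar\<close> lives on the whole space; off the sphere the function is set to
    0.\<close>
  define h1 where "h1 u = h u * indicator (sphere 0 1) u" for u
  have [measurable]: "sphere (0::real^'n) 1 \<in> sets borel" "ball (0::real^'n) 1 \<in> sets borel"
    by (simp_all add: borel_closed borel_open)
  have [measurable]: "h1 \<in> borel_measurable borel"
    unfolding h1_def by measurable
  have h1_le: "h1 u \<le> hausdorff_measure 1 (?A \<inter> {r *\<^sub>R u | r. 0 \<le> r})" for u
  proof (cases "norm u = 1")
    case True
    have S: "{r. 0 \<le> r \<and> r *\<^sub>R u \<in> ?A} \<in> sets borel" by measurable
    have "h u = (\<integral>\<^sup>+r. indicator {r. 0 \<le> r \<and> r *\<^sub>R u \<in> ?A} r \<partial>lborel)"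
      unfolding h_def by (intro nn_integral_cong) (auto simp: indicator_def)
    also have "\<dots> = emeasure lborel {r. 0 \<le> r \<and> r *\<^sub>R u \<in> ?A}"
      using S by simp
    finally show ?thesis
      using emeasure_ray_le_hausdorff[OF True S] True by (simp add: h1_def)
  qed (simp add: h1_def)
  \<comment> \<open>Measurability of the Hausdorff integrand is not established, so the smaller
    measurable \<open>h1\<close> takes its place before passing to almost-everywhere
    statements.\<close>
  have "(\<integral>\<^sup>+u. h1 u \<partial>sphere_haar) \<le> (\<integral>\<^sup>+u. hausdorff_measure 1 (?A \<inter> {r *\<^sub>R u | r. 0 \<le> r}) \<partial>sphere_haar)"
    by (intro nn_integral_mono h1_le)
  then have "(\<integral>\<^sup>+u. h1 u \<partial>sphere_haar) = 0"
    using neg by (simp add: radially_negligible_boundary_def)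
  moreover have "(\<integral>\<^sup>+u. h1 u \<partial>sphere_haar)
      = (\<integral>\<^sup>+x. h1 (sgn x) * indicator (ball 0 1) x \<partial>lborel) / emeasure lborel (ball (0::real^'n) 1)"
    unfolding sphere_haar_def by (subst nn_integral_distr) (auto simp: nn_integral_uniform_measure)
  ultimately have "(\<integral>\<^sup>+x. h1 (sgn x) * indicator (ball 0 1) x \<partial>lborel) = 0"
    using emeasure_unit_ball[where 'a="real^'n"] by (auto simp: ennreal_divide_eq_0_iff)
  then have AE_h1: "AE x in lborel. h1 (sgn x) * indicator (ball 0 1) x = 0"
    by (subst (asm) nn_integral_0_iff_AE) auto
  \<comment> \<open>Homogeneity of degree -1 of \<open>h\<close> carries its vanishing from
    directions to almost all points of the ball.\<close>
  have scale: "h1 (sgn x) = ennreal (norm x) * h x" if "x \<noteq> 0" for x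
  proof -
    have "h (sgn x) = ennreal \<bar>norm x\<bar> * (\<integral>\<^sup>+r. indicator ?A ((norm x * r) *\<^sub>R sgn x) * indicator {0..} (norm x * r) \<partial>lborel)"
      unfolding h_def using that by (intro nn_integral_lborel_scale) auto
    also have "(\<integral>\<^sup>+r. indicator ?A ((norm x * r) *\<^sub>R sgn x) * indicator {0..} (norm x * r) \<partial>lborel) = h x"
      unfolding h_def using that
      by (intro nn_integral_cong) (auto simp: sgn_div_norm indicator_def zero_le_mult_iff mult.commute[of "norm x"] mult.assoc)
    finally show ?thesis using that by (simp add: h1_def norm_sgn)
  qed
  have "AE x in lborel. h x * indicator (ball 0 1) x = 0"
    using AE_h1 AE_lborel_singleton[of "0::real^'n"]
    by eventually_elim (auto simp: scale split: split_indicator_asm)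
  then have "(\<integral>\<^sup>+x. h x * indicator (ball 0 1) x \<partial>lborel) = 0"
    by (subst nn_integral_0_iff_AE) auto
  also have "(\<integral>\<^sup>+x. h x * indicator (ball 0 1) x \<partial>lborel)
      = (\<integral>\<^sup>+x. \<integral>\<^sup>+r. indicator ?A (r *\<^sub>R x) * indicator {0..} r * indicator (ball 0 1) x \<partial>(lborel::real measure) \<partial>lborel)"
    unfolding h_def by (simp add: nn_integral_multc)
  also have "\<dots> = (\<integral>\<^sup>+r. \<integral>\<^sup>+x. indicator ?A (r *\<^sub>R x) * indicator {0..} r * indicator (ball 0 1) x \<partial>lborel \<partial>(lborel::real measure))"
    by (rule lborel_pair.Fubini') auto
  finally have AE_r: "AE r in (lborel::real measure). (\<integral>\<^sup>+x. indicator ?A (r *\<^sub>R x) * indicator {0..} r * indicator (ball 0 1) x \<partial>lborel) = 0"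
    by (subst (asm) nn_integral_0_iff_AE) auto
  have "bounded ?A" using K by (simp add: compact_imp_bounded compact_frontier)
  then obtain b where b: "b > 0" "\<And>x. x \<in> ?A \<Longrightarrow> norm x \<le> b"
    by (auto simp: bounded_pos)
  \<comment> \<open>Almost every radius is good and the interval from \<open>b\<close> to
    \<open>b + 1\<close> has positive length, so some good radius exceeds \<open>b\<close>.\<close>
  have "\<exists>r>b. (\<integral>\<^sup>+x. indicator ?A (r *\<^sub>R x) * indicator {0..} r * indicator (ball 0 1) x \<partial>lborel) = (0::ennreal)"
  proof (rule ccontr)
    assume none: "\<not> ?thesis"
    have "AE r in lborel. r \<notin> {b<..b + 1}"
      using AE_r by (rule eventually_mono) (use none in auto)
    then have "{b<..b + 1} \<in> null_sets lborel"
      by (subst AE_iff_null_sets) auto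
    then show False by (simp add: null_sets_def)
  qed
  then obtain r where r: "r > b" "(\<integral>\<^sup>+x. indicator ?A (r *\<^sub>R x) * indicator {0..} r * indicator (ball 0 1) x \<partial>lborel) = (0::ennreal)"
    by blast
  have r0: "r > 0" using r b by simp
  have "emeasure lborel ?A = (\<integral>\<^sup>+x. indicator ?A x \<partial>lborel)" by simp
  also have "\<dots> = ennreal (\<Prod>i\<in>(UNIV::'n set). \<bar>r\<bar>) * (\<integral>\<^sup>+x. indicator ?A (\<chi> i. r * x $ i) \<partial>lborel)"
    using r0 by (intro nn_integral_lborel_diagonal) auto
  also have "(\<integral>\<^sup>+x. indicator ?A (\<chi> i. r * x $ i) \<partial>lborel)
      = (\<integral>\<^sup>+x. indicator ?A (r *\<^sub>R x) * indicator {0..} r * indicator (ball 0 1) x \<partial>lborel)"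
  proof (rule nn_integral_cong)
    fix x :: "real^'n"
    have *: "(\<chi> i. r * x $ i) = r *\<^sub>R x" by (simp add: vec_eq_iff)
    have "norm x < 1" if "r *\<^sub>R x \<in> ?A"
    proof -
      have "r * norm x \<le> b" using b(2)[OF that] r0 by simp
      then have "r * norm x < r * 1" using r(1) by simp
      then show ?thesis using r0 by (simp only: mult_less_cancel_left_pos)
    qed
    then show "(indicator ?A (\<chi> i. r * x $ i) :: ennreal) = indicator ?A (r *\<^sub>R x) * indicator {0..} r * indicator (ball 0 1) x"
      using r0 by (auto simp: * indicator_def)
  qed
  finally have "emeasure lborel ?A = 0" using r(2) by simp
  then show ?thesis by (auto simp: null_sets_def)
qed

section \<open>One-dimensional estimates\<close>

text \<open>The kernels \<open>(p + 1) / 2 * \<bar>s\<bar> powr p\<close> form an approximate identity as \<open>p\<close> decreases to \<open>-1\<close>.\<close>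

lemma powr_kernel_tendsto:
  fixes \<phi> :: "real \<Rightarrow> real"
  assumes [measurable]: "\<phi> \<in> borel_measurable borel"
    and \<phi>: "\<And>s. 0 \<le> \<phi> s" "\<And>s. \<phi> s \<le> M" "\<And>s. \<phi> s \<noteq> 0 \<Longrightarrow> \<bar>s\<bar> \<le> B" and cont: "isCont \<phi> 0"
  shows "((\<lambda>p. ennreal (p + 1) * (\<integral>\<^sup>+s. ennreal (\<bar>s\<bar> powr p * \<phi> s) \<partial>lborel)) \<longlongrightarrow> ennreal (2 * \<phi> 0)) (at_right (-1))"
    (is "(?H \<longlongrightarrow> _) _")
proof -
  have M0: "M \<ge> 0" using \<phi>(1,2)[of 0] by linarith
  define B' where "B' = max B 0"
  have B': "B' \<ge> 0" "\<And>s. \<phi> s \<noteq> 0 \<Longrightarrow> s \<in> {-B'..B'}"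
    using \<phi>(3) by (force simp: B'_def)+
  \<comment> \<open>For \<open>\<bar>s\<bar> \<le> \<delta>\<close> the function is at most
    \<open>\<phi> 0 + \<epsilon>\<close> and \<open>(p + 1) * \<bar>s\<bar> powr p\<close> has mass
    \<open>2 * \<delta> powr (p + 1)\<close>. Farther out the power is at most
    \<open>\<delta> powr p\<close>, the function at most \<open>M\<close>, and its support has
    length at most \<open>2 * B'\<close>; this part vanishes with \<open>p + 1\<close>. The lower
    bound \<open>lo\<close> keeps only the central part.\<close>
  define up where "up \<epsilon> \<delta> p = (\<phi> 0 + \<epsilon>) * (2 * \<delta> powr (p + 1)) + (p + 1) * (M * \<delta> powr p * (2 * B'))" for \<epsilon> \<delta> p
  define lo where "lo \<epsilon> \<delta> p = (\<phi> 0 - \<epsilon>) * (2 * \<delta> powr (p + 1))" for \<epsilon> \<delta> p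
  have up_lim: "(up \<epsilon> \<delta> \<longlongrightarrow> 2 * (\<phi> 0 + \<epsilon>)) (at_right (-1))" if "\<delta> > 0" for \<epsilon> \<delta>
    unfolding up_def using that by (auto intro!: tendsto_eq_intros)
  have lo_lim: "(lo \<epsilon> \<delta> \<longlongrightarrow> 2 * (\<phi> 0 - \<epsilon>)) (at_right (-1))" if "\<delta> > 0" for \<epsilon> \<delta>
    unfolding lo_def using that by (auto intro!: tendsto_eq_intros)
  have range: "\<forall>\<^sub>F p in at_right (-1). -1 < p \<and> p < (0::real)"
    by (auto simp: eventually_at_right[of "-1" 0] intro!: exI[of _ 0])
  have ker: "ennreal (p + 1) * (\<integral>\<^sup>+s. ennreal (c * (\<bar>s\<bar> powr p * indicator {-\<delta>..\<delta>} s)) \<partial>lborel) = ennreal (c * (2 * \<delta> powr (p + 1)))"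
    if "p > -1" "\<delta> > 0" "c \<ge> 0" for p \<delta> c
  proof -
    have "(\<integral>\<^sup>+s. ennreal (c * (\<bar>s\<bar> powr p * indicator {-\<delta>..\<delta>} s)) \<partial>lborel)
        = (\<integral>\<^sup>+s. ennreal c * (ennreal (\<bar>s\<bar> powr p) * indicator {-\<delta>..\<delta>} s) \<partial>lborel)"
      using that by (intro nn_integral_cong) (auto simp: indicator_def ennreal_mult)
    also have "\<dots> = ennreal c * ennreal (2 * \<delta> powr (p + 1) / (p + 1))"
      using that by (subst nn_integral_cmult) (auto simp: nn_integral_abs_powr)
    finally show ?thesis
      using that by (simp add: ennreal_mult[symmetric])
  qed
  have H_up: "?H p \<le> ennreal (up \<epsilon> \<delta> p)"
    if p: "-1 < p" "p < 0" and \<delta>: "\<delta> > 0" "\<epsilon> \<ge> 0" "\<And>s. \<bar>s\<bar> \<le> \<delta> \<Longrightarrow> \<bar>\<phi> s - \<phi> 0\<bar> \<le> \<epsilon>" for p \<epsilon> \<delta>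
  proof -
    have "(\<integral>\<^sup>+s. ennreal (\<bar>s\<bar> powr p * \<phi> s) \<partial>lborel)
        \<le> (\<integral>\<^sup>+s. ennreal ((\<phi> 0 + \<epsilon>) * (\<bar>s\<bar> powr p * indicator {-\<delta>..\<delta>} s)) + ennreal (M * \<delta> powr p) * indicator {-B'..B'} s \<partial>lborel)"
    proof (rule nn_integral_mono)
      fix s :: real
      show "ennreal (\<bar>s\<bar> powr p * \<phi> s) \<le> ennreal ((\<phi> 0 + \<epsilon>) * (\<bar>s\<bar> powr p * indicator {-\<delta>..\<delta>} s)) + ennreal (M * \<delta> powr p) * indicator {-B'..B'} s"
      proof (cases "\<bar>s\<bar> \<le> \<delta>")
        case True
        have "\<bar>s\<bar> powr p * \<phi> s \<le> (\<phi> 0 + \<epsilon>) * (\<bar>s\<bar> powr p * indicator {-\<delta>..\<delta>} s)"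
          using True \<delta>(3)[OF True] mult_left_mono[of "\<phi> s" "\<phi> 0 + \<epsilon>" "\<bar>s\<bar> powr p"]
          by (auto simp: indicator_def mult.commute)
        then show ?thesis by (meson add_increasing2 ennreal_leI zero_le)
      next
        case False
        have "\<bar>s\<bar> powr p \<le> \<delta> powr p"
          using False p \<delta>(1) by (intro powr_mono2') auto
        then have le: "\<bar>s\<bar> powr p * \<phi> s \<le> M * \<delta> powr p * indicator {-B'..B'} s"
          using B'(2)[of s] \<phi>(1,2)[of s] mult_mono[of "\<bar>s\<bar> powr p" "\<delta> powr p" "\<phi> s" M]
          by (cases "\<phi> s = 0") (auto simp: mult.commute M0 indicator_def)
        have "ennreal (\<bar>s\<bar> powr p * \<phi> s) \<le> ennreal (M * \<delta> powr p) * indicator {-B'..B'} s"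
        proof (cases "s \<in> {-B'..B'}")
          case True
          then show ?thesis using le by (simp only: indicator_simps mult_1_right ennreal_leI)
        next
          case False
          then have "\<phi> s = 0" using B'(2) by blast
          then show ?thesis by simp
        qed
        then show ?thesis by (meson add_increasing zero_le)
      qed
    qed
    also have "\<dots> = (\<integral>\<^sup>+s. ennreal ((\<phi> 0 + \<epsilon>) * (\<bar>s\<bar> powr p * indicator {-\<delta>..\<delta>} s)) \<partial>lborel) + ennreal (M * \<delta> powr p) * ennreal (2 * B')"
      using B'(1) by (subst nn_integral_add) (auto simp: nn_integral_cmult)
    finally have "?H p \<le> ennreal (p + 1) * \<dots>"
      by (rule mult_left_mono) simp
    also have "\<dots> = ennreal (up \<epsilon> \<delta> p)"
      unfolding distrib_left using p \<delta> \<phi>(1)[of 0] M0 B'(1)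
      by (subst ker) (auto simp: up_def ennreal_mult[symmetric] ennreal_plus[symmetric] simp del: ennreal_plus)
    finally show ?thesis .
  qed
  have H_lo: "ennreal (lo \<epsilon> \<delta> p) \<le> ?H p"
    if p: "-1 < p" and \<delta>: "\<delta> > 0" "\<And>s. \<bar>s\<bar> \<le> \<delta> \<Longrightarrow> \<bar>\<phi> s - \<phi> 0\<bar> \<le> \<epsilon>" for p \<epsilon> \<delta>
  proof (cases "\<phi> 0 - \<epsilon> \<ge> 0")
    case True
    have "ennreal (lo \<epsilon> \<delta> p) = ennreal (p + 1) * (\<integral>\<^sup>+s. ennreal ((\<phi> 0 - \<epsilon>) * (\<bar>s\<bar> powr p * indicator {-\<delta>..\<delta>} s)) \<partial>lborel)"
      using ker[OF p \<delta>(1) True] by (simp add: lo_def)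
    also have "\<dots> \<le> ?H p"
    proof (intro mult_left_mono nn_integral_mono ennreal_leI)
      fix s
      show "(\<phi> 0 - \<epsilon>) * (\<bar>s\<bar> powr p * indicator {-\<delta>..\<delta>} s) \<le> \<bar>s\<bar> powr p * \<phi> s"
      proof (cases "\<bar>s\<bar> \<le> \<delta>")
        case True
        then show ?thesis
          using \<delta>(2)[OF True] mult_left_mono[of "\<phi> 0 - \<epsilon>" "\<phi> s" "\<bar>s\<bar> powr p"]
          by (auto simp: indicator_def mult.commute)
      qed (auto simp: indicator_def \<phi>(1))
    qed simp
    finally show ?thesis .
  next
    case False
    then have "lo \<epsilon> \<delta> p \<le> 0" by (auto simp: lo_def mult_le_0_iff)
    then show ?thesis by (simp add: ennreal_neg)
  qed
  have ex_\<delta>: "\<exists>\<delta>>0. \<forall>s. \<bar>s\<bar> \<le> \<delta> \<longrightarrow> \<bar>\<phi> s - \<phi> 0\<bar> \<le> \<epsilon>" if pos: "\<epsilon> > 0" for \<epsilon>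
  proof -
    obtain d where d: "d > 0" "\<forall>s. dist s 0 < d \<longrightarrow> dist (\<phi> s) (\<phi> 0) < \<epsilon>"
      using cont[unfolded continuous_at_eps_delta, THEN spec, of \<epsilon>] pos by auto
    have "\<bar>\<phi> s - \<phi> 0\<bar> \<le> \<epsilon>" if "\<bar>s\<bar> \<le> d / 2" for s
    proof -
      have "\<bar>s\<bar> < d" using that d(1) by linarith
      then show ?thesis using d(2) by (simp add: dist_real_def less_imp_le)
    qed
    then show ?thesis using d(1) by (intro exI[of _ "d / 2"]) auto
  qed
  show ?thesis
  proof (rule order_tendstoI)
    fix a assume a: "a < ennreal (2 * \<phi> 0)"
    then obtain c where c: "a = ennreal c" "c \<ge> 0" "c < 2 * \<phi> 0"
      by (cases a) (auto simp: ennreal_less_iff)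
    define \<epsilon> where "\<epsilon> = (2 * \<phi> 0 - c) / 4"
    have \<epsilon>: "\<epsilon> > 0" "c < 2 * (\<phi> 0 - \<epsilon>)" using c by (auto simp: \<epsilon>_def field_simps)
    obtain \<delta> where \<delta>: "\<delta> > 0" "\<And>s. \<bar>s\<bar> \<le> \<delta> \<Longrightarrow> \<bar>\<phi> s - \<phi> 0\<bar> \<le> \<epsilon>" using ex_\<delta>[OF \<epsilon>(1)] by blast
    have "\<forall>\<^sub>F p in at_right (-1). c < lo \<epsilon> \<delta> p"
      using lo_lim[OF \<delta>(1)] \<epsilon>(2) by (rule order_tendstoD)
    with range show "\<forall>\<^sub>F p in at_right (-1). a < ?H p"
    proof eventually_elim
      case (elim p)
      then have "a < ennreal (lo \<epsilon> \<delta> p)" using c by (simp add: ennreal_less_iff)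
      then show ?case using H_lo[of p \<delta> \<epsilon>] elim \<delta> by (meson less_le_trans)
    qed
  next
    fix a assume a: "ennreal (2 * \<phi> 0) < a"
    obtain c where c: "2 * \<phi> 0 < c" "ennreal c \<le> a"
    proof (cases a)
      case (real r)
      then show ?thesis using a \<phi>(1)[of 0] by (intro that[of r]) (auto simp: ennreal_less_iff)
    next
      case top
      then show ?thesis by (intro that[of "2 * \<phi> 0 + 1"]) auto
    qed
    define \<epsilon> where "\<epsilon> = (c - 2 * \<phi> 0) / 4"
    have \<epsilon>: "\<epsilon> > 0" "2 * (\<phi> 0 + \<epsilon>) < c" using c by (auto simp: \<epsilon>_def field_simps)
    obtain \<delta> where \<delta>: "\<delta> > 0" "\<And>s. \<bar>s\<bar> \<le> \<delta> \<Longrightarrow> \<bar>\<phi> s - \<phi> 0\<bar> \<le> \<epsilon>" using ex_\<delta>[OF \<epsilon>(1)] by blast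
    have "\<forall>\<^sub>F p in at_right (-1). up \<epsilon> \<delta> p < c"
      using up_lim[OF \<delta>(1)] \<epsilon>(2) by (rule order_tendstoD)
    with range show "\<forall>\<^sub>F p in at_right (-1). ?H p < a"
    proof eventually_elim
      case (elim p)
      then have "ennreal (up \<epsilon> \<delta> p) < ennreal c"
        using c \<phi>(1)[of 0] by (intro ennreal_lessI) auto
      then show ?case using H_up[of p \<delta> \<epsilon>] elim \<delta> \<epsilon>(1) c(2) by (meson le_less_trans less_imp_le less_le_trans)
    qed
  qed
qed

text \<open>The bound is uniform in \<open>p\<close>: for small \<open>\<bar>L\<bar>\<close> the
  kernel has bounded mass on the relevant interval, and for large \<open>\<bar>L\<bar>\<close> only
  \<open>\<bar>s\<bar> \<ge> \<bar>L\<bar> / 2 \<ge> 1\<close> occurs, where the exponent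
  \<open>p\<close> may be replaced by \<open>-1/2\<close>.\<close>

lemma powr_kernel_le:
  assumes p: "-1 < p" "p \<le> -1/2" and R: "R \<ge> 1"
  shows "ennreal (p + 1) * (\<integral>\<^sup>+s. ennreal (\<bar>s\<bar> powr p) * indicator {-R..R} (L + s) \<partial>lborel)
    \<le> ennreal (12 * R\<^sup>2 * max 1 \<bar>L\<bar> powr (-1/2))"
proof (cases "\<bar>L\<bar> \<le> 2 * R")
  case True
  have "(\<integral>\<^sup>+s. ennreal (\<bar>s\<bar> powr p) * indicator {-R..R} (L + s) \<partial>lborel)
      \<le> (\<integral>\<^sup>+s. ennreal (\<bar>s\<bar> powr p) * indicator {-(3 * R)..3 * R} s \<partial>lborel)"
    using True by (intro nn_integral_mono) (auto simp: indicator_def)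
  also have "\<dots> = ennreal (2 * (3 * R) powr (p + 1) / (p + 1))"
    using p R by (intro nn_integral_abs_powr) auto
  finally have "ennreal (p + 1) * (\<integral>\<^sup>+s. ennreal (\<bar>s\<bar> powr p) * indicator {-R..R} (L + s) \<partial>lborel)
      \<le> ennreal (p + 1) * \<dots>"
    by (rule mult_left_mono) simp
  also have "\<dots> = ennreal (2 * (3 * R) powr (p + 1))"
    using p by (simp add: ennreal_mult[symmetric])
  also have "2 * (3 * R) powr (p + 1) \<le> 12 * R\<^sup>2 * max 1 \<bar>L\<bar> powr (-1/2)"
  proof -
    have "(3 * R) powr (p + 1) \<le> (3 * R) powr 1"
      using p R by (intro powr_mono) auto
    then have 1: "2 * (3 * R) powr (p + 1) \<le> 6 * R" using R by simp
    \<comment> \<open>The constant \<open>12 * R\<^sup>2\<close> is chosen so that its product with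
      the lower bound \<open>1 / (2 * R)\<close> for the decay factor is the \<open>6 * R\<close>
      found before.\<close>
    have "(2 * R) powr (-1) \<le> (2 * R) powr (-1/2)"
      using R by (intro powr_mono) auto
    also have "\<dots> \<le> max 1 \<bar>L\<bar> powr (-1/2)"
      using True R by (intro powr_mono2') auto
    finally have "1 / (2 * R) \<le> max 1 \<bar>L\<bar> powr (-1/2)"
      using R by (simp add: powr_minus field_simps)
    then have "12 * R\<^sup>2 * (1 / (2 * R)) \<le> 12 * R\<^sup>2 * max 1 \<bar>L\<bar> powr (-1/2)"
      by (intro mult_left_mono) auto
    moreover have "12 * R\<^sup>2 * (1 / (2 * R)) = 6 * R" using R by (simp add: power2_eq_square)
    ultimately show ?thesis using 1 by linarith
  qed
  finally show ?thesis by (simp add: ennreal_leI)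
next
  case False
  have "ennreal (p + 1) * (\<integral>\<^sup>+s. ennreal (\<bar>s\<bar> powr p) * indicator {-R..R} (L + s) \<partial>lborel)
      \<le> 1 * (\<integral>\<^sup>+s. ennreal ((\<bar>L\<bar> / 2) powr (-1/2)) * indicator {-R..R} (s + L) \<partial>lborel)"
  proof (rule mult_mono, goal_cases)
    case 2
    show ?case
    proof (rule nn_integral_mono)
      fix s
      have "\<bar>s\<bar> powr p \<le> (\<bar>L\<bar> / 2) powr (-1/2)" if "L + s \<in> {-R..R}"
      proof -
        have s: "\<bar>s\<bar> \<ge> \<bar>L\<bar> / 2" "\<bar>L\<bar> / 2 \<ge> 1" using that False R by auto
        have "\<bar>s\<bar> powr p \<le> \<bar>s\<bar> powr (-1/2)" using s p by (intro powr_mono) auto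
        also have "\<dots> \<le> (\<bar>L\<bar> / 2) powr (-1/2)" using s by (intro powr_mono2') auto
        finally show ?thesis .
      qed
      then show "ennreal (\<bar>s\<bar> powr p) * indicator {-R..R} (L + s) \<le> ennreal ((\<bar>L\<bar> / 2) powr (-1/2)) * indicator {-R..R} (s + L)"
        by (auto simp: indicator_def add.commute intro: ennreal_leI)
    qed
  qed (use p in auto)
  also have "\<dots> = ennreal ((\<bar>L\<bar> / 2) powr (-1/2)) * ennreal (2 * R)"
    using R nn_integral_lborel_translate[of "indicator {-R..R}" L]
    by (simp add: nn_integral_cmult)
  also have "\<dots> = ennreal ((\<bar>L\<bar> / 2) powr (-1/2) * (2 * R))"
    using R by (simp add: ennreal_mult)
  also have "(\<bar>L\<bar> / 2) powr (-1/2) * (2 * R) \<le> 12 * R\<^sup>2 * max 1 \<bar>L\<bar> powr (-1/2)"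
  proof -
    have m: "max 1 \<bar>L\<bar> = \<bar>L\<bar>" using False R by auto
    have "(\<bar>L\<bar> / 2) powr (-1/2) = \<bar>L\<bar> powr (-1/2) * 2 powr (1/2)"
      by (simp add: powr_divide powr_minus field_simps)
    also have "\<dots> \<le> \<bar>L\<bar> powr (-1/2) * 2 powr 1"
      by (intro mult_left_mono powr_mono) auto
    finally have 1: "(\<bar>L\<bar> / 2) powr (-1/2) \<le> 2 * \<bar>L\<bar> powr (-1/2)" by simp
    have "R \<le> R\<^sup>2" using R by (simp add: power2_eq_square)
    then have "2 * (2 * R) \<le> 12 * R\<^sup>2" using R by linarith
    then have "2 * (2 * R) * \<bar>L\<bar> powr (-1/2) \<le> 12 * R\<^sup>2 * \<bar>L\<bar> powr (-1/2)"
      by (rule mult_right_mono) simp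
    moreover have "(\<bar>L\<bar> / 2) powr (-1/2) * (2 * R) \<le> 2 * \<bar>L\<bar> powr (-1/2) * (2 * R)"
      using 1 R by (intro mult_right_mono) auto
    ultimately show ?thesis unfolding m by (simp add: mult.commute mult.left_commute)
  qed
  finally show ?thesis by (simp add: ennreal_leI)
qed

text \<open>For a steep slope the factor \<open>\<bar>\<alpha>\<bar> powr (-1/2)\<close> can be
  taken out. The remaining \<open>\<bar>t + c\<bar> powr (-1/2)\<close> is at most 1 away from its
  singularity, giving the length \<open>2 * R\<close>, and has integral 4 over the unit
  neighbourhood of it.\<close>

lemma nn_integral_affine_powr_le:
  assumes R: "R \<ge> 1"
  shows "(\<integral>\<^sup>+t. indicator {-R..R} t * ennreal (max 1 \<bar>\<alpha> * t + \<beta>\<bar> powr (-1/2)) \<partial>lborel)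
    \<le> ennreal ((2 * R + 4) * max 1 \<bar>\<alpha>\<bar> powr (-1/2))"
proof (cases "\<bar>\<alpha>\<bar> \<le> 1")
  case True
  have "(\<integral>\<^sup>+t. indicator {-R..R} t * ennreal (max 1 \<bar>\<alpha> * t + \<beta>\<bar> powr (-1/2)) \<partial>lborel)
      \<le> (\<integral>\<^sup>+t. indicator {-R..R} t \<partial>lborel)"
  proof (rule nn_integral_mono)
    fix t
    have "max 1 \<bar>\<alpha> * t + \<beta>\<bar> powr (-1/2) \<le> 1 powr (-1/2)"
      by (intro powr_mono2') auto
    then show "indicator {-R..R} t * ennreal (max 1 \<bar>\<alpha> * t + \<beta>\<bar> powr (-1/2)) \<le> indicator {-R..R} t"
      by (auto simp: indicator_def)
  qed
  also have "\<dots> = ennreal (2 * R)" using R by simp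
  also have "\<dots> \<le> ennreal ((2 * R + 4) * max 1 \<bar>\<alpha>\<bar> powr (-1/2))"
    using True R by (intro ennreal_leI) (auto simp: max_def)
  finally show ?thesis .
next
  case False
  define c where "c = \<beta> / \<alpha>"
  have m: "max 1 \<bar>\<alpha>\<bar> = \<bar>\<alpha>\<bar>" using False by auto
  have "(\<integral>\<^sup>+t. indicator {-R..R} t * ennreal (max 1 \<bar>\<alpha> * t + \<beta>\<bar> powr (-1/2)) \<partial>lborel)
      \<le> (\<integral>\<^sup>+t. ennreal (\<bar>\<alpha>\<bar> powr (-1/2)) * (indicator {-R..R} t + ennreal (\<bar>t + c\<bar> powr (-1/2)) * indicator {-1..1} (t + c)) \<partial>lborel)"
  proof (rule nn_integral_mono_AE, use AE_lborel_singleton[of "-c"] in eventually_elim)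
    fix t assume t: "t \<noteq> - c"
    then have tc: "\<bar>t + c\<bar> > 0" by auto
    have at: "\<alpha> * t + \<beta> = \<alpha> * (t + c)" using False by (auto simp: c_def distrib_left)
    have "max 1 \<bar>\<alpha> * t + \<beta>\<bar> powr (-1/2) \<le> (\<bar>\<alpha>\<bar> * \<bar>t + c\<bar>) powr (-1/2)"
      using tc False by (intro powr_mono2') (auto simp: at abs_mult)
    also have "\<dots> = \<bar>\<alpha>\<bar> powr (-1/2) * \<bar>t + c\<bar> powr (-1/2)" by (simp add: powr_mult)
    finally have 1: "max 1 \<bar>\<alpha> * t + \<beta>\<bar> powr (-1/2) \<le> \<bar>\<alpha>\<bar> powr (-1/2) * \<bar>t + c\<bar> powr (-1/2)" .
    show "indicator {-R..R} t * ennreal (max 1 \<bar>\<alpha> * t + \<beta>\<bar> powr (-1/2))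
      \<le> ennreal (\<bar>\<alpha>\<bar> powr (-1/2)) * (indicator {-R..R} t + ennreal (\<bar>t + c\<bar> powr (-1/2)) * indicator {-1..1} (t + c))"
    proof (cases "\<bar>t + c\<bar> \<le> 1")
      case True
      then have "ennreal (max 1 \<bar>\<alpha> * t + \<beta>\<bar> powr (-1/2)) \<le> ennreal (\<bar>\<alpha>\<bar> powr (-1/2)) * (ennreal (\<bar>t + c\<bar> powr (-1/2)) * indicator {-1..1} (t + c))"
        using 1 by (auto simp: indicator_def ennreal_mult[symmetric] intro!: ennreal_leI)
      then show ?thesis by (auto simp: indicator_def distrib_left intro: add_increasing)
    next
      case False
      have "\<bar>t + c\<bar> powr (-1/2) \<le> 1 powr (-1/2)" using False by (intro powr_mono2') auto
      then have "\<bar>\<alpha>\<bar> powr (-1/2) * \<bar>t + c\<bar> powr (-1/2) \<le> \<bar>\<alpha>\<bar> powr (-1/2) * 1"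
        by (intro mult_left_mono) auto
      then show ?thesis using 1 by (auto simp: indicator_def distrib_left intro!: add_increasing2 ennreal_leI)
    qed
  qed
  also have "\<dots> = ennreal (\<bar>\<alpha>\<bar> powr (-1/2)) * (ennreal (2 * R) + ennreal 4)"
  proof -
    have "(\<integral>\<^sup>+t. ennreal (\<bar>t + c\<bar> powr (-1/2)) * indicator {-1..1} (t + c) \<partial>lborel)
        = (\<integral>\<^sup>+t. ennreal (\<bar>t\<bar> powr (-1/2)) * indicator {-1..1} t \<partial>lborel)"
      by (rule nn_integral_lborel_translate) simp
    also have "\<dots> = ennreal 4" by (subst nn_integral_abs_powr) auto
    finally show ?thesis using R by (simp add: nn_integral_cmult nn_integral_add)
  qed
  also have "\<dots> = ennreal ((2 * R + 4) * \<bar>\<alpha>\<bar> powr (-1/2))"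
  proof -
    have "ennreal (2 * R) + ennreal 4 = ennreal (2 * R + 4)" using R by (intro ennreal_plus[symmetric]) auto
    then show ?thesis using R by (simp only: ennreal_mult'[symmetric] powr_ge_zero mult.commute)
  qed
  finally show ?thesis by (simp only: m)
qed

text \<open>The preimage of an interval under a map of slope \<open>\<alpha>\<close> is shorter by
  the factor \<open>\<bar>\<alpha>\<bar>\<close>; this is the source of the decay of
  \<open>G\<close>.\<close>

lemma nn_integral_affine_indicator_le:
  assumes R: "R \<ge> 1"
  shows "(\<integral>\<^sup>+t. indicator {-R..R} t * indicator {-R..R} (\<alpha> * t + \<beta>) \<partial>lborel) \<le> ennreal (2 * R / max 1 \<bar>\<alpha>\<bar>)"
proof (cases "\<bar>\<alpha>\<bar> \<le> 1")
  case True
  have "(\<integral>\<^sup>+t. indicator {-R..R} t * indicator {-R..R} (\<alpha> * t + \<beta>) \<partial>lborel) \<le> (\<integral>\<^sup>+t. indicator {-R..R} t \<partial>lborel)"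
    by (intro nn_integral_mono) (auto simp: indicator_def)
  then show ?thesis using True R by (simp add: max_def)
next
  case False
  have "ennreal \<bar>\<alpha>\<bar> * (\<integral>\<^sup>+t. indicator {-R..R} (\<alpha> * t + \<beta>) \<partial>lborel) = (\<integral>\<^sup>+t. indicator {-R..R} t \<partial>lborel)"
    using nn_integral_real_affine[of "indicator {-R..R}" \<alpha> \<beta>] False by (simp add: add.commute)
  then have "ennreal \<bar>\<alpha>\<bar> * (\<integral>\<^sup>+t. indicator {-R..R} (\<alpha> * t + \<beta>) \<partial>lborel) = ennreal \<bar>\<alpha>\<bar> * ennreal (2 * R / \<bar>\<alpha>\<bar>)"
    using R False by (simp add: ennreal_mult[symmetric])
  then have "(\<integral>\<^sup>+t. indicator {-R..R} (\<alpha> * t + \<beta>) \<partial>lborel) = ennreal (2 * R / \<bar>\<alpha>\<bar>)"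
    using False by (subst (asm) ennreal_mult_cancel_left) auto
  moreover have "(\<integral>\<^sup>+t. indicator {-R..R} t * indicator {-R..R} (\<alpha> * t + \<beta>) \<partial>lborel) \<le> (\<integral>\<^sup>+t. indicator {-R..R} (\<alpha> * t + \<beta>) \<partial>lborel)"
    by (intro nn_integral_mono) (auto simp: indicator_def)
  ultimately show ?thesis using False by (simp add: max_def)
qed

lemma nn_integral_max_powr_finite:
  fixes q :: real
  assumes q: "q > 1"
  shows "(\<integral>\<^sup>+t. ennreal (max 1 \<bar>t\<bar> powr - q) \<partial>lborel) < \<infinity>"
proof -
  have eq: "(\<integral>\<^sup>+t. ennreal (max 1 \<bar>t\<bar> powr - q) \<partial>lborel)
      = 2 * (\<integral>\<^sup>+t. ennreal (max 1 t powr - q) * indicator {0..} t \<partial>lborel)"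
    by (rule nn_integral_even) measurable
  have "(\<integral>\<^sup>+t. ennreal (max 1 t powr - q) * indicator {0..} t \<partial>lborel)
      \<le> (\<integral>\<^sup>+t. indicator {0..1} t + ennreal (t powr - q) * indicator {1..} t \<partial>lborel)"
    by (intro nn_integral_mono) (auto simp: indicator_def max_def)
  also have "\<dots> = ennreal 1 + ennreal (- (1 powr (- q + 1)) / (- q + 1))"
  proof -
    have "(\<integral>\<^sup>+t. ennreal (t powr - q) * indicator {1..} t \<partial>lborel) = ennreal (- (1 powr (- q + 1)) / (- q + 1))"
      using q by (intro nn_integral_has_integral_lebesgue' has_integral_powr_to_inf) auto
    then show ?thesis by (subst nn_integral_add) auto
  qed
  finally have "(\<integral>\<^sup>+t. ennreal (max 1 t powr - q) * indicator {0..} t \<partial>lborel) < \<infinity>"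
    by (rule le_less_trans) simp
  then show ?thesis
    unfolding eq by (simp add: ennreal_mult_less_top)
qed

section \<open>Dominated convergence for the moments\<close>

lemma lin_vupd_other:
  assumes "j \<noteq> k"
  shows "lin k a (vupd y j t) = a $ j * t + lin k a (vupd y j 0)"
proof -
  have "lin k a (vupd y j t) = a $ j * t + (\<Sum>i\<in>UNIV-{k}-{j}. a $ i * y $ i)" for t
  proof -
    have "lin k a (vupd y j t) = a $ j * vupd y j t $ j + (\<Sum>i\<in>UNIV-{k}-{j}. a $ i * vupd y j t $ i)"
      unfolding lin_def using assms by (intro sum.remove) auto
    also have "(\<Sum>i\<in>UNIV-{k}-{j}. a $ i * vupd y j t $ i) = (\<Sum>i\<in>UNIV-{k}-{j}. a $ i * y $ i)"
      by (intro sum.cong) auto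
    finally show ?thesis by simp
  qed
  from this[of t] this[of 0] show ?thesis by simp
qed

text \<open>The common ground of both cases, with the support in the cube of half-width
  \<open>R\<close>. Continuity is left out because indicators lack it; continuity off a null set
  enters only when the limit is taken.\<close>

locale bounded_density =
  fixes g :: "real^'n \<Rightarrow> real" and k :: 'n and M R :: real
  assumes g_measurable [measurable]: "g \<in> borel_measurable borel"
    and g_nonneg: "0 \<le> g x"
    and g_le: "g x \<le> M"
    and R_ge: "1 \<le> R"
    and g_support: "g x \<noteq> 0 \<Longrightarrow> \<bar>x $ i\<bar> \<le> R"
    and dim_ge: "2 \<le> CARD('n)"
begin

definition graph_value :: "real^'n \<Rightarrow> real^'n \<Rightarrow> ennreal" where
  "graph_value a y = ennreal (g (vupd y k (lin k a y)))"

text \<open>The approximate identity applied vertically around the graph; where \<open>g\<close> is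
  continuous at the graph point it tends to \<open>2 * graph_value a y\<close>.\<close>

definition smeared_value :: "real \<Rightarrow> real^'n \<Rightarrow> real^'n \<Rightarrow> ennreal" where
  "smeared_value p a y = ennreal (p + 1) * (\<integral>\<^sup>+s. ennreal (\<bar>s\<bar> powr p * g (vupd y k (lin k a y + s))) \<partial>lborel)"

text \<open>The transversal weight in coordinate \<open>k\<close> times the indicator of the
  projection of the cube containing the support.\<close>

definition box_weight :: "real^'n \<Rightarrow> ennreal" where
  "box_weight y = (\<Prod>i\<in>UNIV. if i = k then unit_weight (y $ i) else indicator {-R..R} (y $ i))"

text \<open>Up to a constant, this dominates the weighted smeared value for all \<open>p\<close> in
  \<open>{-1<..-1/2}\<close> at once.\<close>

definition row_bound :: "real^'n \<Rightarrow> real^'n \<Rightarrow> ennreal" where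
  "row_bound a y = box_weight y * ennreal (max 1 \<bar>lin k a y\<bar> powr (-1/2))"

lemma M_nonneg: "0 \<le> M"
  using g_nonneg[of 0] g_le[of 0] by linarith

lemma borel_measurable_graph_value [measurable (raw)]:
  assumes [measurable]: "f \<in> borel_measurable L" "h \<in> borel_measurable L"
  shows "(\<lambda>x. graph_value (f x) (h x)) \<in> borel_measurable L"
  unfolding graph_value_def by measurable

lemma borel_measurable_smeared_value [measurable (raw)]:
  assumes [measurable]: "f \<in> borel_measurable L" "h \<in> borel_measurable L"
  shows "(\<lambda>x. smeared_value p (f x) (h x)) \<in> borel_measurable L"
  unfolding smeared_value_def by measurable

lemma borel_measurable_box_weight [measurable (raw)]:
  assumes [measurable]: "f \<in> borel_measurable L"
  shows "(\<lambda>x. box_weight (f x)) \<in> borel_measurable L"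
  unfolding box_weight_def by measurable

lemma borel_measurable_row_bound [measurable (raw)]:
  assumes [measurable]: "f \<in> borel_measurable L" "h \<in> borel_measurable L"
  shows "(\<lambda>x. row_bound (f x) (h x)) \<in> borel_measurable L"
  unfolding row_bound_def by measurable

lemma box_weight_remove: "box_weight y = unit_weight (y $ k) * (\<Prod>i\<in>UNIV-{k}. indicator {-R..R} (y $ i))"
proof -
  have "box_weight y = (if k = k then unit_weight (y $ k) else indicator {-R..R} (y $ k)) *
      (\<Prod>i\<in>UNIV-{k}. if i = k then unit_weight (y $ i) else indicator {-R..R} (y $ i))"
    unfolding box_weight_def by (rule prod.remove) auto
  also have "(\<Prod>i\<in>UNIV-{k}. if i = k then unit_weight (y $ i) else indicator {-R..R} (y $ i))
      = (\<Prod>i\<in>UNIV-{k}. indicator {-R..R} (y $ i) :: ennreal)"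
    by (intro prod.cong) auto
  finally show ?thesis by simp
qed

lemma box_weight_eq:
  assumes "\<And>i. i \<noteq> k \<Longrightarrow> \<bar>y $ i\<bar> \<le> R"
  shows "box_weight y = unit_weight (y $ k)"
proof -
  have "(\<Prod>i\<in>UNIV-{k}. indicator {-R..R} (y $ i)) = (\<Prod>i\<in>UNIV-{k}. 1 :: ennreal)"
    using assms by (intro prod.cong) (auto simp: abs_le_iff minus_le_iff)
  then show ?thesis by (simp add: box_weight_remove)
qed

lemma box_weight_nonzeroD:
  assumes "box_weight y \<noteq> 0" "i \<noteq> k"
  shows "\<bar>y $ i\<bar> \<le> R"
proof -
  have "(indicator {-R..R} (y $ i) :: ennreal) \<noteq> 0"
    using assms by (simp add: box_weight_remove)
  then show ?thesis by (auto simp: indicator_def split: if_splits)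
qed

lemma graph_value_nonzeroD:
  assumes "graph_value a y \<noteq> 0"
  shows "i \<noteq> k \<Longrightarrow> \<bar>y $ i\<bar> \<le> R" "\<bar>lin k a y\<bar> \<le> R"
proof -
  have nz: "g (vupd y k (lin k a y)) \<noteq> 0" using assms by (auto simp: graph_value_def)
  show "\<bar>y $ i\<bar> \<le> R" if "i \<noteq> k" using g_support[OF nz, of i] that by simp
  show "\<bar>lin k a y\<bar> \<le> R" using g_support[OF nz, of k] by simp
qed

lemma weighted_graph_value_le:
  "unit_weight (y $ k) * graph_value a y \<le> ennreal M * (box_weight y * indicator {-R..R} (lin k a y))"
proof (cases "graph_value a y = 0")
  case False
  note nz = graph_value_nonzeroD[OF False]
  have "graph_value a y \<le> ennreal M" by (simp add: graph_value_def ennreal_leI g_le)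
  then have "unit_weight (y $ k) * graph_value a y \<le> unit_weight (y $ k) * ennreal M"
    by (rule mult_left_mono) simp
  moreover have "lin k a y \<in> {-R..R}" using nz(2) by auto
  ultimately show ?thesis by (simp add: box_weight_eq[OF nz(1)] mult.commute)
qed simp

lemma weighted_smeared_value_le:
  assumes p: "-1 < p" "p \<le> -1/2"
  shows "unit_weight (y $ k) * smeared_value p a y \<le> ennreal (M * (12 * R\<^sup>2)) * row_bound a y"
proof (cases "\<forall>i. i \<noteq> k \<longrightarrow> \<bar>y $ i\<bar> \<le> R")
  case False
  then obtain i where i: "i \<noteq> k" "\<not> \<bar>y $ i\<bar> \<le> R" by blast
  have "g (vupd y k t) = 0" for t
    using g_support[of "vupd y k t" i] i by auto
  then show ?thesis by (simp add: smeared_value_def)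
next
  case True
  let ?L = "lin k a y"
  have "(\<integral>\<^sup>+s. ennreal (\<bar>s\<bar> powr p * g (vupd y k (?L + s))) \<partial>lborel)
      \<le> (\<integral>\<^sup>+s. ennreal M * (ennreal (\<bar>s\<bar> powr p) * indicator {-R..R} (?L + s)) \<partial>lborel)"
  proof (rule nn_integral_mono)
    fix s
    show "ennreal (\<bar>s\<bar> powr p * g (vupd y k (?L + s))) \<le> ennreal M * (ennreal (\<bar>s\<bar> powr p) * indicator {-R..R} (?L + s))"
    proof (cases "g (vupd y k (?L + s)) = 0")
      case False
      then have "?L + s \<in> {-R..R}" using g_support[OF False, of k] by auto
      moreover have "\<bar>s\<bar> powr p * g (vupd y k (?L + s)) \<le> M * \<bar>s\<bar> powr p"
        using g_le by (subst mult.commute) (intro mult_right_mono, auto)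
      ultimately show ?thesis
        by (simp add: ennreal_leI ennreal_mult'[symmetric] M_nonneg)
    qed simp
  qed
  then have "smeared_value p a y \<le> ennreal (p + 1) * (\<integral>\<^sup>+s. ennreal M * (ennreal (\<bar>s\<bar> powr p) * indicator {-R..R} (?L + s)) \<partial>lborel)"
    unfolding smeared_value_def by (rule mult_left_mono) simp
  also have "\<dots> = ennreal M * (ennreal (p + 1) * (\<integral>\<^sup>+s. ennreal (\<bar>s\<bar> powr p) * indicator {-R..R} (?L + s) \<partial>lborel))"
    by (subst nn_integral_cmult) (simp_all add: mult.left_commute)
  also have "\<dots> \<le> ennreal M * ennreal (12 * R\<^sup>2 * max 1 \<bar>?L\<bar> powr (-1/2))"
    by (intro mult_left_mono powr_kernel_le p R_ge) simp
  also have "\<dots> = ennreal (M * (12 * R\<^sup>2)) * ennreal (max 1 \<bar>?L\<bar> powr (-1/2))"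
    by (simp add: ennreal_mult'[symmetric] M_nonneg mult.assoc)
  finally have "unit_weight (y $ k) * smeared_value p a y
      \<le> unit_weight (y $ k) * (ennreal (M * (12 * R\<^sup>2)) * ennreal (max 1 \<bar>?L\<bar> powr (-1/2)))"
    by (rule mult_left_mono) simp
  then show ?thesis
    using True by (simp add: row_bound_def box_weight_eq mult.left_commute)
qed

text \<open>Integrating first over coordinate \<open>j\<close>, on which the height depends affinely
  with slope \<open>a $ j\<close>, yields all the decay; the other coordinates contribute at most
  the size of the box. Leaving \<open>j\<close> free allows the steepest slope to be used
  later.\<close>

lemma nn_integral_box_weight_lin_le:
  assumes [measurable]: "\<psi> \<in> borel_measurable borel" and j: "j \<noteq> k"
    and E: "\<And>\<beta>. (\<integral>\<^sup>+t. indicator {-R..R} t * \<psi> (a $ j * t + \<beta>) \<partial>lborel) \<le> E"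
  shows "(\<integral>\<^sup>+y. box_weight y * \<psi> (lin k a y) \<partial>lborel) \<le> E * ennreal ((2 * R) ^ CARD('n))"
proof -
  \<comment> \<open>Slicing along \<open>j\<close> consumes the indicator in that coordinate and
    leaves a unit weight behind.\<close>
  define w where "w i = (if i = k \<or> i = j then unit_weight else indicator {-R..R} :: real \<Rightarrow> ennreal)" for i
  have [measurable]: "w i \<in> borel_measurable borel" for i by (simp add: w_def)
  define P where "P y = (\<Prod>i\<in>UNIV-{j}. w i (y $ i))" for y :: "real^'n"
  define rest where "rest y = lin k a (vupd y j 0)" for y
  have box: "box_weight (vupd y j t) = indicator {-R..R} t * P y" for y t
  proof -
    have "box_weight (vupd y j t) = (if j = k then unit_weight (vupd y j t $ j) else indicator {-R..R} (vupd y j t $ j)) *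
       (\<Prod>i\<in>UNIV-{j}. if i = k then unit_weight (vupd y j t $ i) else indicator {-R..R} (vupd y j t $ i))"
      unfolding box_weight_def by (rule prod.remove) auto
    also have "(\<Prod>i\<in>UNIV-{j}. if i = k then unit_weight (vupd y j t $ i) else indicator {-R..R} (vupd y j t $ i)) = P y"
      unfolding P_def by (intro prod.cong) (auto simp: w_def)
    finally show ?thesis using j by simp
  qed
  have lin: "lin k a (vupd y j t) = a $ j * t + rest y" for y t
    unfolding rest_def using j by (rule lin_vupd_other)
  have "(\<integral>\<^sup>+y. box_weight y * \<psi> (lin k a y) \<partial>lborel)
      = (\<integral>\<^sup>+y. unit_weight (y $ j) * (\<integral>\<^sup>+t. P y * (indicator {-R..R} t * \<psi> (a $ j * t + rest y)) \<partial>lborel) \<partial>lborel)"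
    by (subst nn_integral_slice_coordinate[of _ j]) (simp_all add: box lin mult.assoc mult.left_commute)
  also have "\<dots> \<le> (\<integral>\<^sup>+y. E * (\<Prod>i\<in>UNIV. w i (y $ i)) \<partial>lborel)"
  proof (rule nn_integral_mono)
    fix y :: "real^'n"
    have "(\<integral>\<^sup>+t. P y * (indicator {-R..R} t * \<psi> (a $ j * t + rest y)) \<partial>lborel) \<le> P y * E"
      using E[of "rest y"] by (subst nn_integral_cmult) (auto intro: mult_left_mono)
    then have "unit_weight (y $ j) * (\<integral>\<^sup>+t. P y * (indicator {-R..R} t * \<psi> (a $ j * t + rest y)) \<partial>lborel)
        \<le> unit_weight (y $ j) * (P y * E)"
      by (rule mult_left_mono) simp
    also have "\<dots> = E * (w j (y $ j) * P y)" by (simp add: w_def ac_simps)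
    also have "w j (y $ j) * P y = (\<Prod>i\<in>UNIV. w i (y $ i))"
      unfolding P_def by (rule prod.remove[symmetric]) auto
    finally show "unit_weight (y $ j) * (\<integral>\<^sup>+t. P y * (indicator {-R..R} t * \<psi> (a $ j * t + rest y)) \<partial>lborel)
        \<le> E * (\<Prod>i\<in>UNIV. w i (y $ i))" .
  qed
  also have "\<dots> = E * (\<Prod>i\<in>UNIV. \<integral>\<^sup>+t. w i t \<partial>lborel)"
    by (simp add: nn_integral_cmult nn_integral_lborel_vec_prod)
  \<comment> \<open>The unit weights have mass 1, which is below \<open>2 * R\<close>; so one bound
    serves for every factor.\<close>
  also have "(\<Prod>i\<in>UNIV. \<integral>\<^sup>+t. w i t \<partial>lborel) \<le> (\<Prod>i\<in>(UNIV::'n set). ennreal (2 * R))"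
  proof (rule prod_mono_ennreal)
    fix i :: 'n
    show "(\<integral>\<^sup>+t. w i t \<partial>lborel) \<le> ennreal (2 * R)"
      using R_ge by (auto simp: w_def)
  qed
  also have "\<dots> = ennreal ((2 * R) ^ CARD('n))"
    using R_ge by (simp add: ennreal_power)
  finally show ?thesis by (simp add: mult_left_mono)
qed

section \<open>Decay of the graph integrals in the slopes\<close>

abbreviation G :: "real^'n \<Rightarrow> ennreal" where
  "G \<equiv> graph_integral k (\<lambda>x. ennreal (g x))"

lemma G_eq: "G a = (\<integral>\<^sup>+y. unit_weight (y $ k) * graph_value a y \<partial>lborel)"
  by (simp add: graph_integral_def graph_value_def)

text \<open>The sum of the constants arising for \<open>G\<close> and for \<open>row_bound\<close>,
  so that one constant serves both.\<close>

definition decay_const :: real where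
  "decay_const = (2 * R * M + (2 * R + 4)) * (2 * R) ^ CARD('n)"

lemma decay_const_ge: "0 \<le> decay_const"
  using M_nonneg R_ge by (simp add: decay_const_def)

lemma G_le:
  assumes j: "j \<noteq> k"
  shows "G a \<le> ennreal (decay_const * max 1 \<bar>a $ j\<bar> powr (-1))"
proof -
  let ?m = "max 1 \<bar>a $ j\<bar>"
  have m: "?m powr (-1) = 1 / ?m" by (simp add: powr_minus_divide)
  have "G a \<le> (\<integral>\<^sup>+y. ennreal M * (box_weight y * indicator {-R..R} (lin k a y)) \<partial>lborel)"
    unfolding G_eq by (rule nn_integral_mono) (rule weighted_graph_value_le)
  also have "\<dots> = ennreal M * (\<integral>\<^sup>+y. box_weight y * indicator {-R..R} (lin k a y) \<partial>lborel)"
    by (rule nn_integral_cmult) measurable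
  also have "\<dots> \<le> ennreal M * (ennreal (2 * R / ?m) * ennreal ((2 * R) ^ CARD('n)))"
    by (intro mult_left_mono nn_integral_box_weight_lin_le[OF _ j] nn_integral_affine_indicator_le R_ge) auto
  also have "\<dots> = ennreal (2 * R * M * (2 * R) ^ CARD('n) * ?m powr (-1))"
    using M_nonneg R_ge by (simp add: ennreal_mult'[symmetric] m ac_simps)
  also have "\<dots> \<le> ennreal (decay_const * ?m powr (-1))"
    using M_nonneg R_ge unfolding decay_const_def by (intro ennreal_leI mult_right_mono) auto
  finally show ?thesis .
qed

lemma nn_integral_row_bound_le:
  assumes j: "j \<noteq> k"
  shows "(\<integral>\<^sup>+y. row_bound a y \<partial>lborel) \<le> ennreal (decay_const * max 1 \<bar>a $ j\<bar> powr (-1/2))"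
proof -
  let ?m = "max 1 \<bar>a $ j\<bar>"
  have "(\<integral>\<^sup>+y. row_bound a y \<partial>lborel) \<le> ennreal ((2 * R + 4) * ?m powr (-1/2)) * ennreal ((2 * R) ^ CARD('n))"
    unfolding row_bound_def
    by (rule nn_integral_box_weight_lin_le[of "\<lambda>x. ennreal (max 1 \<bar>x\<bar> powr (-1/2))",
          OF _ j nn_integral_affine_powr_le[OF R_ge]]) measurable
  also have "\<dots> = ennreal ((2 * R + 4) * (2 * R) ^ CARD('n) * ?m powr (-1/2))"
    using R_ge by (simp add: ennreal_mult'[symmetric] ac_simps)
  also have "\<dots> \<le> ennreal (decay_const * ?m powr (-1/2))"
    using M_nonneg R_ge unfolding decay_const_def by (intro ennreal_leI mult_right_mono) auto
  finally show ?thesis .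
qed

lemma ex_other_index: "\<exists>j. j \<noteq> k"
proof (rule ccontr)
  assume "\<nexists>j. j \<noteq> k"
  then have "(UNIV :: 'n set) = {k}" by auto
  then have "CARD('n) = 1" by (metis card.empty card.insert empty_iff finite.emptyI One_nat_def)
  then show False using dim_ge by simp
qed

lemma G_finite: "G a < \<infinity>"
proof -
  obtain j where "j \<noteq> k" using ex_other_index by blast
  from G_le[OF this, of a] show ?thesis by (rule le_less_trans) simp
qed

text \<open>In the largest slope the \<open>n - 1\<close> factors \<open>G\<close> and one row bound
  decay with total exponent \<open>(n - 1) + 1/2\<close>. This is that exponent shared evenly among
  \<open>n - 1\<close> slopes; the extra half makes it exceed 1.\<close>

definition decay_exp :: real where
  "decay_exp = 1 + 1 / (2 * (real CARD('n) - 1))"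

text \<open>All decay is first taken in the steepest slope. As the other slopes are no larger, each
  of the \<open>n - 1\<close> equal factors can be traded for the factor of another slope, which
  gives a product separated in the coordinates.\<close>

lemma G_power_row_bound_le:
  "G a ^ (CARD('n) - 1) * (\<integral>\<^sup>+y. row_bound a y \<partial>lborel)
    \<le> ennreal (decay_const ^ CARD('n)) * (\<Prod>j\<in>UNIV-{k}. ennreal (max 1 \<bar>a $ j\<bar> powr - decay_exp))"
proof -
  let ?n = "CARD('n)" and ?A = "UNIV - {k} :: 'n set" and ?m = "\<lambda>j. max 1 \<bar>a $ j\<bar>"
  have A: "finite ?A" "?A \<noteq> {}" using ex_other_index by auto
  obtain j where j: "j \<in> ?A" "\<And>i. i \<in> ?A \<Longrightarrow> ?m i \<le> ?m j"
  proof -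
    have "Max (?m ` ?A) \<in> ?m ` ?A" using A by (intro Max_in) auto
    then obtain j where "j \<in> ?A" "Max (?m ` ?A) = ?m j" by auto
    moreover from this have "?m i \<le> ?m j" if "i \<in> ?A" for i
      using that A by (metis Max_ge finite_imageI imageI)
    ultimately show ?thesis using that by blast
  qed
  have jk: "j \<noteq> k" using j(1) by auto
  have e: "decay_exp * real (?n - 1) = real (?n - 1) + 1/2"
    using dim_ge by (simp add: decay_exp_def field_simps)
  have e0: "decay_exp > 0" using dim_ge by (simp add: decay_exp_def add_pos_nonneg)
  have "G a ^ (?n - 1) * (\<integral>\<^sup>+y. row_bound a y \<partial>lborel)
      \<le> ennreal (decay_const * ?m j powr (-1)) ^ (?n - 1) * ennreal (decay_const * ?m j powr (-1/2))"
    by (intro mult_mono power_mono G_le nn_integral_row_bound_le jk) auto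
  also have "\<dots> = ennreal ((decay_const * ?m j powr (-1)) ^ (?n - 1) * (decay_const * ?m j powr (-1/2)))"
    using decay_const_ge by (simp add: ennreal_power ennreal_mult'[symmetric])
  also have "(decay_const * ?m j powr (-1)) ^ (?n - 1) * (decay_const * ?m j powr (-1/2))
      = decay_const ^ ?n * (?m j powr - decay_exp) ^ (?n - 1)"
  proof -
    have m: "(?m j powr (-1)) ^ (?n - 1) * ?m j powr (-1/2) = (?m j powr - decay_exp) ^ (?n - 1)"
    proof -
      have "(?m j powr (-1)) ^ (?n - 1) = ?m j powr (- real (?n - 1))"
        by (subst powr_power) auto
      moreover have "(?m j powr - decay_exp) ^ (?n - 1) = ?m j powr (- (decay_exp * real (?n - 1)))"
        by (subst powr_power) (auto simp: mult.commute)
      ultimately show ?thesis by (simp only: e powr_add[symmetric]) simp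
    qed
    have d: "decay_const ^ (?n - 1) * decay_const = decay_const ^ ?n"
      using dim_ge by (metis power_minus_mult not_numeral_le_zero neq0_conv)
    have "(decay_const * ?m j powr (-1)) ^ (?n - 1) * (decay_const * ?m j powr (-1/2))
        = (decay_const ^ (?n - 1) * decay_const) * ((?m j powr (-1)) ^ (?n - 1) * ?m j powr (-1/2))"
      by (simp only: power_mult_distrib mult.assoc mult.commute mult.left_commute)
    then show ?thesis by (simp only: m d)
  qed
  also have "\<dots> \<le> decay_const ^ ?n * (\<Prod>i\<in>?A. ?m i powr - decay_exp)"
  proof (intro mult_left_mono)
    have "(?m j powr - decay_exp) ^ (?n - 1) = (\<Prod>i\<in>?A. ?m j powr - decay_exp)"
      by (simp add: card_Diff_singleton)
    also have "\<dots> \<le> (\<Prod>i\<in>?A. ?m i powr - decay_exp)"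
      using j(2) e0 by (intro prod_mono conjI powr_mono2') auto
    finally show "(?m j powr - decay_exp) ^ (?n - 1) \<le> (\<Prod>i\<in>?A. ?m i powr - decay_exp)" .
  qed (simp add: decay_const_ge)
  also have "ennreal (decay_const ^ ?n * (\<Prod>i\<in>?A. ?m i powr - decay_exp))
      = ennreal (decay_const ^ ?n) * (\<Prod>i\<in>?A. ennreal (?m i powr - decay_exp))"
    using decay_const_ge by (simp add: ennreal_mult' prod_ennreal prod_nonneg)
  finally show ?thesis by (simp add: ennreal_leI)
qed

text \<open>The separated bound factorises over the coordinates of \<open>a\<close>, and each factor
  is integrable because \<open>decay_exp > 1\<close>.\<close>

lemma nn_integral_G_power_row_bound_finite:
  "(\<integral>\<^sup>+a. unit_weight (a $ k) * (G a ^ (CARD('n) - 1) * (\<integral>\<^sup>+y. row_bound a y \<partial>lborel)) \<partial>lborel) < \<infinity>"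
proof -
  define w where "w j = (if j = k then unit_weight else (\<lambda>t. ennreal (max 1 \<bar>t\<bar> powr - decay_exp)))" for j
  have [measurable]: "w j \<in> borel_measurable borel" for j by (simp add: w_def)
  have e1: "decay_exp > 1" using dim_ge by (simp add: decay_exp_def)
  have "(\<integral>\<^sup>+a. unit_weight (a $ k) * (G a ^ (CARD('n) - 1) * (\<integral>\<^sup>+y. row_bound a y \<partial>lborel)) \<partial>lborel)
      \<le> (\<integral>\<^sup>+a. ennreal (decay_const ^ CARD('n)) * (\<Prod>j\<in>UNIV. w j (a $ j)) \<partial>lborel)"
  proof (rule nn_integral_mono)
    fix a :: "real^'n"
    have "unit_weight (a $ k) * (G a ^ (CARD('n) - 1) * (\<integral>\<^sup>+y. row_bound a y \<partial>lborel))
        \<le> unit_weight (a $ k) * (ennreal (decay_const ^ CARD('n)) * (\<Prod>j\<in>UNIV-{k}. ennreal (max 1 \<bar>a $ j\<bar> powr - decay_exp)))"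
      by (intro mult_left_mono G_power_row_bound_le) simp
    also have "\<dots> = ennreal (decay_const ^ CARD('n)) * (w k (a $ k) * (\<Prod>j\<in>UNIV-{k}. w j (a $ j)))"
      by (simp add: w_def mult.left_commute cong: prod.cong_simp)
    also have "w k (a $ k) * (\<Prod>j\<in>UNIV-{k}. w j (a $ j)) = (\<Prod>j\<in>UNIV. w j (a $ j))"
      by (rule prod.remove[symmetric]) auto
    finally show "unit_weight (a $ k) * (G a ^ (CARD('n) - 1) * (\<integral>\<^sup>+y. row_bound a y \<partial>lborel))
        \<le> ennreal (decay_const ^ CARD('n)) * (\<Prod>j\<in>UNIV. w j (a $ j))" .
  qed
  also have "\<dots> = ennreal (decay_const ^ CARD('n)) * (\<Prod>j\<in>UNIV. \<integral>\<^sup>+t. w j t \<partial>lborel)"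
    by (simp add: nn_integral_cmult nn_integral_lborel_vec_prod)
  also have "\<dots> < \<infinity>"
  proof -
    have "(\<integral>\<^sup>+t. w j t \<partial>lborel) < \<top>" for j
      using nn_integral_max_powr_finite[OF e1] by (simp add: w_def)
    then have "(\<Prod>j\<in>A. \<integral>\<^sup>+t. w j t \<partial>lborel) < \<top>" for A
      by (induction A rule: infinite_finite_induct) (auto simp: ennreal_mult_less_top)
    then show ?thesis by (simp add: ennreal_mult_less_top)
  qed
  finally show ?thesis .
qed

end

section \<open>Null sets along graphs and a bound for determinants\<close>

lemma lin_commute: "lin k a y = lin k y a"
  by (simp add: lin_def mult.commute)

lemma AE_lborel_nth_nonzero: "AE y in lborel. (y::real^'n) $ j \<noteq> 0"
proof -
  have "emeasure lborel {y::real^'n. y $ j = 0} = (\<integral>\<^sup>+y. indicator {y. y $ j = 0} (y::real^'n) \<partial>lborel)"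
    by (subst nn_integral_indicator) auto
  also have "\<dots> = (\<integral>\<^sup>+y. unit_weight (y $ j) * (\<integral>\<^sup>+t. indicator {y. y $ j = 0} (vupd y j t) \<partial>lborel) \<partial>(lborel :: (real^'n) measure))"
    by (rule nn_integral_slice_coordinate) measurable
  also have "\<dots> = (\<integral>\<^sup>+y. unit_weight (y $ j) * 0 \<partial>(lborel :: (real^'n) measure))"
  proof (rule nn_integral_cong)
    fix y :: "real^'n"
    have "(\<integral>\<^sup>+t. indicator {y. y $ j = 0} (vupd y j t) \<partial>lborel) = (\<integral>\<^sup>+t. indicator {0::real} t \<partial>lborel :: ennreal)"
      by (intro nn_integral_cong) (auto simp: indicator_def)
    then show "unit_weight (y $ j) * (\<integral>\<^sup>+t. indicator {y. y $ j = 0} (vupd y j t) \<partial>lborel) = unit_weight (y $ j) * 0"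
      by simp
  qed
  finally have "{y::real^'n. y $ j = 0} \<in> null_sets lborel" by (auto simp: null_sets_def)
  then show ?thesis by (auto dest: AE_not_in)
qed

text \<open>For almost every \<open>y\<close> the vertical fibre of \<open>N\<close> over
  \<open>y\<close> is null and \<open>y $ j\<close> is nonzero. Then the height
  \<open>lin k a y\<close> moves affinely with slope \<open>y $ j\<close> in the variable
  \<open>a $ j\<close>, so it lies in that fibre only for a null set of slopes.\<close>

lemma nn_integral_graph_null:
  fixes N :: "(real^'n) set" and k :: 'n
  assumes N: "N \<in> null_sets lborel" and j: "j \<noteq> k"
  shows "(\<integral>\<^sup>+Y. \<integral>\<^sup>+a. unit_weight (Y $ k $ k) * indicator N (vupd (Y $ k) k (lin k a (Y $ k))) \<partial>lborel \<partial>(lborel :: (real^'n^'n) measure)) = 0"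
proof -
  have [measurable]: "N \<in> sets borel" using N by auto
  define F where "F y = unit_weight (y $ k) * (\<integral>\<^sup>+a. indicator N (vupd y k (lin k a y)) \<partial>lborel)" for y
  have [measurable]: "F \<in> borel_measurable borel" unfolding F_def by measurable
  have "0 = emeasure lborel N" using N by auto
  also have "\<dots> = (\<integral>\<^sup>+y. indicator N y \<partial>lborel)" by simp
  also have "\<dots> = (\<integral>\<^sup>+y. unit_weight (y $ k) * (\<integral>\<^sup>+t. indicator N (vupd y k t) \<partial>lborel) \<partial>lborel)"
    by (rule nn_integral_slice_coordinate) simp
  finally have "(\<integral>\<^sup>+y. unit_weight (y $ k) * (\<integral>\<^sup>+t. indicator N (vupd y k t) \<partial>lborel) \<partial>lborel) = 0" ..
  then have "AE y in lborel. unit_weight (y $ k) * (\<integral>\<^sup>+t. indicator N (vupd y k t) \<partial>lborel) = 0"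
    by (subst (asm) nn_integral_0_iff_AE) auto
  then have "AE y in lborel. F y = 0"
    using AE_lborel_nth_nonzero[of j]
  proof eventually_elim
    case (elim y)
    show "F y = 0"
    proof (cases "unit_weight (y $ k) = 0")
      case False
      then have 0: "(\<integral>\<^sup>+t. indicator N (vupd y k t) \<partial>lborel) = (0::ennreal)" using elim by auto
      have inner: "(\<integral>\<^sup>+t. indicator N (vupd y k (\<beta> + y $ j * t)) \<partial>lborel) = (0::ennreal)" for \<beta>
      proof -
        have "ennreal \<bar>y $ j\<bar> * (\<integral>\<^sup>+t. indicator N (vupd y k (\<beta> + y $ j * t)) \<partial>lborel) = 0"
          using nn_integral_real_affine[of "\<lambda>t. indicator N (vupd y k t)" "y $ j" \<beta>] elim 0 by simp
        then show ?thesis using elim by auto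
      qed
      have lin: "lin k (vupd a j t) y = lin k (vupd a j 0) y + y $ j * t" for a t
        using lin_vupd_other[OF j, of y a t] by (simp add: lin_commute[of k _ y])
      have "(\<integral>\<^sup>+a. indicator N (vupd y k (lin k a y)) \<partial>lborel)
          = (\<integral>\<^sup>+a. unit_weight (a $ j) * (\<integral>\<^sup>+t. indicator N (vupd y k (lin k (vupd a j t) y)) \<partial>lborel) \<partial>lborel)"
        by (rule nn_integral_slice_coordinate) measurable
      also have "\<dots> = 0" by (subst lin, subst inner) simp
      finally show ?thesis by (simp add: F_def)
    qed (simp add: F_def)
  qed
  then have F0: "(\<integral>\<^sup>+y. F y \<partial>lborel) = 0"
    by (subst nn_integral_0_iff_AE) auto
  have "(\<integral>\<^sup>+Y. \<integral>\<^sup>+a. unit_weight (Y $ k $ k) * indicator N (vupd (Y $ k) k (lin k a (Y $ k))) \<partial>lborel \<partial>(lborel :: (real^'n^'n) measure))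
      = (\<integral>\<^sup>+Y. F (Y $ k) \<partial>(lborel :: (real^'n^'n) measure))"
    unfolding F_def by (intro nn_integral_cong) (simp add: nn_integral_cmult)
  \<comment> \<open>The other rows carry no weight and integrate to infinity; in
    \<open>ennreal\<close> the zero factor from row \<open>k\<close> still makes the product
    0.\<close>
  also have "\<dots> = (\<integral>\<^sup>+Y. (\<Prod>i\<in>UNIV. (if i = k then F (Y $ i) else 1)) \<partial>(lborel :: (real^'n^'n) measure))"
    by simp
  also have "\<dots> = (\<Prod>i\<in>(UNIV::'n set). \<integral>\<^sup>+y. (if i = k then F y else 1) \<partial>lborel)"
    by (rule nn_integral_lborel_vec_prod[of "\<lambda>i y. if i = k then F y else 1"]) auto
  also have "\<dots> = 0"
    using F0 by (intro prod_zero bexI[of _ k]) auto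
  finally show ?thesis .
qed

text \<open>Only a bound independent of \<open>p\<close> for the power of the minor is wanted, so
  counting the terms of the Leibniz formula is enough.\<close>

lemma abs_det_le:
  fixes A :: "real^'n^'n"
  assumes "\<And>i j. \<bar>A $ i $ j\<bar> \<le> R"
  shows "\<bar>det A\<bar> \<le> fact CARD('n) * R ^ CARD('n)"
proof -
  have "\<bar>det A\<bar> \<le> (\<Sum>\<pi>\<in>{\<pi>. \<pi> permutes (UNIV::'n set)}. \<bar>of_int (sign \<pi>) * (\<Prod>i\<in>UNIV. A $ i $ \<pi> i)\<bar>)"
    unfolding det_def by (rule sum_abs)
  also have "\<dots> \<le> (\<Sum>\<pi>\<in>{\<pi>. \<pi> permutes (UNIV::'n set)}. R ^ CARD('n))"
  proof (rule sum_mono)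
    fix \<pi> :: "'n \<Rightarrow> 'n"
    have "\<bar>of_int (sign \<pi>) * (\<Prod>i\<in>UNIV. A $ i $ \<pi> i)\<bar> = (\<Prod>i\<in>UNIV. \<bar>A $ i $ \<pi> i\<bar>)"
      by (simp add: abs_mult abs_prod sign_def)
    also have "\<dots> \<le> (\<Prod>i\<in>(UNIV::'n set). R)"
      using assms by (intro prod_mono) auto
    finally show "\<bar>of_int (sign \<pi>) * (\<Prod>i\<in>UNIV. A $ i $ \<pi> i)\<bar> \<le> R ^ CARD('n)" by simp
  qed
  also have "\<dots> = fact CARD('n) * R ^ CARD('n)"
    by (simp add: card_permutations[OF refl])
  finally show ?thesis .
qed

section \<open>Domination, pointwise limit and convergence of the moments\<close>

context bounded_density
begin

definition rows_product :: "real^'n^'n \<Rightarrow> real^'n \<Rightarrow> ennreal" where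
  "rows_product Y a = (\<Prod>i\<in>UNIV-{k}. unit_weight (Y $ i $ k) * graph_value a (Y $ i))"

text \<open>The integrand of \<open>nn_integral_Delta_powr\<close> times \<open>p + 1\<close>,
  regrouped so that \<open>p\<close> occurs only in the power of the minor and in the factor of row
  \<open>k\<close>.\<close>

definition integrand :: "real \<Rightarrow> real^'n^'n \<Rightarrow> real^'n \<Rightarrow> ennreal" where
  "integrand p Y a = ennreal (\<bar>det (colmat k Y)\<bar> powr (1 + p)) *
     (unit_weight (a $ k) * (rows_product Y a * (unit_weight (Y $ k $ k) * smeared_value p a (Y $ k))))"

definition limit_integrand :: "real^'n^'n \<Rightarrow> real^'n \<Rightarrow> ennreal" where
  "limit_integrand Y a =
     unit_weight (a $ k) * (rows_product Y a * (unit_weight (Y $ k $ k) * (2 * graph_value a (Y $ k))))"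

definition dominant :: "real^'n^'n \<Rightarrow> real^'n \<Rightarrow> ennreal" where
  "dominant Y a = ennreal (fact CARD('n) * R ^ CARD('n)) * (ennreal (M * (12 * R\<^sup>2)) *
     (unit_weight (a $ k) * (rows_product Y a * row_bound a (Y $ k))))"

lemma borel_measurable_rows_product [measurable (raw)]:
  assumes [measurable]: "f \<in> borel_measurable L" "h \<in> borel_measurable L"
  shows "(\<lambda>x. rows_product (f x) (h x)) \<in> borel_measurable L"
  unfolding rows_product_def by measurable

lemma borel_measurable_integrands [measurable (raw)]:
  assumes [measurable]: "f \<in> borel_measurable L" "h \<in> borel_measurable L"
  shows "(\<lambda>x. integrand p (f x) (h x)) \<in> borel_measurable L"
    "(\<lambda>x. limit_integrand (f x) (h x)) \<in> borel_measurable L"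
    "(\<lambda>x. dominant (f x) (h x)) \<in> borel_measurable L"
  unfolding integrand_def limit_integrand_def dominant_def by measurable

lemma Delta_moment_eq:
  assumes "p > -1"
  shows "Delta_moment g p = ennreal (1 / CARD('n)) * (\<integral>\<^sup>+Y. \<integral>\<^sup>+a. integrand p Y a \<partial>lborel \<partial>lborel)"
proof -
  let ?S = "\<lambda>Y a. \<integral>\<^sup>+s. ennreal (\<bar>s\<bar> powr p * g (vupd (Y $ k) k (lin k a (Y $ k) + s))) \<partial>lborel"
  let ?f = "\<lambda>Y a. (\<Prod>i\<in>UNIV. unit_weight (Y $ i $ k)) * unit_weight (a $ k) *
        ennreal (\<bar>det (colmat k Y)\<bar> powr (1 + p)) *
        (\<Prod>i\<in>UNIV-{k}. ennreal (g (vupd (Y $ i) k (lin k a (Y $ i))))) * ?S Y a"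
  have const: "ennreal ((p + 1) / real CARD('n)) = ennreal (1 / CARD('n)) * ennreal (p + 1)"
    using assms by (simp add: ennreal_mult'[symmetric])
  have f: "ennreal (p + 1) * ?f Y a = integrand p Y a" for Y a
  proof -
    have "(\<Prod>i\<in>UNIV. unit_weight (Y $ i $ k)) = unit_weight (Y $ k $ k) * (\<Prod>i\<in>UNIV-{k}. unit_weight (Y $ i $ k))"
      by (rule prod.remove) auto
    then show ?thesis
      by (simp only: integrand_def rows_product_def prod.distrib graph_value_def smeared_value_def
          mult.assoc mult.commute mult.left_commute)
  qed
  have [measurable]: "(\<lambda>z. ?f (fst z) (snd z)) \<in> borel_measurable (lborel \<Otimes>\<^sub>M lborel)"
    by measurable
  have "Delta_moment g p = ennreal (1 / CARD('n)) * (ennreal (p + 1) * (\<integral>\<^sup>+Y. \<integral>\<^sup>+a. ?f Y a \<partial>lborel \<partial>lborel))"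
    unfolding Delta_moment_def nn_integral_Delta_powr[OF g_measurable g_nonneg, of p k] const mult.assoc[of _ "ennreal (p + 1)"] ..
  also have "ennreal (p + 1) * (\<integral>\<^sup>+Y. \<integral>\<^sup>+a. ?f Y a \<partial>lborel \<partial>lborel)
      = (\<integral>\<^sup>+Y. \<integral>\<^sup>+a. ennreal (p + 1) * ?f Y a \<partial>lborel \<partial>lborel)"
  proof -
    have "ennreal (p + 1) * (\<integral>\<^sup>+Y. \<integral>\<^sup>+a. ?f Y a \<partial>lborel \<partial>lborel)
        = (\<integral>\<^sup>+Y. ennreal (p + 1) * (\<integral>\<^sup>+a. ?f Y a \<partial>lborel) \<partial>lborel)"
      by (rule nn_integral_cmult[symmetric]) measurable
    also have "\<dots> = (\<integral>\<^sup>+Y. \<integral>\<^sup>+a. ennreal (p + 1) * ?f Y a \<partial>lborel \<partial>lborel)"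
      by (rule nn_integral_cong, rule nn_integral_cmult[symmetric]) measurable
    finally show ?thesis .
  qed
  finally show ?thesis unfolding f .
qed

text \<open>Where the bound for the rows is nonzero, all entries of \<open>Y\<close> outside column
  \<open>k\<close> are at most \<open>R\<close>, so the minor is at most \<open>?C\<close>. Since
  \<open>?C \<ge> 1\<close> and \<open>0 < 1 + p \<le> 1\<close>, its power is at most
  \<open>?C\<close> too.\<close>

lemma integrand_le_dominant:
  assumes p: "-1 < p" "p \<le> -1/2"
  shows "integrand p Y a \<le> dominant Y a"
proof -
  let ?d = "\<bar>det (colmat k Y)\<bar>" and ?C = "fact CARD('n) * R ^ CARD('n)"
  let ?r = "rows_product Y a * row_bound a (Y $ k)"
  have "rows_product Y a * (unit_weight (Y $ k $ k) * smeared_value p a (Y $ k))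
      \<le> rows_product Y a * (ennreal (M * (12 * R\<^sup>2)) * row_bound a (Y $ k))"
    by (intro mult_left_mono weighted_smeared_value_le p) simp
  then have le: "integrand p Y a \<le> ennreal (?d powr (1 + p)) * (ennreal (M * (12 * R\<^sup>2)) * (unit_weight (a $ k) * ?r))"
    unfolding integrand_def by (subst (3) mult.left_commute) (intro mult_left_mono, simp_all add: mult.left_commute)
  show ?thesis
  proof (cases "?r = 0")
    case True
    then have "integrand p Y a \<le> 0" using le by (simp only: mult_zero_right)
    then show ?thesis by simp
  next
    case False
    have Y: "\<bar>Y $ i $ j\<bar> \<le> R" if "j \<noteq> k" for i j
    proof (cases "i = k")
      case True
      then show ?thesis
        using box_weight_nonzeroD[of "Y $ k" j] False that by (auto simp: row_bound_def)
    next
      case ik: False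
      have "graph_value a (Y $ i) \<noteq> 0"
        using False ik by (auto simp: rows_product_def)
      then show ?thesis using graph_value_nonzeroD(1) that by blast
    qed
    have "\<bar>colmat k Y $ i $ j\<bar> \<le> R" for i j
      using Y[of j i] R_ge by (cases "j = k") (auto simp: colmat_def axis_def)
    then have d: "?d \<le> ?C" by (rule abs_det_le)
    have C: "?C \<ge> 1"
      using mult_mono[of 1 "fact CARD('n)" 1 "R ^ CARD('n)"] R_ge by (simp add: one_le_power)
    have "?d powr (1 + p) \<le> ?C powr (1 + p)"
      using d p by (intro powr_mono2) auto
    also have "\<dots> \<le> ?C powr 1"
      using C p by (intro powr_mono) auto
    also have "\<dots> = ?C" using C by simp
    finally have "ennreal (?d powr (1 + p)) \<le> ennreal ?C" by (rule ennreal_leI)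
    then have "ennreal (?d powr (1 + p)) * (ennreal (M * (12 * R\<^sup>2)) * (unit_weight (a $ k) * ?r)) \<le> dominant Y a"
      unfolding dominant_def by (rule mult_right_mono) simp
    with le show ?thesis by (rule order_trans)
  qed
qed

text \<open>For fixed slopes the rows separate, and each row other than \<open>k\<close> contributes
  one factor \<open>G a\<close>.\<close>

lemma nn_integral_rows:
  assumes [measurable]: "F \<in> borel_measurable borel"
  shows "(\<integral>\<^sup>+Y. rows_product Y a * F (Y $ k) \<partial>lborel) = G a ^ (CARD('n) - 1) * (\<integral>\<^sup>+y. F y \<partial>lborel)"
proof -
  define w where "w i = (if i = k then F else (\<lambda>y. unit_weight (y $ k) * graph_value a y))" for i
  have [measurable]: "w i \<in> borel_measurable borel" for i by (simp add: w_def)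
  have "rows_product Y a * F (Y $ k) = (\<Prod>i\<in>UNIV. w i (Y $ i))" for Y
  proof -
    have "(\<Prod>i\<in>UNIV. w i (Y $ i)) = w k (Y $ k) * (\<Prod>i\<in>UNIV-{k}. w i (Y $ i))"
      by (rule prod.remove) auto
    also have "(\<Prod>i\<in>UNIV-{k}. w i (Y $ i)) = rows_product Y a"
      unfolding rows_product_def by (intro prod.cong) (auto simp: w_def)
    finally show ?thesis by (simp add: w_def mult.commute)
  qed
  then have "(\<integral>\<^sup>+Y. rows_product Y a * F (Y $ k) \<partial>lborel) = (\<Prod>i\<in>UNIV. \<integral>\<^sup>+y. w i y \<partial>lborel)"
    by (simp add: nn_integral_lborel_vec_prod)
  also have "\<dots> = (\<integral>\<^sup>+y. w k y \<partial>lborel) * (\<Prod>i\<in>UNIV-{k}. \<integral>\<^sup>+y. w i y \<partial>lborel)"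
    by (rule prod.remove) auto
  also have "(\<Prod>i\<in>UNIV-{k}. \<integral>\<^sup>+y. w i y \<partial>lborel) = (\<Prod>i\<in>UNIV-{k}. G a)"
    unfolding G_eq by (intro prod.cong) (auto simp: w_def)
  finally show ?thesis by (simp add: w_def card_Diff_singleton mult.commute)
qed

text \<open>The slopes are integrated last: integrating over the rows first leaves the quantity
  whose decay in \<open>a\<close> has been established.\<close>

lemma nn_integral_dominant_finite: "(\<integral>\<^sup>+z. dominant (fst z) (snd z) \<partial>(lborel \<Otimes>\<^sub>M lborel)) < \<infinity>"
proof -
  have "(\<integral>\<^sup>+z. dominant (fst z) (snd z) \<partial>(lborel \<Otimes>\<^sub>M lborel)) = (\<integral>\<^sup>+a. \<integral>\<^sup>+Y. dominant Y a \<partial>lborel \<partial>lborel)"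
    using lborel_pair.nn_integral_snd[of "\<lambda>z. dominant (fst z) (snd z)"] by simp
  also have "\<dots> = (\<integral>\<^sup>+a. ennreal (fact CARD('n) * R ^ CARD('n)) * (ennreal (M * (12 * R\<^sup>2)) *
     (unit_weight (a $ k) * (G a ^ (CARD('n) - 1) * (\<integral>\<^sup>+y. row_bound a y \<partial>lborel)))) \<partial>lborel)"
    unfolding dominant_def by (intro nn_integral_cong) (simp add: nn_integral_cmult nn_integral_rows)
  also have "\<dots> = ennreal (fact CARD('n) * R ^ CARD('n)) * (ennreal (M * (12 * R\<^sup>2)) *
     (\<integral>\<^sup>+a. unit_weight (a $ k) * (G a ^ (CARD('n) - 1) * (\<integral>\<^sup>+y. row_bound a y \<partial>lborel)) \<partial>lborel))"
    by (simp add: nn_integral_cmult)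
  also have "\<dots> < \<infinity>"
    using nn_integral_G_power_row_bound_finite by (simp add: ennreal_mult_less_top)
  finally show ?thesis .
qed

lemma nn_integral_limit_integrand:
  "(\<integral>\<^sup>+z. limit_integrand (fst z) (snd z) \<partial>(lborel \<Otimes>\<^sub>M lborel))
    = 2 * (\<integral>\<^sup>+a. unit_weight (a $ k) * G a ^ CARD('n) \<partial>lborel)"
proof -
  have pow: "G a ^ (CARD('n) - 1) * G a = G a ^ CARD('n)" for a
    using dim_ge by (metis not_numeral_le_zero neq0_conv power_minus_mult)
  have "(\<integral>\<^sup>+z. limit_integrand (fst z) (snd z) \<partial>(lborel \<Otimes>\<^sub>M lborel)) = (\<integral>\<^sup>+a. \<integral>\<^sup>+Y. limit_integrand Y a \<partial>lborel \<partial>lborel)"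
    using lborel_pair.nn_integral_snd[of "\<lambda>z. limit_integrand (fst z) (snd z)"] by simp
  also have "\<dots> = (\<integral>\<^sup>+a. 2 * (unit_weight (a $ k) * G a ^ CARD('n)) \<partial>lborel)"
  proof (rule nn_integral_cong)
    fix a :: "real^'n"
    have "(\<integral>\<^sup>+Y. limit_integrand Y a \<partial>lborel)
        = unit_weight (a $ k) * (\<integral>\<^sup>+Y. rows_product Y a * (unit_weight (Y $ k $ k) * (2 * graph_value a (Y $ k))) \<partial>lborel)"
      unfolding limit_integrand_def by (rule nn_integral_cmult) measurable
    also have "(\<integral>\<^sup>+Y. rows_product Y a * (unit_weight (Y $ k $ k) * (2 * graph_value a (Y $ k))) \<partial>lborel)
        = G a ^ (CARD('n) - 1) * (\<integral>\<^sup>+y. unit_weight (y $ k) * (2 * graph_value a y) \<partial>lborel)"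
      by (rule nn_integral_rows) measurable
    also have "(\<integral>\<^sup>+y. unit_weight (y $ k) * (2 * graph_value a y) \<partial>lborel) = 2 * G a"
      by (simp add: G_eq nn_integral_cmult mult.left_commute[of _ 2])
    finally show "(\<integral>\<^sup>+Y. limit_integrand Y a \<partial>lborel) = 2 * (unit_weight (a $ k) * G a ^ CARD('n))"
      unfolding pow[symmetric] by (simp only: mult.assoc mult.commute mult.left_commute)
  qed
  finally show ?thesis by (simp add: nn_integral_cmult)
qed

lemma smeared_value_tendsto:
  assumes "isCont g (vupd y k (lin k a y))"
  shows "((\<lambda>p. smeared_value p a y) \<longlongrightarrow> 2 * graph_value a y) (at_right (-1))"
proof -
  let ?L = "lin k a y"
  have eq: "vupd y k t = y + (t - y $ k) *\<^sub>R axis k 1" for t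
    by (simp add: vec_eq_iff axis_def)
  have "isCont (\<lambda>s. vupd y k (?L + s)) 0"
    unfolding eq by (intro continuous_intros)
  moreover have "isCont g (vupd y k (?L + 0))" using assms by simp
  ultimately have "isCont (\<lambda>s. g (vupd y k (?L + s))) 0"
    by (rule isCont_o2)
  then have "((\<lambda>p. smeared_value p a y) \<longlongrightarrow> ennreal (2 * g (vupd y k (?L + 0)))) (at_right (-1))"
    unfolding smeared_value_def
  proof (rule powr_kernel_tendsto[rotated -1, where M = M and B = "R + \<bar>?L\<bar>"])
    fix s assume "g (vupd y k (?L + s)) \<noteq> 0"
    from g_support[OF this, of k] show "\<bar>s\<bar> \<le> R + \<bar>?L\<bar>" by simp
  qed (auto simp: g_nonneg g_le)
  then show ?thesis
    using ennreal_mult'[of 2 "g (vupd y k ?L)"] by (simp add: graph_value_def)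
qed

text \<open>A nonzero minor has power tending to 1, and the factor of row \<open>k\<close> converges
  by continuity at the graph point. Where the weight of row \<open>k\<close> vanishes, integrand and
  limit are both 0.\<close>

lemma integrand_tendsto:
  assumes det: "det (colmat k Y) \<noteq> 0"
    and cont: "unit_weight (Y $ k $ k) = 0 \<or> isCont g (vupd (Y $ k) k (lin k a (Y $ k)))"
  shows "((\<lambda>p. integrand p Y a) \<longlongrightarrow> limit_integrand Y a) (at_right (-1))"
  using cont
proof
  assume cont: "isCont g (vupd (Y $ k) k (lin k a (Y $ k)))"
  \<comment> \<open>The factors free of \<open>p\<close> are collected because multiplication in
    \<open>ennreal\<close> is continuous in this argument only for a finite constant.\<close>
  define c where "c = unit_weight (a $ k) * (rows_product Y a * unit_weight (Y $ k $ k))"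
  have w: "unit_weight t < \<top>" for t by (simp add: unit_weight_def indicator_def)
  have "(\<Prod>i\<in>A. unit_weight (Y $ i $ k) * graph_value a (Y $ i)) < \<top>" for A
    using w by (induction A rule: infinite_finite_induct) (auto simp: graph_value_def ennreal_mult_less_top)
  from this[of "UNIV - {k}"] have "c < \<top>"
    using w by (simp add: c_def rows_product_def ennreal_mult_less_top)
  then have c: "c \<noteq> \<top>" by simp
  have lim_c: "((\<lambda>p. c * smeared_value p a (Y $ k)) \<longlongrightarrow> c * (2 * graph_value a (Y $ k))) (at_right (-1))"
    using c by (intro ennreal_tendsto_cmult smeared_value_tendsto[OF cont]) (simp add: less_top)
  have "((\<lambda>p. \<bar>det (colmat k Y)\<bar> powr (1 + p)) \<longlongrightarrow> 1) (at_right (-1))"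
    using det by (auto intro!: tendsto_eq_intros)
  then have lim_d: "((\<lambda>p. ennreal (\<bar>det (colmat k Y)\<bar> powr (1 + p))) \<longlongrightarrow> 1) (at_right (-1))"
    by (metis ennreal_1 tendsto_ennrealI)
  have "((\<lambda>p. ennreal (\<bar>det (colmat k Y)\<bar> powr (1 + p)) * (c * smeared_value p a (Y $ k)))
      \<longlongrightarrow> 1 * (c * (2 * graph_value a (Y $ k)))) (at_right (-1))"
    using c by (intro tendsto_mult_ennreal lim_c lim_d) (auto simp: graph_value_def ennreal_mult_eq_top_iff)
  then show ?thesis
    by (simp add: integrand_def limit_integrand_def c_def mult.assoc)
qed (simp add: integrand_def limit_integrand_def)

text \<open>The moments and the volume are \<open>1 / n\<close> times integrals over the same space
  of pairs \<open>(Y, a)\<close>. Almost every pair has nonzero minor and does not send a weighted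
  row \<open>k\<close> into \<open>N\<close>, so dominated convergence applies.\<close>

lemma Delta_moment_tendsto:
  assumes N: "N \<in> null_sets lborel" "\<And>x. x \<notin> N \<Longrightarrow> isCont g x"
  shows "(Delta_moment g \<longlongrightarrow> emeasure lebesgue (I_body g)) (at_right (-1))"
    and "emeasure lebesgue (I_body g) < \<infinity>"
proof -
  let ?P = "lborel \<Otimes>\<^sub>M lborel :: ((real^'n^'n) \<times> (real^'n)) measure"
  let ?I = "\<integral>\<^sup>+z. limit_integrand (fst z) (snd z) \<partial>?P"
  have [measurable]: "N \<in> sets borel" using N(1) by auto
  obtain j where j: "j \<noteq> k" using ex_other_index by blast
  have I_body: "emeasure lebesgue (I_body g) = ennreal (1 / CARD('n)) * ?I"
  proof -
    have "emeasure lebesgue (I_body g) = ennreal (2 / CARD('n)) * (\<integral>\<^sup>+a. unit_weight (a $ k) * G a ^ CARD('n) \<partial>lborel)"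
      by (rule emeasure_I_body[OF g_measurable g_nonneg G_finite dim_ge])
    also have "ennreal (2 / CARD('n)) = ennreal (1 / CARD('n)) * 2"
      using ennreal_mult'[of "1 / CARD('n)" 2] by simp
    finally show ?thesis by (simp only: nn_integral_limit_integrand mult.assoc)
  qed
  have AE_det: "AE z in ?P. det (colmat k (fst z)) \<noteq> 0"
  proof (rule lborel_pair.AE_pair_measure)
    show "{z \<in> space ?P. det (colmat k (fst z)) \<noteq> 0} \<in> sets ?P" by measurable
  qed (use AE_det_colmat_nonzero[of k] in auto)
  have "(\<integral>\<^sup>+z. unit_weight (fst z $ k $ k) * indicator N (vupd (fst z $ k) k (lin k (snd z) (fst z $ k))) \<partial>?P) = 0"
    using nn_integral_graph_null[OF N(1) j]
      lborel.nn_integral_fst[of "\<lambda>z. unit_weight (fst z $ k $ k) * indicator N (vupd (fst z $ k) k (lin k (snd z) (fst z $ k)))" "lborel :: (real^'n^'n) measure"]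
    by simp
  then have AE_N: "AE z in ?P. unit_weight (fst z $ k $ k) * indicator N (vupd (fst z $ k) k (lin k (snd z) (fst z $ k))) = 0"
    by (subst (asm) nn_integral_0_iff_AE) auto
  have AE_lim: "AE z in ?P. ((\<lambda>p. integrand p (fst z) (snd z)) \<longlongrightarrow> limit_integrand (fst z) (snd z)) (at_right (-1))"
    using AE_det AE_N
  proof eventually_elim
    case (elim z)
    then have "unit_weight (fst z $ k $ k) = 0 \<or> isCont g (vupd (fst z $ k) k (lin k (snd z) (fst z $ k)))"
      using N(2) by (auto simp: indicator_def split: if_splits)
    with elim(1) show ?case by (rule integrand_tendsto)
  qed
  have range: "\<forall>\<^sub>F p in at_right (-1). -1 < p \<and> p \<le> (-1/2 :: real)"
    by (auto simp: eventually_at_right[of "-1" 0] intro!: exI[of _ "-1/2"])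
  have int_lim: "((\<lambda>p. \<integral>\<^sup>+z. integrand p (fst z) (snd z) \<partial>?P) \<longlongrightarrow> ?I) (at_right (-1))"
  \<comment> \<open>Dominated convergence concerns sequences, so the limit is checked along
    sequences tending to -1. The upper end \<open>-1/2\<close> keeps \<open>p\<close> in the range
    of the majorant.\<close>
  proof (rule tendsto_at_right_sequentially[of "-1" "-1/2"])
    fix S :: "nat \<Rightarrow> real"
    assume S: "\<And>n. -1 < S n" "\<And>n. S n < -1/2" "S \<longlonglongrightarrow> -1"
    have S': "filterlim S (at_right (-1)) sequentially"
    proof -
      have "S n \<noteq> -1" for n using S(1)[of n] by simp
      then show ?thesis using S(1,3) by (auto simp: filterlim_at)
    qed
    show "(\<lambda>n. \<integral>\<^sup>+z. integrand (S n) (fst z) (snd z) \<partial>?P) \<longlonglongrightarrow> ?I"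
    proof (rule nn_integral_dominated_convergence)
      show "AE z in ?P. integrand (S n) (fst z) (snd z) \<le> dominant (fst z) (snd z)" for n
        using S(1)[of n] S(2)[of n] by (intro always_eventually allI integrand_le_dominant) auto
      show "AE z in ?P. (\<lambda>n. integrand (S n) (fst z) (snd z)) \<longlonglongrightarrow> limit_integrand (fst z) (snd z)"
        using AE_lim by eventually_elim (rule filterlim_compose[OF _ S'])
    qed (use nn_integral_dominant_finite in auto)
  qed simp
  have "((\<lambda>p. ennreal (1 / CARD('n)) * (\<integral>\<^sup>+z. integrand p (fst z) (snd z) \<partial>?P)) \<longlongrightarrow> ennreal (1 / CARD('n)) * ?I) (at_right (-1))"
    by (intro ennreal_tendsto_cmult int_lim) simp
  then show "(Delta_moment g \<longlongrightarrow> emeasure lebesgue (I_body g)) (at_right (-1))"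
    unfolding I_body
  proof (rule Lim_transform_eventually)
    show "\<forall>\<^sub>F p in at_right (-1). ennreal (1 / CARD('n)) * (\<integral>\<^sup>+z. integrand p (fst z) (snd z) \<partial>?P) = Delta_moment g p"
      using range
    proof eventually_elim
      case (elim p)
      have "(\<integral>\<^sup>+Y. \<integral>\<^sup>+a. integrand p Y a \<partial>lborel \<partial>lborel) = (\<integral>\<^sup>+z. integrand p (fst z) (snd z) \<partial>?P)"
        using lborel.nn_integral_fst[of "\<lambda>z. integrand p (fst z) (snd z)" "lborel :: (real^'n^'n) measure"] by simp
      then show ?case using elim by (simp add: Delta_moment_eq)
    qed
  qed
  \<comment> \<open>The pointwise limit inherits the integrable majorant, which also makes the
    volume finite.\<close>
  have "?I \<le> (\<integral>\<^sup>+z. dominant (fst z) (snd z) \<partial>?P)"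
  proof (rule nn_integral_mono_AE, use AE_lim in eventually_elim)
    fix z assume "((\<lambda>p. integrand p (fst z) (snd z)) \<longlongrightarrow> limit_integrand (fst z) (snd z)) (at_right (-1))"
    then show "limit_integrand (fst z) (snd z) \<le> dominant (fst z) (snd z)"
      by (rule tendsto_upperbound) (use range in \<open>auto elim!: eventually_mono intro: integrand_le_dominant\<close>)
  qed
  then have "?I < \<infinity>" using nn_integral_dominant_finite by (rule le_less_trans)
  then show "emeasure lebesgue (I_body g) < \<infinity>"
    unfolding I_body by (simp add: ennreal_mult_less_top)
qed

end

section \<open>Continuous functions and indicators as bounded densities\<close>

lemma bounded_density_continuous:
  fixes f :: "real^'n \<Rightarrow> real"
  assumes "CARD('n) \<ge> 2" and cont: "continuous_on UNIV f" and nonneg: "\<And>x. f x \<ge> 0"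
    and supp: "compact (closure {x. f x \<noteq> 0})"
  shows "\<exists>M R. bounded_density f M R"
proof -
  let ?S = "closure {x. f x \<noteq> 0}"
  have "bounded (f ` ?S)"
    using supp cont by (intro compact_imp_bounded compact_continuous_image) (auto intro: continuous_on_subset)
  then obtain M where M: "\<And>x. x \<in> ?S \<Longrightarrow> \<bar>f x\<bar> \<le> M" "M > 0"
    by (auto simp: bounded_pos)
  obtain R where R: "\<And>x. x \<in> ?S \<Longrightarrow> norm x \<le> R"
    using compact_imp_bounded[OF supp] by (auto simp: bounded_iff)
  have in_S: "x \<in> ?S" if "f x \<noteq> 0" for x
    using that closure_subset[of "{x. f x \<noteq> 0}"] by auto
  have "bounded_density f M (max 1 R)"
  proof
    show "f \<in> borel_measurable borel" using cont by (rule borel_measurable_continuous_onI)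
    fix x
    show "f x \<le> M"
    proof (cases "f x = 0")
      case False
      from M(1)[OF in_S[OF False]] show ?thesis by simp
    qed (use M(2) in simp)
    fix i assume "f x \<noteq> 0"
    then have "norm x \<le> max 1 R" using R[OF in_S, of x] by linarith
    then show "\<bar>x $ i\<bar> \<le> max 1 R" using component_le_norm_cart[of x i] by linarith
  qed (use assms in auto)
  then show ?thesis by blast
qed

lemma bounded_density_indicator:
  fixes K :: "(real^'n) set"
  assumes "CARD('n) \<ge> 2" and K: "compact K"
  shows "\<exists>M R. bounded_density (indicator K) M R"
proof -
  obtain R where R: "\<And>x. x \<in> K \<Longrightarrow> norm x \<le> R"
    using compact_imp_bounded[OF K] by (auto simp: bounded_iff)
  have "bounded_density (indicator K) 1 (max 1 R)"
  proof
    show "(indicator K :: real^'n \<Rightarrow> real) \<in> borel_measurable borel"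
      using K by (intro borel_measurable_indicator borel_compact)
    fix x :: "real^'n" and i assume "(indicator K x :: real) \<noteq> 0"
    then have "x \<in> K" by (simp add: indicator_eq_0_iff)
    then have "norm x \<le> max 1 R" using R[of x] by linarith
    then show "\<bar>x $ i\<bar> \<le> max 1 R" using component_le_norm_cart[of x i] by linarith
  qed (use assms in \<open>auto simp: indicator_def\<close>)
  then show ?thesis by blast
qed

theorem theorem1p9:
  fixes f :: "real^'n \<Rightarrow> real" and K :: "(real^'n) set"
  assumes "CARD('n) \<ge> 2"
    and "continuous_on UNIV f" and "\<And>x. f x \<ge> 0" and "compact (closure {x. f x \<noteq> 0})"
    and "compact K" and "radially_negligible_boundary K"
  shows "(\<forall>g \<in> {f, indicator K}. \<exists>L::ennreal. L < \<infinity> \<and> (Delta_moment g \<longlongrightarrow> L) (at_right (-1))) \<and>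
    emeasure lebesgue (I_body f) = I0 f \<and>
    emeasure lebesgue (I_body (indicator K)) = I0 (indicator K)"
proof -
  obtain M R where "bounded_density f M R"
    using bounded_density_continuous assms(1-4) by blast
  \<comment> \<open>The interpretation is generic in \<open>k\<close>: any coordinate can serve as
    the vertical one, and the limit obtained does not mention it.\<close>
  then interpret f: bounded_density f k M R for k .
  have lim_f: "(Delta_moment f \<longlongrightarrow> emeasure lebesgue (I_body f)) (at_right (-1))" "emeasure lebesgue (I_body f) < \<infinity>"
    using f.Delta_moment_tendsto[of "{}"] assms(2) by (simp_all add: continuous_on_eq_continuous_at)
  obtain M' R' where "bounded_density (indicator K) M' R'"
    using bounded_density_indicator assms(1,5) by blast
  then interpret K: bounded_density "indicator K" k M' R' for k .
  have lim_K: "(Delta_moment (indicator K) \<longlongrightarrow> emeasure lebesgue (I_body (indicator K))) (at_right (-1))"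
    "emeasure lebesgue (I_body (indicator K)) < \<infinity>"
    \<comment> \<open>Off the frontier of \<open>K\<close> its indicator is continuous, so the
      frontier serves as the exceptional null set.\<close>
    using K.Delta_moment_tendsto[OF null_sets_frontier_radially_negligible[OF assms(5,6)]]
    by (simp_all add: isCont_indicator)
  have "I0 f = emeasure lebesgue (I_body f)" "I0 (indicator K) = emeasure lebesgue (I_body (indicator K))"
    unfolding I0_def using lim_f(1) lim_K(1) by (auto intro!: tendsto_Lim)
  then show ?thesis
    using lim_f lim_K by (intro conjI ballI) auto
qed

end
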